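(* Let $\pi$ be a fixed meta-prior on $\mathcal{A}$, let $\mathfrak{P}(A)$, $A\in\mathcal{A}$, be a fixed (data-independent) family as below, and let $\delta>0$. Then with probability at least $1-\delta$ over the sampling of the training tasks and datasets, simultaneously for all meta-posteriors $\rho$ and all hyper-posteriors $\mathcal{Q}(A)$, $$\mathcal{R}^T_M(\rho)\;\le\;\mathrm{kl}^{-1}_n\!\left(\mathrm{kl}^{-1}_{m_1,\dots,m_n}\Big(\widehat{\mathcal{R}}_1(\rho),\dots,\widehat{\mathcal{R}}_n(\rho)\,\Big|\,C(\rho)+c_1\Big)\,\Big|\,\mathrm{KL}(\rho\|\pi)+\log\frac{4\sqrt n}{\delta}\right),$$ where $C(\rho)=\mathrm{KL}(\rho\|\pi)+\mathbb{E}_{A\sim\rho}\big[\mathrm{KL}(\mathfrak{Q}(A)\|\mathfrak{P}(A))\big]+\log\frac2\delta$ and $c_1=\sum_{i=1}^n\log(2\sqrt{m_i})$.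
   Context: Meta-learning setting: $\tau$ is an unknown environment distribution over triples $(D,m,S)$, where $D$ is a distribution on $\mathcal{Z}$, $m\in\{1,\dots,m_{\max}\}$ and, given $(D,m)$, $S$ consists of $m$ i.i.d. samples from $D$. Training tasks $(D_i,m_i,S_i)$, $i=1,\dots,n$, are i.i.d. from $\tau$. A loss $\ell:\mathcal{F}\times\mathcal{Z}\to[0,1]$ is fixed; for a distribution $Q$ on $\mathcal{F}$, $\ell(z,Q)=\mathbb{E}_{f\sim Q}\ell(f,z)$. $\mathcal{A}$ is a set of algorithms; each $A\in\mathcal{A}$ maps a dataset $S$ to a posterior $A(S)\in\mathcal{M}(\mathcal{F})$ (distributions on $\mathcal{F}$). A meta-prior $\pi$ (data-independent) and meta-posterior $\rho$ are distributions on $\mathcal{A}$. For each $A$: $\mathcal{P}(A)$ is a data-independent hyper-prior (distribution on $\mathcal{M}(\mathcal{F})$) and $\mathcal{Q}(A)$ a data-dependent hyper-posterior; $\mathfrak{Q}(A)=\mathcal{Q}(A)\times A(S_1)\times\cdots\times A(S_n)$ on $\mathcal{M}(\mathcal{F})\times\mathcal{F}^n$, and $\mathfrak{P}(A)$ is generated by $P\sim\mathcal{P}(A)$, then $f_1,\dots,f_n$ i.i.d. $\sim P$. Empirical risks: $\widehat{\mathcal{R}}_i(\rho)=\mathbb{E}_{A\sim\rho}\frac1{m_i}\sum_{z\in S_i}\ell(z,A(S_i))$. Task-centric meta-risk: $\mathcal{R}^T_M(\rho)=\mathbb{E}_{A\sim\rho}\mathbb{E}_{(D,m,S)\sim\tau}\mathbb{E}_{z\sim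 D}\ell(z,A(S))$. $\mathrm{kl}(q|p)=q\log\frac qp+(1-q)\log\frac{1-q}{1-p}$. Inverses: $\mathrm{kl}^{-1}_{m_1,\dots,m_n}(q_1,\dots,q_n|b)=\sup\{\frac1n\sum_i p_i:\sum_i m_i\mathrm{kl}(q_i|p_i)\le b,\ p_i\in[0,1]\}$, and for a single integer $N$, $\mathrm{kl}^{-1}_N(q|b)=\sup\{p\in[0,1]:N\,\mathrm{kl}(q|p)\le b\}$. $\mathrm{KL}$ is the Kullback–Leibler divergence. *)

theory Defs
  imports "HOL-Probability.Probability"
begin

definition kl_term :: "real \<Rightarrow> real \<Rightarrow> ereal" where
  "kl_term a b = (if a = 0 then 0 else if b = 0 then \<infinity> else ereal (a * ln (a / b)))"

definition kl :: "real \<Rightarrow> real \<Rightarrow> ereal" where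
  "kl q p = kl_term q p + kl_term (1 - q) (1 - p)"

definition kl_inv_multi :: "nat \<Rightarrow> (nat \<Rightarrow> nat) \<Rightarrow> (nat \<Rightarrow> real) \<Rightarrow> ereal \<Rightarrow> ereal" where
  "kl_inv_multi n m q b =
     Sup {ereal ((1 / real n) * (\<Sum>i<n. p i)) | p.
            (\<forall>i<n. p i \<in> {0..1}) \<and> (\<Sum>i<n. ereal (real (m i)) * kl (q i) (p i)) \<le> b}"

definition kl_inv :: "nat \<Rightarrow> real \<Rightarrow> ereal \<Rightarrow> ereal" where
  "kl_inv N q b = Sup {ereal p | p. p \<in> {0..1} \<and> ereal (real N) * kl q p \<le> b}"

definition KLdiv :: "'a measure \<Rightarrow> 'a measure \<Rightarrow> ereal" where
  "KLdiv N M =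
     (if sets N = sets M \<and> absolutely_continuous M N
         \<and> integrable N (entropy_density (exp 1) M N)
      then ereal (KL_divergence (exp 1) M N) else \<infinity>)"

definition dataset :: "nat \<Rightarrow> (nat \<Rightarrow> 'z) \<Rightarrow> 'z list" where
  "dataset m S = map S [0..<m]"

definition task_space :: "'z measure \<Rightarrow> nat \<Rightarrow> (('z measure \<times> nat) \<times> (nat \<Rightarrow> 'z)) measure" where
  "task_space Z mmax = (prob_algebra Z \<Otimes>\<^sub>M count_space {1..mmax}) \<Otimes>\<^sub>M (\<Pi>\<^sub>M i\<in>UNIV. Z)"

text \<open>The environment tau: (D, m) drawn from tau0, then i.i.d. samples from D
  (of which the first m form the dataset S).\<close>
definition env :: "('z measure \<times> nat) measure \<Rightarrow> 'z measure \<Rightarrow> nat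
                    \<Rightarrow> (('z measure \<times> nat) \<times> (nat \<Rightarrow> 'z)) measure" where
  "env tau0 Z mmax = bind tau0 (\<lambda>Dm. distr (\<Pi>\<^sub>M i\<in>UNIV. fst Dm) (task_space Z mmax) (\<lambda>S. (Dm, S)))"

definition lossQ :: "('f \<Rightarrow> 'z \<Rightarrow> real) \<Rightarrow> 'z \<Rightarrow> 'f measure \<Rightarrow> real" where
  "lossQ l z Q = (\<integral>f. l f z \<partial>Q)"

definition emp_risk :: "('f \<Rightarrow> 'z \<Rightarrow> real) \<Rightarrow> ('a \<Rightarrow> 'z list \<Rightarrow> 'f measure)
     \<Rightarrow> (nat \<Rightarrow> ('z measure \<times> nat) \<times> (nat \<Rightarrow> 'z)) \<Rightarrow> 'a measure \<Rightarrow> nat \<Rightarrow> real" where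
  "emp_risk l alg \<omega> \<rho> i =
     (let m = snd (fst (\<omega> i)); S = snd (\<omega> i) in
      \<integral>A. (1 / real m) * (\<Sum>j<m. lossQ l (S j) (alg A (dataset m S))) \<partial>\<rho>)"

definition task_risk :: "('f \<Rightarrow> 'z \<Rightarrow> real) \<Rightarrow> ('a \<Rightarrow> 'z list \<Rightarrow> 'f measure)
     \<Rightarrow> (('z measure \<times> nat) \<times> (nat \<Rightarrow> 'z)) measure \<Rightarrow> 'a measure \<Rightarrow> real" where
  "task_risk l alg \<tau> \<rho> =
     (\<integral>A. (\<integral>t. (\<integral>z. lossQ l z (alg A (dataset (snd (fst t)) (snd t))) \<partial>(fst (fst t))) \<partial>\<tau>) \<partial>\<rho>)"

definition joint_space :: "'f measure \<Rightarrow> nat \<Rightarrow> ('f measure \<times> (nat \<Rightarrow> 'f)) measure" where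
  "joint_space F n = prob_algebra F \<Otimes>\<^sub>M (\<Pi>\<^sub>M i\<in>{..<n}. F)"

definition hyper_post_joint :: "('a \<Rightarrow> 'z list \<Rightarrow> 'f measure) \<Rightarrow> nat
     \<Rightarrow> (nat \<Rightarrow> ('z measure \<times> nat) \<times> (nat \<Rightarrow> 'z)) \<Rightarrow> 'f measure measure \<Rightarrow> 'a
     \<Rightarrow> ('f measure \<times> (nat \<Rightarrow> 'f)) measure" where
  "hyper_post_joint alg n \<omega> QA A =
     QA \<Otimes>\<^sub>M (\<Pi>\<^sub>M i\<in>{..<n}. alg A (dataset (snd (fst (\<omega> i))) (snd (\<omega> i))))"

definition hyper_prior_joint :: "'f measure \<Rightarrow> nat \<Rightarrow> 'f measure measure
     \<Rightarrow> ('f measure \<times> (nat \<Rightarrow> 'f)) measure" where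
  "hyper_prior_joint F n PA =
     bind PA (\<lambda>P. distr (\<Pi>\<^sub>M i\<in>{..<n}. P) (joint_space F n) (\<lambda>fs. (P, fs)))"

end

theory Submission
  imports Defs "HOL-Real_Asymp.Real_Asymp"
begin

text \<open>
  The binary divergence is regularised to \<open>skl\<close>, which is finite and jointly convex and increases to
  \<open>kl\<close> as the shift vanishes. For a mean of \<open>m\<close> independent \<open>[0,1]\<close>-valued variables,
  \<open>exp (m * skl)\<close> has expectation at most \<open>2 * sqrt m\<close>: convexity reduces this to Bernoulli variables,
  where it says that the Krichevsky--Trofimov mixture dominates the maximum likelihood up to the factor \<open>2 * sqrt m\<close>.
  The change of measure inequality of Donsker and Varadhan, Markov's inequality and Jensen's inequality then
  give one bound within the tasks (through the hypotheses \<open>f\<^sub>1, ..., f\<^sub>n\<close>) and one across the tasks (through \<open>A\<close> alone),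
  each failing with probability at most \<open>\<delta> / 2\<close>.

  The hyper-priors are not assumed to depend measurably on \<open>A\<close>, so Fubini's theorem cannot be applied directly
  within the tasks. Instead, the exponential moment is dominated, uniformly in the hypotheses, by
  functions that take only finitely many values as functions of the data. Choosing one bad data set in
  each of the finitely many cells, only measurability in \<open>A\<close> for fixed data is needed, and the
  prior enters through a bound that holds for every single \<open>A\<close>.
\<close>

section \<open>A sum of binomial likelihood maxima\<close>

text \<open>The exceptional event must be fixed before the hyper-posterior \<open>Q\<close> is seen,
  and the weight exp (- KL) induced by \<open>Q\<close> is measurable in \<open>A\<close> only for
  each fixed data set. Within the tasks, Markov's inequality is therefore applied to a finite
  selection of violations, not to a supremum over \<open>Q\<close>; the price is an arbitrarily
  small excess over the failure probability \<delta> / 2. The shift brings a second defect: every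
  shift has its own exceptional event. Both defects vanish at the end. Data that escape infinitely
  many of these events are kept; they have probability at least 1 - \<delta>, and the inequalities
  pass to the limit because their right-hand sides do not contain the shift. The two levels meet
  only in the true risks of the \<open>n\<close> observed tasks: one bound makes them feasible for
  the inner inverse, the other compares their mean with the meta-risk. The constants are a moment
  bound divided by \<delta> / 2: 2 / \<delta> comes from the moment 1, and 4 sqrt n / \<delta> from
  the moment 2 sqrt n.\<close>

lemma ln_ratio_ge: 
  fixes x :: real assumes "x > 0"
  shows "1 / (x + 1/2) \<le> ln (x + 1) - ln x"
proof -
  \<comment> \<open>The claim is the midpoint rule for the convex function 1 / t on [x, x + 1]. The
    gap decreases in x, because z (z + 1) \<le> (z + 1/2)^2, and it vanishes at infinity, so it is
    nonnegative.\<close>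
  define f where "f = (\<lambda>x::real. ln (x + 1) - ln x - 1 / (x + 1/2))"
  have lim: "(f \<longlongrightarrow> 0) at_top" unfolding f_def by real_asymp
  have "f y \<le> f x" if "x \<le> y" for y
  proof (rule DERIV_nonpos_imp_nonincreasing[OF that])
    fix z assume z: "x \<le> z" "z \<le> y"
    with assms have "z > 0" by simp
    then have "(f has_real_derivative (1/(z+1) - 1/z + 1/(z+1/2)^2)) (at z)"
      unfolding f_def by (auto intro!: derivative_eq_intros simp: power2_eq_square)
    moreover have "1/(z+1) - 1/z + 1/(z+1/2)^2 \<le> 0"
      using \<open>z > 0\<close> by (simp add: divide_simps) (simp add: algebra_simps power2_eq_square)
    ultimately show "\<exists>d. (f has_real_derivative d) (at z) \<and> d \<le> 0" by blast
  qed
  then have "eventually (\<lambda>y. f y \<le> f x) at_top"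
    using eventually_ge_at_top[of x] by (rule eventually_mono[rotated])
  from tendsto_upperbound[OF lim this] have "0 \<le> f x" by simp
  then show ?thesis by (simp add: f_def)
qed

text \<open>The derivative is exactly the gap in \<open>ln_ratio_ge\<close>. The expression is the
  logarithm of \<open>ratio_step\<close>.\<close>

lemma growth_exponent_mono:
  fixes x y :: real assumes "0 < x" "x \<le> y"
  shows "(x+1) * ln (x+1) - x * ln x - ln (x + 1/2) \<le> (y+1) * ln (y+1) - y * ln y - ln (y + 1/2)"
proof (rule DERIV_nonneg_imp_nondecreasing[OF assms(2)])
  fix z assume z: "x \<le> z" "z \<le> y"
  with assms have "z > 0" by simp
  then have "((\<lambda>x. (x+1) * ln (x+1) - x * ln x - ln (x + 1/2)) has_real_derivative (ln (z+1) - ln z - 1/(z+1/2))) (at z)"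
    by (auto intro!: derivative_eq_intros)
  moreover have "0 \<le> ln (z+1) - ln z - 1/(z+1/2)" using ln_ratio_ge[OF \<open>z > 0\<close>] by simp
  ultimately show "\<exists>d. ((\<lambda>x. (x+1) * ln (x+1) - x * ln x - ln (x + 1/2)) has_real_derivative d) (at z) \<and> 0 \<le> d" by blast
qed

text \<open>The quotient of consecutive values of \<open>self_power_ratio\<close>; since 0^0 = 1 it
  equals 2 at k = 0.\<close>

definition ratio_step :: "nat \<Rightarrow> real" where
  "ratio_step k = real (k + 1) ^ (k + 1) / (real k ^ k * (real k + 1/2))"

lemma ratio_step_eq_exp:
  assumes "k > 0"
  shows "ratio_step k = exp ((real k+1) * ln (real k+1) - real k * ln (real k) - ln (real k + 1/2))"
proof -
  have "real (k + 1) ^ (k + 1) = exp ((real k+1) * ln (real k+1))"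
    using exp_of_nat_mult[of "k+1" "ln (real k + 1)"] by (simp add: add.commute)
  moreover have "real k ^ k = exp (real k * ln (real k))"
    using exp_of_nat_mult[of "k" "ln (real k)"] assms by simp
  ultimately show ?thesis unfolding ratio_step_def by (simp add: exp_diff)
qed

lemma ratio_step_mono: "j \<le> k \<Longrightarrow> ratio_step j \<le> ratio_step k"
proof -
  have pos: "ratio_step j \<le> ratio_step k" if "0 < j" "j \<le> k" for j k
    using that growth_exponent_mono[of "real j" "real k"] by (simp add: ratio_step_eq_exp)
  \<comment> \<open>The logarithmic form starts at k = 1; the remaining comparison is 2 \<le>
    8/3.\<close>
  have "ratio_step 0 \<le> ratio_step 1" by (simp add: ratio_step_def)
  then have "ratio_step 0 \<le> ratio_step k" for k
    using pos[of 1 k] by (cases k) auto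
  then show "j \<le> k \<Longrightarrow> ratio_step j \<le> ratio_step k" using pos by (cases "j = 0") auto
qed

text \<open>For a binary word of length m with k ones, the Krichevsky--Trofimov mixture has the
  probability \<open>pochhammer (1/2) k * pochhammer (1/2) (m - k) / fact m\<close>, and the maximal
  likelihood is k^k (m - k)^(m - k) / m^m. The quotient of likelihood and mixture is the product of
  the ratios at k and m - k, times fact m / m^m.\<close>

definition self_power_ratio :: "nat \<Rightarrow> real" where "self_power_ratio k = real k ^ k / pochhammer (1/2) k"

lemma pochhammer_half_pos: "pochhammer (1/2 :: real) k > 0" by (rule pochhammer_pos) simp

lemma self_power_ratio_Suc: "self_power_ratio (Suc k) = ratio_step k * self_power_ratio k"
proof -
  have "real k ^ k \<noteq> 0" by (cases k) auto
  then show ?thesis using pochhammer_half_pos[of k]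
    by (simp add: self_power_ratio_def ratio_step_def pochhammer_Suc)
qed

text \<open>The sequence is log-convex, because its quotients \<open>ratio_step\<close> increase,
  and it starts at 1. Hence the likelihood quotient is largest for constant words.\<close>

lemma self_power_ratio_supermult: "self_power_ratio k * self_power_ratio l \<le> self_power_ratio (k + l)"
proof (induction l)
  case 0 then show ?case by (simp add: self_power_ratio_def)
next
  case (Suc l)
  have "ratio_step l \<ge> 0" "self_power_ratio (k + l) \<ge> 0"
    using pochhammer_half_pos[of "k + l"] by (simp_all add: ratio_step_def self_power_ratio_def)
  have "self_power_ratio k * self_power_ratio (Suc l) = ratio_step l * (self_power_ratio k * self_power_ratio l)" by (simp add: self_power_ratio_Suc)
  also have "\<dots> \<le> ratio_step l * self_power_ratio (k + l)" using Suc \<open>ratio_step l \<ge> 0\<close> by (rule mult_left_mono)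
  also have "\<dots> \<le> ratio_step (k + l) * self_power_ratio (k + l)"
    using \<open>self_power_ratio (k + l) \<ge> 0\<close> by (intro mult_right_mono ratio_step_mono) auto
  finally show ?case by (simp add: self_power_ratio_Suc)
qed

text \<open>The quotient of the two sides without the root is 4^m / (2m choose m). After squaring,
  the induction step is (m + 1)(m + 2) \<le> (m + 3/2)^2; equality at m = 1 fixes the constant
  2.\<close>

lemma fact_le_pochhammer_half: "m > 0 \<Longrightarrow> fact m \<le> 2 * sqrt (real m) * pochhammer (1/2) m"
proof -
  have *: "(fact (Suc m))\<^sup>2 \<le> 4 * real (Suc m) * (pochhammer (1/2) (Suc m))\<^sup>2" for m
  proof (induction m)
    case 0 then show ?case by (simp add: power2_eq_square)
  next
    case (Suc m)
    let ?p = "pochhammer (1/2::real) (Suc m)"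
    have "(fact (Suc (Suc m)))\<^sup>2 = (real m + 2)\<^sup>2 * (fact (Suc m))\<^sup>2"
      by (simp only: fact_Suc[of "Suc m"] power_mult_distrib) (simp add: add.commute)
    also have "\<dots> \<le> (real m + 2)\<^sup>2 * (4 * real (Suc m) * ?p\<^sup>2)"
      using Suc by (intro mult_left_mono) auto
    also have "\<dots> = ((real m + 2) * (real m + 1)) * (4 * (real m + 2) * ?p\<^sup>2)" 
      by (simp add: power2_eq_square algebra_simps)
    also have "\<dots> \<le> (real m + 3/2)\<^sup>2 * (4 * (real m + 2) * ?p\<^sup>2)"
      by (intro mult_right_mono) (auto simp: power2_eq_square algebra_simps)
    also have "\<dots> = 4 * real (Suc (Suc m)) * (pochhammer (1/2) (Suc (Suc m)))\<^sup>2"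
      by (simp only: pochhammer_Suc[of _ "Suc m"] power_mult_distrib) (simp add: add_ac)
    finally show ?case .
  qed
  assume "m > 0"
  with *[of "m - 1"] have "(fact m)\<^sup>2 \<le> 4 * real m * (pochhammer (1/2) m)\<^sup>2" by simp
  also have "\<dots> = (2 * sqrt (real m) * pochhammer (1/2) m)\<^sup>2" by (simp add: power_mult_distrib)
  finally show ?thesis
    by (rule power2_le_imp_le) (use pochhammer_half_pos[of m] in simp)
qed

text \<open>Once the likelihood quotients are replaced by their maximum, what remains is the total
  mass of the mixture: Vandermonde's identity for rising factorials gives pochhammer 1 m = fact
  m.\<close>

lemma sum_binomial_self_power_le:
  assumes "m > 0"
  shows "(\<Sum>k\<le>m. real (m choose k) * (real k ^ k * real (m - k) ^ (m - k))) \<le> 2 * sqrt (real m) * real m ^ m"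
proof -
  let ?p = "\<lambda>k. pochhammer (1/2::real) k"
  have "(\<Sum>k\<le>m. real (m choose k) * (real k ^ k * real (m - k) ^ (m - k)))
      = (\<Sum>k\<le>m. (self_power_ratio k * self_power_ratio (m - k)) * (real (m choose k) * ?p k * ?p (m - k)))"
    using pochhammer_half_pos by (intro sum.cong) (auto simp: self_power_ratio_def field_simps less_imp_neq[THEN not_sym])
  also have "\<dots> \<le> (\<Sum>k\<le>m. self_power_ratio m * (real (m choose k) * ?p k * ?p (m - k)))"
  proof (intro sum_mono mult_right_mono)
    show "self_power_ratio k * self_power_ratio (m - k) \<le> self_power_ratio m" if "k \<in> {..m}" for k
      using self_power_ratio_supermult[of k "m - k"] that by simp
  qed (use pochhammer_half_pos in \<open>auto simp: less_imp_le\<close>)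
  also have "\<dots> = self_power_ratio m * pochhammer (1/2 + 1/2) m"
    by (simp only: pochhammer_binomial_sum sum_distrib_left)
  also have "\<dots> = real m ^ m * (fact m / ?p m)" by (simp add: self_power_ratio_def pochhammer_fact[symmetric])
  also have "\<dots> \<le> real m ^ m * (2 * sqrt (real m))"
    using fact_le_pochhammer_half[OF assms] pochhammer_half_pos[of m] by (intro mult_left_mono) (auto simp: field_simps)
  finally show ?thesis by (simp add: mult_ac)
qed

section \<open>Exponential moments of the shifted divergence\<close>

text \<open>Both denominators are at least \<open>t\<close> for p in [0, 1], so the logarithms
  cannot blow up. The denominators sum to 1 + 2t, so this is not a divergence between two
  distributions and it may be negative.\<close>

definition skl :: "real \<Rightarrow> real \<Rightarrow> real \<Rightarrow> real" where
  "skl t q p = q * ln (q / (p + t)) + (1 - q) * ln ((1 - q) / (1 - p + t))"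

text \<open>The function a ln (a / b) is jointly convex and homogeneous of degree one, so a
  supporting plane passes through the origin and depends only on the ratio c = a / b at the point of
  contact. Convexity in the first argument, the joint Jensen inequality and the lower bounds all
  come from this plane, which itself is ln x \<le> x - 1.\<close>

lemma xlogx_tangent:
  fixes a b c :: real
  assumes "a \<ge> 0" "b > 0" "c > 0"
  shows "a * (ln c + 1) - b * c \<le> a * ln (a / b)"
proof (cases "a = 0")
  case False
  with assms have "a > 0" by simp
  have "ln (b * c / a) \<le> b * c / a - 1"
    using assms \<open>a > 0\<close> by (intro ln_le_minus_one) simp
  then have "a * ln (b * c / a) \<le> a * (b * c / a - 1)"
    using \<open>a > 0\<close> by (intro mult_left_mono) auto
  then show ?thesis
    using assms \<open>a > 0\<close> by (simp add: ln_div ln_mult algebra_simps)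
qed (use assms in simp)

lemma xlogx_convex:
  fixes b :: real assumes "b > 0"
  shows "convex_on {0..} (\<lambda>a. a * ln (a / b))"
proof (rule convex_onI)
  fix u x y :: real
  assume u: "0 < u" "u < 1" and xy: "x \<in> {0..}" "y \<in> {0..}"
  define z where "z = (1 - u) * x + u * y"
  have "z \<ge> 0" using u xy by (simp add: z_def)
  have "z * ln (z / b) \<le> (1 - u) * (x * ln (x / b)) + u * (y * ln (y / b))"
  proof (cases "z = 0")
    case True
    have "(1 - u) * x = 0 \<and> u * y = 0" 
      using True u xy by (subst add_nonneg_eq_0_iff[symmetric]) (auto simp: z_def)
    then show ?thesis using True u by simp
  next
    case False
    then have "z > 0" using \<open>z \<ge> 0\<close> by simp
    \<comment> \<open>The supporting plane with contact at \<open>z\<close>, for fixed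
      \<open>b\<close>. Its ratio z / b must be positive, hence the separate case z = 0.\<close>
    let ?T = "\<lambda>a. a * (ln (z / b) + 1) - b * (z / b)"
    have "(1 - u) * ?T x + u * ?T y = z * (ln (z / b) + 1) - b * (z / b)"
      by (simp only: z_def) (simp only: algebra_simps)
    then have "z * ln (z / b) = (1 - u) * ?T x + u * ?T y"
      using assms by (simp add: distrib_left)
    also have "\<dots> \<le> (1 - u) * (x * ln (x / b)) + u * (y * ln (y / b))"
      using u xy assms \<open>z > 0\<close> by (intro add_mono mult_left_mono xlogx_tangent) auto
    finally show ?thesis .
  qed
  then show "((1 - u) *\<^sub>R x + u *\<^sub>R y) * ln (((1 - u) *\<^sub>R x + u *\<^sub>R y) / b)
      \<le> (1 - u) * (x * ln (x / b)) + u * (y * ln (y / b))" by (simp add: z_def)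
qed simp

lemma skl_convex:
  assumes "0 < p + t" "0 < 1 - p + t"
  shows "convex_on {0..1} (\<lambda>q. skl t q p)"
proof (rule convex_onI)
  fix u x y :: real
  assume u: "0 < u" "u < 1" and xy: "x \<in> {0..1}" "y \<in> {0..1}"
  let ?z = "(1 - u) * x + u * y"
  have "?z * ln (?z / (p + t)) \<le> (1 - u) * (x * ln (x / (p + t))) + u * (y * ln (y / (p + t)))"
    using convex_onD[OF xlogx_convex[of "p + t"], of u x y] u xy assms by simp
  moreover have "1 - ?z = (1 - u) * (1 - x) + u * (1 - y)" by (simp add: algebra_simps)
  then have "(1 - ?z) * ln ((1 - ?z) / (1 - p + t)) \<le> (1 - u) * ((1 - x) * ln ((1 - x) / (1 - p + t)))
      + u * ((1 - y) * ln ((1 - y) / (1 - p + t)))"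
    using convex_onD[OF xlogx_convex[of "1 - p + t"], of u "1 - x" "1 - y"] u xy assms by simp
  ultimately show "skl t ((1 - u) *\<^sub>R x + u *\<^sub>R y) p \<le> (1 - u) * skl t x p + u * skl t y p"
    by (simp add: skl_def algebra_simps)
qed simp

lemma exp_convex_comb:
  fixes a b u :: real assumes "0 \<le> u" "u \<le> 1"
  shows "exp ((1 - u) * a + u * b) \<le> (1 - u) * exp a + u * exp b"
  using convex_onD[OF exp_convex, of u a b] assms by simp

lemma exp_skl_convex:
  assumes "0 < t" "0 \<le> p" "p \<le> 1" "m > 0"
  shows "convex_on {0..real m} (\<lambda>y. exp (real m * skl t (y / real m) p))"
proof (rule convex_onI)
  fix u x y :: real
  assume u: "0 < u" "u < 1" and xy: "x \<in> {0..real m}" "y \<in> {0..real m}"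
  have "skl t (((1 - u) * x + u * y) / m) p \<le> (1 - u) * skl t (x / m) p + u * skl t (y / m) p"
    using convex_onD[OF skl_convex[of p t], of u "x / m" "y / m"] u xy assms
    by (simp add: field_simps)
  then have "real m * skl t (((1 - u) * x + u * y) / m) p
     \<le> real m * ((1 - u) * skl t (x / m) p + u * skl t (y / m) p)"
    by (intro mult_left_mono) auto
  then have "exp (real m * skl t (((1 - u) * x + u * y) / m) p)
     \<le> exp ((1 - u) * (real m * skl t (x / m) p) + u * (real m * skl t (y / m) p))"
    by (simp add: algebra_simps)
  also have "\<dots> \<le> (1 - u) * exp (real m * skl t (x / m) p) + u * exp (real m * skl t (y / m) p)"
    using u by (intro exp_convex_comb) auto
  finally show "exp (real m * skl t (((1 - u) *\<^sub>R x + u *\<^sub>R y) / real m) p)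
     \<le> (1 - u) * exp (real m * skl t (x / real m) p) + u * exp (real m * skl t (y / real m) p)"
    by simp
qed simp

text \<open>The right-hand side is the expectation of \<open>G\<close> at the number of successes of
  independent Bernoulli trials with success probabilities \<open>x j\<close>. The trials replace the
  values one at a time: a value in [0, 1] is a mixture of 0 and 1, and a convex function lies below
  its chord.\<close>

lemma convex_le_multiaffine:
  fixes G :: "real \<Rightarrow> real" and x :: "'i \<Rightarrow> real"
  assumes "finite J" "convex_on {0..real (card J)} G" "\<And>j. j \<in> J \<Longrightarrow> x j \<in> {0..1}"
  shows "G (\<Sum>j\<in>J. x j) \<le> (\<Sum>B\<in>Pow J. (\<Prod>j\<in>B. x j) * (\<Prod>j\<in>J-B. 1 - x j) * G (real (card B)))"
  using assms
proof (induction J arbitrary: G rule: finite_induct)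
  case empty then show ?case by simp
next
  case (insert a J)
  let ?s = "\<Sum>j\<in>J. x j"
  let ?w = "\<lambda>B. (\<Prod>j\<in>B. x j) * (\<Prod>j\<in>J-B. 1 - x j)"
  have s: "0 \<le> ?s" "?s \<le> card J"
    using insert.prems(2) sum_mono[of J x "\<lambda>_. 1"] by (auto intro!: sum_nonneg)
  have a: "0 \<le> x a" "x a \<le> 1" using insert.prems(2)[of a] by auto
  have c0: "convex_on {0..real (card J)} G"
    using insert.prems(1) insert.hyps by (rule_tac convex_on_subset) auto
  have c1: "convex_on {0..real (card J)} (\<lambda>y. G (1 + y))"
  proof (rule convex_onI)
    fix u y z :: real assume *: "0 < u" "u < 1" "y \<in> {0..real (card J)}" "z \<in> {0..real (card J)}"
    have "1 + ((1 - u) * y + u * z) = (1 - u) * (1 + y) + u * (1 + z)" by (simp add: algebra_simps)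
    then show "G (1 + ((1 - u) *\<^sub>R y + u *\<^sub>R z)) \<le> (1 - u) * G (1 + y) + u * G (1 + z)"
      using convex_onD[OF insert.prems(1), of u "1 + y" "1 + z"] * insert.hyps by simp
  qed simp
  have "G (\<Sum>j\<in>insert a J. x j) = G ((1 - x a) *\<^sub>R ?s + x a *\<^sub>R (1 + ?s))"
    using insert.hyps by (simp add: algebra_simps)
  also have "\<dots> \<le> (1 - x a) * G ?s + x a * G (1 + ?s)"
    using s a insert.hyps by (intro convex_onD[OF insert.prems(1)]) auto
  also have "\<dots> \<le> (1 - x a) * (\<Sum>B\<in>Pow J. ?w B * G (real (card B)))
      + x a * (\<Sum>B\<in>Pow J. ?w B * G (1 + real (card B)))"
    using a insert.IH[OF c0] insert.IH[OF c1] insert.prems(2)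
    by (intro add_mono mult_left_mono) auto
  also have "\<dots> = (\<Sum>B\<in>Pow (insert a J). (\<Prod>j\<in>B. x j) * (\<Prod>j\<in>insert a J-B. 1 - x j) * G (real (card B)))"
  proof -
    have inj: "inj_on (insert a) (Pow J)" using insert.hyps by (auto intro!: inj_onI)
    have 1: "(\<Sum>B\<in>Pow J. (\<Prod>j\<in>B. x j) * (\<Prod>j\<in>insert a J-B. 1 - x j) * G (real (card B)))
       = (1 - x a) * (\<Sum>B\<in>Pow J. ?w B * G (real (card B)))"
      unfolding sum_distrib_left
    proof (rule sum.cong[OF refl])
      fix B assume "B \<in> Pow J"
      then have "insert a J - B = insert a (J - B)" "a \<notin> J - B" using insert.hyps by auto
      then show "(\<Prod>j\<in>B. x j) * (\<Prod>j\<in>insert a J-B. 1 - x j) * G (real (card B)) = (1 - x a) * (?w B * G (real (card B)))"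
        using insert.hyps by simp
    qed
    have 2: "(\<Sum>B\<in>Pow J. (\<Prod>j\<in>insert a B. x j) * (\<Prod>j\<in>insert a J-insert a B. 1 - x j) * G (real (card (insert a B))))
       = x a * (\<Sum>B\<in>Pow J. ?w B * G (1 + real (card B)))"
      unfolding sum_distrib_left
    proof (rule sum.cong[OF refl])
      fix B assume "B \<in> Pow J"
      then have "insert a J - insert a B = J - B" "a \<notin> B" "finite B" using insert.hyps finite_subset by auto
      then show "(\<Prod>j\<in>insert a B. x j) * (\<Prod>j\<in>insert a J-insert a B. 1 - x j) * G (real (card (insert a B)))
         = x a * (?w B * G (1 + real (card B)))"
        by simp
    qed
    have "Pow J \<inter> insert a ` Pow J = {}" using insert.hyps by auto
    then show ?thesis
      unfolding Pow_insert using insert.hyps 1 2 inj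
      by (subst sum.union_disjoint) (auto simp: sum.reindex)
  qed
  finally show ?case .
qed

text \<open>The exponential turns the likelihood under \<open>p\<close> into the maximal one: the
  powers of p and 1 - p cancel against the denominators of \<open>skl\<close>, up to powers of p /
  (p + t) and (1 - p) / (1 - p + t), which are at most 1. This is why the bound is free of
  \<open>p\<close> and \<open>t\<close>.\<close>

lemma sum_binomial_exp_skl:
  assumes "0 < t" "0 \<le> p" "p \<le> 1" "m > 0"
  shows "(\<Sum>k\<le>m. real (m choose k) * (p ^ k * (1 - p) ^ (m - k) * exp (real m * skl t (real k / real m) p)))
      \<le> 2 * sqrt (real m)"
proof -
  have le: "p ^ k * (1 - p) ^ (m - k) * exp (real m * skl t (real k / real m) p)
      \<le> real k ^ k * real (m - k) ^ (m - k) / real m ^ m" if "k \<le> m" for k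
  proof -
    have E: "r ^ j * exp (real j * ln (real j / m / (r + t))) \<le> (real j / m) ^ j" if "0 \<le> r" for r j
    proof (cases "j = 0")
      case False
      then have "exp (real j * ln (real j / m / (r + t))) = (real j / m / (r + t)) ^ j"
        using assms that by (simp add: exp_of_nat_mult)
      then have "r ^ j * exp (real j * ln (real j / m / (r + t))) = (real j / m) ^ j * (r / (r + t)) ^ j"
        by (simp add: power_divide power_mult_distrib)
      also have "\<dots> \<le> (real j / m) ^ j * 1"
        using that assms by (intro mult_left_mono power_le_one) auto
      finally show ?thesis by simp
    qed simp
    have eq: "real m * skl t (real k / real m) p
      = real k * ln (real k / m / (p + t)) + real (m - k) * ln (real (m - k) / m / (1 - p + t))"
    proof -
      have "1 - real k / m = real (m - k) / m" using that assms by (simp add: of_nat_diff field_simps)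
      then show ?thesis using assms by (simp add: skl_def distrib_left)
    qed
    have "p ^ k * (1 - p) ^ (m - k) * exp (real m * skl t (real k / real m) p)
      = (p ^ k * exp (real k * ln (real k / m / (p + t))))
        * ((1 - p) ^ (m - k) * exp (real (m - k) * ln (real (m - k) / m / (1 - p + t))))"
      unfolding eq exp_add by (simp only: mult_ac)
    also have "\<dots> \<le> (real k / m) ^ k * (real (m - k) / m) ^ (m - k)"
      using assms by (intro mult_mono E) auto
    also have "\<dots> = real k ^ k * real (m - k) ^ (m - k) / real m ^ m"
      using that by (simp add: power_divide flip: power_add)
    finally show ?thesis .
  qed
  have "(\<Sum>k\<le>m. real (m choose k) * (p ^ k * (1 - p) ^ (m - k) * exp (real m * skl t (real k / real m) p)))
      \<le> (\<Sum>k\<le>m. real (m choose k) * (real k ^ k * real (m - k) ^ (m - k) / real m ^ m))"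
    by (intro sum_mono mult_left_mono le) auto
  also have "\<dots> = (\<Sum>k\<le>m. real (m choose k) * (real k ^ k * real (m - k) ^ (m - k))) / real m ^ m"
    by (simp add: sum_divide_distrib)
  also have "\<dots> \<le> 2 * sqrt (real m)"
    using sum_binomial_self_power_le[OF assms(4)] assms(4) by (simp add: divide_simps)
  finally show ?thesis .
qed

lemma sum_Pow_card:
  fixes f :: "nat \<Rightarrow> real" assumes "finite J"
  shows "(\<Sum>B\<in>Pow J. f (card B)) = (\<Sum>k\<le>card J. real (card J choose k) * f k)"
proof -
  have "(\<Sum>B\<in>Pow J. f (card B)) = (\<Sum>k\<le>card J. \<Sum>B | B \<in> Pow J \<and> card B = k. f (card B))"
    using assms by (intro sum.group[symmetric]) (auto intro: card_mono)
  also have "\<dots> = (\<Sum>k\<le>card J. real (card J choose k) * f k)"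
    using assms by (intro sum.cong) (auto simp: n_subsets)
  finally show ?thesis .
qed

text \<open>By independence the multi-affine majorant can be integrated factor by factor, which
  replaces every \<open>g (x j)\<close> by the common mean and leaves the Bernoulli case.\<close>

lemma nn_integral_exp_skl_le:
  fixes M :: "'z measure" and g :: "'z \<Rightarrow> real"
  assumes "prob_space M" and g[measurable]: "g \<in> borel_measurable M"
    and g01: "\<And>z. z \<in> space M \<Longrightarrow> g z \<in> {0..1}" and "m > 0" "t > 0"
  shows "(\<integral>\<^sup>+x. ennreal (exp (real m * skl t ((\<Sum>j<m. g (x j)) / real m) (\<integral>z. g z \<partial>M))) \<partial>(\<Pi>\<^sub>M i\<in>{..<m}. M))
      \<le> ennreal (2 * sqrt (real m))"
proof -
  interpret M: prob_space M by fact
  interpret P: product_prob_space "\<lambda>_. M" "{..<m}" by unfold_locales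
  let ?P = "\<Pi>\<^sub>M i\<in>{..<m}. M"
  let ?J = "{..<m}"
  define p where "p = (\<integral>z. g z \<partial>M)"
  have int_g: "integrable M g" using g01 by (intro M.integrable_const_bound[where B=1]) auto
  have p: "0 \<le> p" "p \<le> 1"
  proof -
    show "0 \<le> p" unfolding p_def using g01 by (intro integral_nonneg_AE) auto
    have "p \<le> (\<integral>z. 1 \<partial>M)" unfolding p_def using g01 int_g by (intro integral_mono) auto
    then show "p \<le> 1" by (simp add: M.prob_space)
  qed
  define G where "G y = exp (real m * skl t (y / real m) p)" for y
  have conv: "convex_on {0..real (card ?J)} G"
    unfolding G_def using exp_skl_convex[OF \<open>t > 0\<close> p \<open>m > 0\<close>] by simp
  \<comment> \<open>A single product over the whole index set, with the case distinction inside the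
    factor, is the form in which product integration applies.\<close>
  define W where "W B x = (\<Prod>j\<in>?J. if j \<in> B then g (x j) else 1 - g (x j))" for B x
  have W_eq: "W B x = (\<Prod>j\<in>B. g (x j)) * (\<Prod>j\<in>?J-B. 1 - g (x j))" if "B \<subseteq> ?J" for B x
    unfolding W_def using that by (subst prod.If_cases) (auto simp: Int_absorb1 Diff_eq intro!: arg_cong2[where f="(*)"] prod.cong)
  have le: "G (\<Sum>j<m. g (x j)) \<le> (\<Sum>B\<in>Pow ?J. W B x * G (real (card B)))" if "x \<in> space ?P" for x
  proof -
    have "G (\<Sum>j<m. g (x j)) \<le> (\<Sum>B\<in>Pow ?J. (\<Prod>j\<in>B. g (x j)) * (\<Prod>j\<in>?J-B. 1 - g (x j)) * G (real (card B)))"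
      using that g01 by (intro convex_le_multiaffine conv) (auto simp: space_PiM PiE_iff)
    also have "\<dots> = (\<Sum>B\<in>Pow ?J. W B x * G (real (card B)))"
      by (intro sum.cong) (auto simp: W_eq)
    finally show ?thesis .
  qed
  have int1: "integrable M (\<lambda>z. if j \<in> B then g z else 1 - g z)" for j B
    using int_g by (cases "j \<in> B") auto
  have intW: "integrable ?P (W B)" "(\<integral>x. W B x \<partial>?P) = p ^ card B * (1 - p) ^ (m - card B)" if "B \<subseteq> ?J" for B
  proof -
    show "integrable ?P (W B)" unfolding W_def
      using int1 by (intro P.product_integrable_prod) auto
    have "(\<integral>x. W B x \<partial>?P) = (\<Prod>j\<in>?J. \<integral>z. (if j \<in> B then g z else 1 - g z) \<partial>M)"
      unfolding W_def using int1 by (intro P.product_integral_prod) auto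
    also have "\<dots> = (\<Prod>j\<in>?J. if j \<in> B then p else 1 - p)"
      using int_g by (intro prod.cong) (auto simp: p_def M.prob_space)
    also have "\<dots> = p ^ card B * (1 - p) ^ (m - card B)"
      using that by (subst prod.If_cases) (auto simp: Int_absorb1 Diff_eq[symmetric] card_Diff_subset finite_subset)
    finally show "(\<integral>x. W B x \<partial>?P) = p ^ card B * (1 - p) ^ (m - card B)" .
  qed
  let ?H = "\<lambda>x. \<Sum>B\<in>Pow ?J. W B x * G (real (card B))"
  have intH: "integrable ?P ?H" using intW by (intro Bochner_Integration.integrable_sum integrable_mult_left) auto
  have H0: "0 \<le> ?H x" if "x \<in> space ?P" for x
    using le[OF that] by (rule order_trans[rotated]) (simp add: G_def)
  have "(\<integral>\<^sup>+x. ennreal (G (\<Sum>j<m. g (x j))) \<partial>?P) \<le> (\<integral>\<^sup>+x. ennreal (?H x) \<partial>?P)"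
    using le by (intro nn_integral_mono ennreal_leI) auto
  also have "\<dots> = ennreal (\<integral>x. ?H x \<partial>?P)"
    using H0 by (intro nn_integral_eq_integral intH) auto
  also have "(\<integral>x. ?H x \<partial>?P) = (\<Sum>B\<in>Pow ?J. p ^ card B * (1 - p) ^ (m - card B) * G (real (card B)))"
    using intW by (subst Bochner_Integration.integral_sum) (auto intro!: sum.cong)
  also have "\<dots> = (\<Sum>k\<le>m. real (m choose k) * (p ^ k * (1 - p) ^ (m - k) * G (real k)))"
    using sum_Pow_card[of ?J "\<lambda>k. p ^ k * (1 - p) ^ (m - k) * G (real k)"] by simp
  also have "\<dots> \<le> 2 * sqrt (real m)"
    unfolding G_def using sum_binomial_exp_skl[OF \<open>t > 0\<close> p \<open>m > 0\<close>] .
  finally show ?thesis by (simp add: G_def p_def ennreal_leI)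
qed

section \<open>Change of measure and Jensen inequalities\<close>

text \<open>The weight \<open>w\<close> stands in place of an exponential so that it may vanish;
  this will encode an infinite penalty. Instead of Jensen's inequality, the pointwise bound ln x
  \<le> x - 1 is integrated at x = w / (r c), where r is the density of \<open>N\<close> with
  respect to \<open>M\<close>.\<close>

lemma donsker_varadhan:
  assumes "prob_space M" "prob_space N"
    and w[measurable]: "w \<in> borel_measurable M" and w0: "\<And>x. x \<in> space M \<Longrightarrow> 0 \<le> w x"
    and wpos: "AE x in N. 0 < w x" and intw: "integrable N (\<lambda>x. ln (w x))"
    and le: "(\<integral>\<^sup>+x. ennreal (w x) \<partial>M) \<le> ennreal c" and "0 < c"
  shows "ereal (\<integral>x. ln (w x) \<partial>N) \<le> KLdiv N M + ereal (ln c)"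
proof (cases "sets N = sets M \<and> absolutely_continuous M N \<and> integrable N (entropy_density (exp 1) M N)")
  case False
  then have "KLdiv N M = \<infinity>" unfolding KLdiv_def by (rule if_not_P)
  then show ?thesis by simp
next
  case True
  then have sets[measurable_cong, simp]: "sets N = sets M" and ac: "absolutely_continuous M N"
    and ent: "integrable N (entropy_density (exp 1) M N)" by auto
  interpret M: prob_space M by fact
  interpret N: prob_space N by fact
  let ?R = "RN_deriv M N"
  define r where "r x = enn2real (?R x)" for x
  have r_meas[measurable]: "r \<in> borel_measurable M" unfolding r_def by measurable
  have dens: "density M ?R = N" using ac by (intro M.density_RN_deriv) auto
  have fin: "AE x in M. ?R x \<noteq> \<infinity>"
    using N.sigma_finite_measure_axioms ac by (intro M.RN_deriv_finite) auto
  have Rpos: "AE x in N. 0 < ?R x"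
    by (subst dens[symmetric], subst AE_density) auto
  have finN: "AE x in N. ?R x \<noteq> \<infinity>"
    using fin by (subst dens[symmetric], subst AE_density) auto
  have rpos: "AE x in N. 0 < r x"
    using Rpos finN by eventually_elim (auto simp: r_def enn2real_positive_iff top.not_eq_extremum)
  have ent_eq: "entropy_density (exp 1) M N = (\<lambda>x. ln (r x))"
    by (auto simp: entropy_density_def r_def log_def fun_eq_iff)
  have int_r: "integrable N (\<lambda>x. ln (r x))" using ent by (simp add: ent_eq)
  \<comment> \<open>Below, \<open>ennreal\<close> cuts off the negative part of \<open>?X\<close>,
    which only enlarges the integral that is to be bounded from above.\<close>
  let ?X = "\<lambda>x. 1 + ln (w x) - ln (r x) - ln c"
  have "(\<integral>\<^sup>+x. ennreal (?X x) \<partial>N) \<le> (\<integral>\<^sup>+x. ennreal (w x / (r x * c)) \<partial>N)"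
  proof (intro nn_integral_mono_AE)
    show "AE x in N. ennreal (?X x) \<le> ennreal (w x / (r x * c))"
      using wpos rpos
    proof eventually_elim
      case (elim x)
      have "ln (w x / (r x * c)) \<le> w x / (r x * c) - 1"
        using elim \<open>0 < c\<close> by (intro ln_le_minus_one) simp
      then show ?case using elim \<open>0 < c\<close> by (intro ennreal_leI) (simp add: ln_div ln_mult)
    qed
  qed
  also have "\<dots> = (\<integral>\<^sup>+x. ?R x * ennreal (w x / (r x * c)) \<partial>M)"
    by (subst dens[symmetric], subst nn_integral_density) (auto simp: r_def)
  \<comment> \<open>Equality can fail only where \<open>r\<close> vanishes; there division by zero
    makes the left side 0.\<close>
  also have "\<dots> \<le> (\<integral>\<^sup>+x. ennreal (1 / c) * ennreal (w x) \<partial>M)"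
  proof (intro nn_integral_mono_AE)
    show "AE x in M. ?R x * ennreal (w x / (r x * c)) \<le> ennreal (1 / c) * ennreal (w x)"
      using fin AE_space
    proof eventually_elim
      case (elim x)
      have "?R x = ennreal (r x)" using elim(1) by (simp add: r_def less_top)
      then have "?R x * ennreal (w x / (r x * c)) = ennreal (r x) * ennreal (w x / (r x * c))" by (rule arg_cong)
      also have "\<dots> = ennreal (r x * (w x / (r x * c)))"
        by (intro ennreal_mult'[symmetric]) (simp add: r_def)
      also have "\<dots> \<le> ennreal (1 / c * w x)"
        using w0[OF elim(2)] \<open>0 < c\<close> by (intro ennreal_leI) (auto simp: field_simps)
      also have "\<dots> = ennreal (1 / c) * ennreal (w x)"
        using \<open>0 < c\<close> by (intro ennreal_mult') simp
      finally show ?case .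
    qed
  qed
  also have "\<dots> = ennreal (1 / c) * (\<integral>\<^sup>+x. ennreal (w x) \<partial>M)"
    by (rule nn_integral_cmult) simp
  also have "\<dots> \<le> ennreal (1 / c) * ennreal c" by (intro mult_left_mono le) simp
  also have "\<dots> = ennreal 1" using \<open>0 < c\<close> by (simp flip: ennreal_mult')
  finally have "(\<integral>x. ?X x \<partial>N) \<le> 1" by (intro integral_real_bounded) auto
  moreover have "(\<integral>x. ?X x \<partial>N) = 1 + (\<integral>x. ln (w x) \<partial>N) - (\<integral>x. ln (r x) \<partial>N) - ln c"
    using intw int_r by (simp add: N.prob_space)
  ultimately have "(\<integral>x. ln (w x) \<partial>N) \<le> (\<integral>x. ln (r x) \<partial>N) + ln c" by simp
  moreover have "KLdiv N M = ereal (\<integral>x. ln (r x) \<partial>N)"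
    using True by (simp add: KLdiv_def KL_divergence_def ent_eq)
  ultimately show ?thesis by simp
qed

lemma KLdiv_nonneg: "prob_space M \<Longrightarrow> prob_space N \<Longrightarrow> 0 \<le> KLdiv N M"
  using donsker_varadhan[of M N "\<lambda>_. 1" 1]
  by (simp add: prob_space.emeasure_space_1 zero_ereal_def)

lemma xlogx_bounds:
  fixes a b t :: real assumes "0 \<le> a" "a \<le> 1" "t \<le> b" "b \<le> 1 + t" "0 < t" 
  shows "\<bar>a * ln (a / b)\<bar> \<le> 1 + t + \<bar>ln t\<bar>"
proof -
  have "a * (ln 1 + 1) - b * 1 \<le> a * ln (a / b)" using assms by (intro xlogx_tangent) auto
  then have lo: "- (1 + t) \<le> a * ln (a / b)" using assms by simp
  have "a * ln (a / b) \<le> \<bar>ln t\<bar>"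
  proof (cases "a = 0")
    case False
    have "a / b \<le> 1 / t" using assms by (intro frac_le) auto
    then have "ln (a / b) \<le> ln (1 / t)" using assms False by (subst ln_le_cancel_iff) auto
    also have "\<dots> \<le> \<bar>ln t\<bar>" using assms by (simp add: ln_div)
    finally have "a * ln (a / b) \<le> a * \<bar>ln t\<bar>" using assms by (intro mult_left_mono) auto
    also have "\<dots> \<le> \<bar>ln t\<bar>" using assms by (intro mult_left_le_one_le) auto
    finally show ?thesis .
  qed simp
  with lo assms show ?thesis by (simp add: abs_le_iff)
qed

lemma skl_bounded:
  assumes "0 < t" "q \<in> {0..1}" "p \<in> {0..1}"
  shows "\<bar>skl t q p\<bar> \<le> 2 * (1 + t + \<bar>ln t\<bar>)"
  using xlogx_bounds[of q t "p + t"] xlogx_bounds[of "1 - q" t "1 - p + t"] assms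
  by (simp add: skl_def)

text \<open>Integrate the supporting plane whose ratio \<open>c\<close> is the quotient of the two
  means. If the mean of \<open>a\<close> is 0, this ratio is not positive, and \<open>c\<close> is
  sent to 0 instead.\<close>

lemma (in prob_space) xlogx_jensen:
  fixes a b :: "'a \<Rightarrow> real"
  assumes [measurable]: "a \<in> borel_measurable M" "b \<in> borel_measurable M" and "0 < t"
    and a: "\<And>x. x \<in> space M \<Longrightarrow> a x \<in> {0..1}" and b: "\<And>x. x \<in> space M \<Longrightarrow> b x \<in> {t..1 + t}"
  shows "(\<integral>x. a x \<partial>M) * ln ((\<integral>x. a x \<partial>M) / (\<integral>x. b x \<partial>M)) \<le> (\<integral>x. a x * ln (a x / b x) \<partial>M)"
    and "integrable M (\<lambda>x. a x * ln (a x / b x))"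
proof -
  show int: "integrable M (\<lambda>x. a x * ln (a x / b x))"
    using xlogx_bounds[of "a _" t "b _"] a b \<open>0 < t\<close>
    by (intro integrable_const_bound[where B="1 + t + \<bar>ln t\<bar>"]) auto
  have ia: "integrable M a" using a by (intro integrable_const_bound[where B=1]) auto
  have ib: "integrable M b" using b \<open>0 < t\<close> by (intro integrable_const_bound[where B="1+t"]) force+
  let ?a = "\<integral>x. a x \<partial>M" and ?b = "\<integral>x. b x \<partial>M" and ?I = "\<integral>x. a x * ln (a x / b x) \<partial>M"
  have "?a \<ge> 0" using a by (intro integral_nonneg_AE) auto
  have "(\<integral>x. t \<partial>M) \<le> ?b" using b ib by (intro integral_mono) auto
  then have "?b > 0" using \<open>0 < t\<close> by (simp add: prob_space)
  have key: "?a * (ln c + 1) - ?b * c \<le> ?I" if "c > 0" for c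
  proof -
    have "?a * (ln c + 1) - ?b * c = (\<integral>x. a x * (ln c + 1) - b x * c \<partial>M)"
      using ia ib by simp
    also have "\<dots> \<le> ?I"
      using ia ib int a b \<open>0 < t\<close> that by (intro integral_mono xlogx_tangent) force+
    finally show ?thesis .
  qed
  show "?a * ln (?a / ?b) \<le> ?I"
  proof (cases "?a = 0")
    case False
    with \<open>?a \<ge> 0\<close> \<open>?b > 0\<close> key[of "?a / ?b"] show ?thesis by (simp add: algebra_simps)
  next
    case True
    have "0 \<le> ?I"
    proof (rule field_le_epsilon)
      fix e :: real assume "e > 0"
      with key[of "e / ?b"] True \<open>?b > 0\<close> show "0 \<le> ?I + e" by simp
    qed
    with True show ?thesis by simp
  qed
qed

text \<open>Joint convexity is essential, since empirical and true losses are averaged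
  simultaneously, first over hypotheses and then over algorithms.\<close>

lemma (in prob_space) skl_jensen:
  fixes q p :: "'a \<Rightarrow> real"
  assumes [measurable]: "q \<in> borel_measurable M" "p \<in> borel_measurable M" and "0 < t"
    and q: "\<And>x. x \<in> space M \<Longrightarrow> q x \<in> {0..1}" and p: "\<And>x. x \<in> space M \<Longrightarrow> p x \<in> {0..1}"
  shows "skl t (\<integral>x. q x \<partial>M) (\<integral>x. p x \<partial>M) \<le> (\<integral>x. skl t (q x) (p x) \<partial>M)"
    and "integrable M (\<lambda>x. skl t (q x) (p x))"
proof -
  have iq: "integrable M q" using q by (intro integrable_const_bound[where B=1]) auto
  have ip: "integrable M p" using p by (intro integrable_const_bound[where B=1]) auto
  note J1 = xlogx_jensen[of q "\<lambda>x. p x + t" t]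
  note J2 = xlogx_jensen[of "\<lambda>x. 1 - q x" "\<lambda>x. 1 - p x + t" t]
  show "skl t (\<integral>x. q x \<partial>M) (\<integral>x. p x \<partial>M) \<le> (\<integral>x. skl t (q x) (p x) \<partial>M)"
    using J1 J2 iq ip p q \<open>0 < t\<close> by (simp add: skl_def prob_space)
  show "integrable M (\<lambda>x. skl t (q x) (p x))"
    using J1 J2 p q \<open>0 < t\<close> by (simp add: skl_def)
qed

text \<open>The boundary is the delicate part: for a > 0 and b = 0 the shifted term grows to
  infinity, in agreement with \<open>kl_term\<close>. Neither limit is minus infinity, so the two
  limits may be added.\<close>

lemma skl_tendsto_kl:
  assumes q: "q \<in> {0..1}" and p: "p \<in> {0..1}"
  shows "((\<lambda>t. ereal (skl t q p)) \<longlongrightarrow> kl q p) (at_right 0)"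
proof -
  have T: "((\<lambda>t. ereal (a * ln (a / (b + t)))) \<longlongrightarrow> kl_term a b) (at_right 0)"
    if "0 \<le> a" "0 \<le> b" for a b :: real
  proof -
    consider "a = 0" | "a > 0" "b > 0" | "a > 0" "b = 0" using \<open>0 \<le> a\<close> \<open>0 \<le> b\<close> by linarith
    then show ?thesis
    proof cases
      case 1 then show ?thesis by (simp add: kl_term_def zero_ereal_def)
    next
      case 2
      then have "((\<lambda>t. a * ln (a / (b + t))) \<longlongrightarrow> a * ln (a / (b + 0))) (at_right 0)"
        by (intro tendsto_intros tendsto_ident_at) auto
      with 2 show ?thesis by (simp add: kl_term_def)
    next
      case 3
      then have "filterlim (\<lambda>t. a * ln (a / (b + t))) at_top (at_right 0)" by simp real_asymp
      with 3 show ?thesis by (simp add: kl_term_def tendsto_PInfty_eq_at_top)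
    qed
  qed
  have ninf: "kl_term a b \<noteq> - \<infinity>" for a b by (simp add: kl_term_def)
  have "((\<lambda>t. ereal (q * ln (q / (p + t))) + ereal ((1 - q) * ln ((1 - q) / (1 - p + t)))) \<longlongrightarrow> kl q p) (at_right 0)"
    unfolding kl_def using p q ninf[of q p] ninf[of "1 - q" "1 - p"]
    by (intro tendsto_add_ereal_general T) auto
  then show ?thesis by (simp add: skl_def)
qed

section \<open>Outer approximation uniform in one coordinate\<close>

text \<open>These sets take the place of the open sets in a regularity argument without a topology:
  they are stable under countable unions and finite intersections, and finitely many of their
  rectangles involve only finitely many sets of data.\<close>

definition rect_open :: "'f measure \<Rightarrow> 'w measure \<Rightarrow> ('f \<times> 'w) set \<Rightarrow> bool" where
  "rect_open F P U \<longleftrightarrow> (\<exists>C. countable C \<and> C \<subseteq> {E \<times> B | E B. E \<in> sets F \<and> B \<in> sets P} \<and> U = \<Union>C)"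

lemma rect_open_times: "E \<in> sets F \<Longrightarrow> B \<in> sets P \<Longrightarrow> rect_open F P (E \<times> B)"
  unfolding rect_open_def by (intro exI[of _ "{E \<times> B}"]) auto

lemma rect_open_UN:
  assumes "countable I" "\<And>i. i \<in> I \<Longrightarrow> rect_open F P (U i)"
  shows "rect_open F P (\<Union>i\<in>I. U i)"
proof -
  let ?Q = "\<lambda>i C. countable C \<and> C \<subseteq> {E \<times> B | E B. E \<in> sets F \<and> B \<in> sets P} \<and> U i = \<Union>C"
  have "\<forall>i\<in>I. \<exists>C. ?Q i C" using assms(2) unfolding rect_open_def by (intro ballI)
  then obtain C where "\<forall>i\<in>I. ?Q i (C i)" by (rule bchoice[THEN exE])
  then have C: "\<And>i. i \<in> I \<Longrightarrow> countable (C i)" "\<And>i. i \<in> I \<Longrightarrow> C i \<subseteq> {E \<times> B | E B. E \<in> sets F \<and> B \<in> sets P}"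
      "\<And>i. i \<in> I \<Longrightarrow> U i = \<Union>(C i)" by simp_all
  show ?thesis unfolding rect_open_def
  proof (intro exI[of _ "\<Union>i\<in>I. C i"] conjI)
    show "countable (\<Union>i\<in>I. C i)" using assms(1) C(1) by (rule countable_UN)
    show "(\<Union>i\<in>I. C i) \<subseteq> {E \<times> B | E B. E \<in> sets F \<and> B \<in> sets P}" using C(2) by (rule UN_least)
    show "(\<Union>i\<in>I. U i) = \<Union>(\<Union>i\<in>I. C i)" using C(3) by (simp, blast)
  qed
qed

lemma rect_open_Int:
  assumes "rect_open F P U" "rect_open F P V"
  shows "rect_open F P (U \<inter> V)"
proof -
  from assms obtain C D where C: "countable C" "C \<subseteq> {E \<times> B | E B. E \<in> sets F \<and> B \<in> sets P}" "U = \<Union>C"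
    and D: "countable D" "D \<subseteq> {E \<times> B | E B. E \<in> sets F \<and> B \<in> sets P}" "V = \<Union>D"
    unfolding rect_open_def by auto
  have "U \<inter> V = (\<Union>x\<in>C \<times> D. fst x \<inter> snd x)" using C(3) D(3) by fastforce
  also have "rect_open F P \<dots>"
  proof (rule rect_open_UN)
    fix x assume "x \<in> C \<times> D"
    then have "fst x \<in> C" "snd x \<in> D" by auto
    then have "fst x \<in> {E \<times> B | E B. E \<in> sets F \<and> B \<in> sets P}" "snd x \<in> {E \<times> B | E B. E \<in> sets F \<and> B \<in> sets P}"
      using C(2) D(2) by (blast dest: subsetD)+
    then obtain E B E' B' where "fst x = E \<times> B" "snd x = E' \<times> B'"
      "E \<in> sets F" "B \<in> sets P" "E' \<in> sets F" "B' \<in> sets P" by (elim CollectE exE conjE) (rule that)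
    then show "rect_open F P (fst x \<inter> snd x)"
      by (simp add: Times_Int_Times rect_open_times)
  qed (use C D in auto)
  finally show ?thesis .
qed

lemma rect_open_INT:
  assumes "\<And>k. k < (N::nat) \<Longrightarrow> rect_open F P (V k)"
  shows "rect_open F P ((space F \<times> space P) \<inter> (\<Inter>k<N. V k))"
  using assms
proof (induction N)
  case 0 then show ?case by (simp add: rect_open_times)
next
  case (Suc N)
  have "rect_open F P (((space F \<times> space P) \<inter> (\<Inter>k<N. V k)) \<inter> V N)"
    by (rule rect_open_Int) (use Suc in auto)
  moreover have "((space F \<times> space P) \<inter> (\<Inter>k<N. V k)) \<inter> V N = (space F \<times> space P) \<inter> (\<Inter>k<Suc N. V k)"
    by (auto simp: less_Suc_eq)
  ultimately show ?case by simp
qed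

lemma rect_open_sets: "rect_open F P U \<Longrightarrow> U \<in> sets (F \<Otimes>\<^sub>M P)"
  unfolding rect_open_def by (auto intro!: sets.countable_Union)

lemma rect_open_sequence:
  assumes "rect_open F P U"
  obtains E B where "\<And>k::nat. E k \<in> sets F" "\<And>k. B k \<in> sets P" "U = (\<Union>k. E k \<times> B k)"
proof -
  from assms obtain C where C: "countable C" "C \<subseteq> {E \<times> B | E B. E \<in> sets F \<and> B \<in> sets P}" "U = \<Union>C"
    unfolding rect_open_def by auto
  \<comment> \<open>The empty rectangle makes the family nonempty, so that it can be enumerated by
    all natural numbers.\<close>
  let ?C = "insert ({} \<times> {}) C"
  have "\<forall>k. \<exists>E B. E \<in> sets F \<and> B \<in> sets P \<and> from_nat_into ?C k = E \<times> B"
  proof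
    fix k
    have "from_nat_into ?C k \<in> ?C" by (intro from_nat_into) simp
    moreover have "?C \<subseteq> {E \<times> B | E B. E \<in> sets F \<and> B \<in> sets P}" using C(2) by blast
    ultimately show "\<exists>E B. E \<in> sets F \<and> B \<in> sets P \<and> from_nat_into ?C k = E \<times> B" by blast
  qed
  then obtain E B where EB: "\<And>k. E k \<in> sets F" "\<And>k. B k \<in> sets P" "\<And>k. from_nat_into ?C k = E k \<times> B k"
    by metis
  have "(\<Union>k. E k \<times> B k) = \<Union>(range (from_nat_into ?C))" by (simp only: EB(3)[symmetric])
  also have "range (from_nat_into ?C) = ?C" using C(1) by (intro range_from_nat_into) auto
  finally have "U = (\<Union>k. E k \<times> B k)" using C(3) by simp
  with EB that show ?thesis by blast
qed

text \<open>
  The proof of outer and inner regularity, but with an error that is uniform in \<open>f\<close>: in the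
  step for countable unions, the number of sets needed for the inner approximation depends measurably on \<open>f\<close>.
\<close>

lemma uniform_regularity:
  assumes "prob_space P" "M \<in> sets (F \<Otimes>\<^sub>M P)" "0 < e"
  shows "\<exists>U V. rect_open F P U \<and> rect_open F P V \<and> M \<subseteq> U \<and> space F \<times> space P - M \<subseteq> V \<and>
    (\<forall>f\<in>space F. measure P (Pair f -` (U \<inter> V)) \<le> e)"
proof -
  interpret P: prob_space P by fact
  have "M \<in> sigma_sets (space F \<times> space P) {a \<times> b |a b. a \<in> sets F \<and> b \<in> sets P}"
    using assms(2) by (simp add: sets_pair_measure)
  \<comment> \<open>Since \<open>V\<close> covers the complement of \<open>M\<close>, the excess of
    \<open>U\<close> over \<open>M\<close> lies in the intersection of \<open>U\<close> and
    \<open>V\<close>. This symmetric form reduces the complement case to an exchange of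
    \<open>U\<close> and \<open>V\<close>.\<close>
  then show ?thesis using \<open>0 < e\<close>
  proof (induction arbitrary: e)
    case (Basic M)
    then obtain E B where M: "M = E \<times> B" "E \<in> sets F" "B \<in> sets P" by auto
    let ?V = "\<Union>i\<in>{True,False}. if i then (space F - E) \<times> space P else space F \<times> (space P - B)"
    have "rect_open F P ?V" using M by (intro rect_open_UN) (auto intro!: rect_open_times)
    moreover have "M \<inter> ?V = {}" using M by auto
    moreover have "space F \<times> space P - M \<subseteq> ?V" using M by auto
    ultimately show ?case using M Basic.prems
      by (intro exI[of _ M] exI[of _ ?V]) (auto intro: rect_open_times)
  next
    case Empty
    then show ?case
      by (intro exI[of _ "{} \<times> {}"] exI[of _ "space F \<times> space P"])
        (auto intro: rect_open_times[OF sets.empty_sets sets.empty_sets, simplified] rect_open_times)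
  next
    case (Compl M)
    from Compl.IH[OF Compl.prems] obtain U V where UV: "rect_open F P U" "rect_open F P V" "M \<subseteq> U"
      "space F \<times> space P - M \<subseteq> V" "\<forall>f\<in>space F. measure P (Pair f -` (U \<inter> V)) \<le> e" by blast
    then show ?case by (intro exI[of _ V] exI[of _ U]) (auto simp: Int_commute)
  next
    case (Union M)
    \<comment> \<open>The errors sum to e / 2, which leaves room for the strict inequality that
      selects a finite stage.\<close>
    have "\<forall>k. \<exists>U V. rect_open F P U \<and> rect_open F P V \<and> M k \<subseteq> U \<and> space F \<times> space P - M k \<subseteq> V \<and>
        (\<forall>f\<in>space F. measure P (Pair f -` (U \<inter> V)) \<le> e / 4 * (1/2)^k)"
      by (intro allI Union.IH mult_pos_pos divide_pos_pos Union.prems zero_less_power) auto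
    then obtain U V where U: "\<And>k. rect_open F P (U k)" and V: "\<And>k. rect_open F P (V k)"
      and MU: "\<And>k. M k \<subseteq> U k" and MV: "\<And>k. space F \<times> space P - M k \<subseteq> V k"
      and m: "\<And>k f. f \<in> space F \<Longrightarrow> measure P (Pair f -` (U k \<inter> V k)) \<le> e / 4 * (1/2)^k"
      by metis
    define UU where "UU = (\<Union>k. U k)"
    \<comment> \<open>The complement of the union lies in every \<open>V k\<close>, but a countable
      intersection need not be a countable union of rectangles. Only finitely many
      \<open>V k\<close> are intersected at each stage.\<close>
    define VV where "VV N = (space F \<times> space P) \<inter> (\<Inter>k<N. V k)" for N
    have UU: "rect_open F P UU" unfolding UU_def using U by (intro rect_open_UN) auto
    have VV: "rect_open F P (VV N)" for N unfolding VV_def using V by (intro rect_open_INT) auto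
    note [measurable] = rect_open_sets[OF UU] rect_open_sets[OF VV] rect_open_sets[OF U] rect_open_sets[OF V]
    define D where "D N f = measure P (Pair f -` (UU \<inter> VV N))" for N f
    have D_meas[measurable]: "D N \<in> borel_measurable F" for N
      unfolding D_def measure_def
      by (intro borel_measurable_enn2real P.measurable_emeasure_Pair) measurable
    have ex: "\<exists>N. D N f < e" if f: "f \<in> space F" for f
    proof -
      have sec: "Pair f -` X \<in> sets P" if "X \<in> sets (F \<Otimes>\<^sub>M P)" for X using that by (rule sets_Pair1)
      have sD: "Pair f -` (UU \<inter> VV N) \<in> sets P" "Pair f -` (U N \<inter> V N) \<in> sets P" for N
        by (rule sec; measurable)+
      have "decseq (\<lambda>N. Pair f -` (UU \<inter> VV N))" unfolding decseq_def VV_def by fastforce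
      then have "(\<lambda>N. D N f) \<longlonglongrightarrow> measure P (\<Inter>N. Pair f -` (UU \<inter> VV N))"
        unfolding D_def using sD(1) by (intro P.finite_Lim_measure_decseq) blast+
      moreover have "measure P (\<Inter>N. Pair f -` (UU \<inter> VV N)) < e"
      proof -
        have s: "(\<lambda>k. e / 4 * (1/2)^k) sums (e / 4 * 2)"
          using sums_mult[OF geometric_sums[of "1/2::real"], of "e/4"] by simp
        have sm: "summable (\<lambda>k. measure P (Pair f -` (U k \<inter> V k)))"
          using m[OF f] by (intro summable_comparison_test'[OF sums_summable[OF s]]) auto
        have "measure P (\<Inter>N. Pair f -` (UU \<inter> VV N)) \<le> measure P (\<Union>k. Pair f -` (U k \<inter> V k))"
        proof (rule P.finite_measure_mono)
          show "(\<Inter>N. Pair f -` (UU \<inter> VV N)) \<subseteq> (\<Union>k. Pair f -` (U k \<inter> V k))"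
            by (auto simp: UU_def VV_def)
          show "(\<Union>k. Pair f -` (U k \<inter> V k)) \<in> sets P" using sD(2) by blast
        qed
        also have "\<dots> \<le> (\<Sum>k. measure P (Pair f -` (U k \<inter> V k)))"
          using sm by (intro P.finite_measure_subadditive_countably) (use sD(2) in blast)+
        also have "\<dots> \<le> (\<Sum>k. e / 4 * (1/2)^k)"
          using m[OF f] sm s by (intro suminf_le sums_summable) auto
        also have "\<dots> = e / 4 * 2" using s by (rule sums_unique[symmetric])
        also have "\<dots> < e" using Union.prems by simp
        finally show ?thesis .
      qed
      ultimately have "eventually (\<lambda>N. D N f < e) sequentially" by (rule order_tendstoD)
      then show ?thesis by (auto simp: eventually_sequentially)
    qed
    define L where "L f = (LEAST N. D N f < e)" for f
    have L_meas[measurable]: "L \<in> measurable F (count_space UNIV)" unfolding L_def by measurable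
    \<comment> \<open>The level sets of \<open>L\<close> are measurable, so the stages chosen for
      different \<open>f\<close> paste together to one countable union of rectangles.\<close>
    define W where "W = (\<Union>N. ({f\<in>space F. L f = N} \<times> space P) \<inter> VV N)"
    have W: "rect_open F P W" unfolding W_def
      by (intro rect_open_UN rect_open_Int rect_open_times VV) auto
    have W_sec: "Pair f -` (UU \<inter> W) = Pair f -` (UU \<inter> VV (L f))" if "f \<in> space F" for f
      using that by (auto simp: W_def VV_def)
    have "measure P (Pair f -` (UU \<inter> W)) \<le> e" if "f \<in> space F" for f
      unfolding W_sec[OF that] D_def[symmetric] L_def by (rule less_imp_le[OF LeastI_ex[OF ex[OF that]]])
    moreover have "(\<Union>k. M k) \<subseteq> UU" using MU by (auto simp: UU_def)
    moreover have "space F \<times> space P - (\<Union>k. M k) \<subseteq> W" using MV by (fastforce simp: W_def VV_def)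
    ultimately show ?case using UU W by blast
  qed
qed

text \<open>The number of levels strictly below \<open>y\<close> is the ceiling of y / h, so the sum
  rounds \<open>y\<close> up to a multiple of \<open>h\<close>.\<close>

lemma layer_cake_bounds:
  fixes y h :: real assumes "0 < h" "0 \<le> y" "y \<le> h * real K"
  shows "y \<le> h * (\<Sum>k<K. of_bool (h * real k < y))" "h * (\<Sum>k<K. of_bool (h * real k < y)) \<le> y + h"
proof -
  have "{k. k < K \<and> h * real k < y} = {..<nat \<lceil>y / h\<rceil>}"
  proof -
    have a: "h * real k < y \<longleftrightarrow> k < nat \<lceil>y / h\<rceil>" for k
      using assms by (simp add: less_ceiling_iff zless_nat_eq_int_zless field_simps)
    have "nat \<lceil>y / h\<rceil> \<le> K" using assms by (simp add: nat_le_iff ceiling_le_iff field_simps)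
    then show ?thesis unfolding a by (auto simp only: lessThan_def intro: less_le_trans)
  qed
  then have "(\<Sum>k<K. of_bool (h * real k < y) :: real) = real (nat \<lceil>y / h\<rceil>)"
    by (simp add: of_bool_def sum.If_cases Int_def)
  moreover have "y / h \<le> real (nat \<lceil>y / h\<rceil>)" by linarith
  moreover have "real (nat \<lceil>y / h\<rceil>) \<le> y / h + 1"
  proof -
    have "0 \<le> y / h" using assms by simp
    then show ?thesis by linarith
  qed
  ultimately show "y \<le> h * (\<Sum>k<K. of_bool (h * real k < y))" "h * (\<Sum>k<K. of_bool (h * real k < y)) \<le> y + h"
    using assms(1) by (simp_all add: field_simps)
qed

text \<open>Each superlevel set of \<open>g\<close> on a grid is covered by countably many
  rectangles, with a small excess in every section, and \<open>G N\<close> keeps only the first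
  \<open>N\<close> rectangles of each cover. It therefore sees \<open>w\<close> only through
  membership in finitely many sets, which \<open>c N w\<close> records. Truncation costs the
  domination of \<open>g\<close> at a fixed \<open>N\<close>; it is recovered pointwise for large
  \<open>N\<close>, while the bound on the integrals holds at every \<open>N\<close>.\<close>

lemma uniform_outer_approximation:
  fixes g :: "'f \<times> 'w \<Rightarrow> real"
  assumes "prob_space P" and g[measurable]: "g \<in> borel_measurable (F \<Otimes>\<^sub>M P)"
    and g0: "\<And>x. x \<in> space (F \<Otimes>\<^sub>M P) \<Longrightarrow> 0 \<le> g x" and gC: "\<And>x. x \<in> space (F \<Otimes>\<^sub>M P) \<Longrightarrow> g x \<le> C" and "0 < e"
  obtains G :: "nat \<Rightarrow> 'f \<times> 'w \<Rightarrow> real" and a b :: real and c :: "nat \<Rightarrow> 'w \<Rightarrow> (nat \<times> nat) set"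
  where "\<And>N. G N \<in> borel_measurable (F \<Otimes>\<^sub>M P)" "0 < a" "\<And>N x. a \<le> G N x" "\<And>N x. G N x \<le> b"
    "\<And>x. x \<in> space (F \<Otimes>\<^sub>M P) \<Longrightarrow> \<exists>N0. \<forall>N\<ge>N0. g x \<le> G N x"
    "\<And>N f. f \<in> space F \<Longrightarrow> (\<integral>w. G N (f, w) \<partial>P) \<le> (\<integral>w. g (f, w) \<partial>P) + e"
    "\<And>N. finite (range (c N))" "\<And>N s. {w \<in> space P. c N w = s} \<in> sets P"
    "\<And>N f w w'. c N w = c N w' \<Longrightarrow> G N (f, w) = G N (f, w')"
proof -
  interpret P: prob_space P by fact
  \<comment> \<open>Three errors of at most \<open>h\<close> occur: the additive constant in
    \<open>G\<close>, the total excess of the \<open>K\<close> covers, and the rounding to the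
    grid.\<close>
  define h where "h = e / 4"
  have "0 < h" using \<open>0 < e\<close> by (simp add: h_def)
  obtain K where K: "C \<le> h * real K"
    using reals_Archimedean3[OF \<open>0 < h\<close>] by (metis less_imp_le mult.commute)
  define M where "M k = {x \<in> space (F \<Otimes>\<^sub>M P). h * real k < g x}" for k :: nat
  have M[measurable]: "M k \<in> sets (F \<Otimes>\<^sub>M P)" for k unfolding M_def by measurable
  define d where "d = 1 / (real K + 1)"
  have "0 < d" by (simp add: d_def)
  obtain U V where U: "\<And>k. rect_open F P (U k)" and V: "\<And>k. rect_open F P (V k)"
    and MU: "\<And>k. M k \<subseteq> U k" and MV: "\<And>k. space F \<times> space P - M k \<subseteq> V k"
    and UV: "\<And>k f. f \<in> space F \<Longrightarrow> measure P (Pair f -` (U k \<inter> V k)) \<le> d"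
    using uniform_regularity[OF \<open>prob_space P\<close> M \<open>0 < d\<close>] by metis
  have "\<forall>k. \<exists>E B. (\<forall>i. E i \<in> sets F) \<and> (\<forall>i. B i \<in> sets P) \<and> U k = (\<Union>i::nat. E i \<times> B i)"
  proof
    fix k show "\<exists>E B. (\<forall>i. E i \<in> sets F) \<and> (\<forall>i. B i \<in> sets P) \<and> U k = (\<Union>i::nat. E i \<times> B i)"
      by (rule rect_open_sequence[OF U[of k]]) blast
  qed
  then obtain E B where E[measurable]: "\<And>k i. E k i \<in> sets F" and B[measurable]: "\<And>k i. B k i \<in> sets P"
    and UEB: "\<And>k. U k = (\<Union>i::nat. E k i \<times> B k i)"
    by metis
  note [measurable] = rect_open_sets[OF U] rect_open_sets[OF V]
  define Uf where "Uf N k = (\<Union>i<N. E k i \<times> B k i)" for N k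
  have Uf_U: "Uf N k \<subseteq> U k" for N k by (auto simp: Uf_def UEB)
  have Uf_meas[measurable]: "Uf N k \<in> sets (F \<Otimes>\<^sub>M P)" for N k unfolding Uf_def by measurable
  \<comment> \<open>The additive \<open>h\<close> keeps \<open>G N\<close> away from 0, so that its
    logarithm is bounded.\<close>
  define G where "G N x = h + h * (\<Sum>k<K. indicator (Uf N k) x)" for N x
  define c where "c N w = {(k, i). k < K \<and> i < N \<and> w \<in> B k i}" for N w
  have G_meas: "G N \<in> borel_measurable (F \<Otimes>\<^sub>M P)" for N unfolding G_def by measurable
  have G_lower: "h \<le> G N x" for N x
    unfolding G_def using \<open>0 < h\<close> by (simp add: sum_nonneg)
  have G_upper: "G N x \<le> h + h * real K" for N x
  proof -
    have "(\<Sum>k<K. indicator (Uf N k) x :: real) \<le> (\<Sum>k<K. 1)" by (intro sum_mono) (simp add: indicator_def)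
    then show ?thesis unfolding G_def using \<open>0 < h\<close> by simp
  qed
  have G_ev: "\<exists>N0. \<forall>N\<ge>N0. g x \<le> G N x" if x: "x \<in> space (F \<Otimes>\<^sub>M P)" for x
  proof -
    have "\<exists>i. x \<in> M k \<longrightarrow> x \<in> E k i \<times> B k i" for k
      using subsetD[OF MU[of k], of x] unfolding UEB by blast
    then obtain i where i: "\<And>k. x \<in> M k \<Longrightarrow> x \<in> E k (i k) \<times> B k (i k)" by metis
    define N0 where "N0 = Suc (\<Sum>k<K. i k)"
    have "g x \<le> G N x" if "N0 \<le> N" for N
    proof -
      have "of_bool (h * real k < g x) \<le> (indicator (Uf N k) x :: real)" if k: "k < K" for k
      proof (cases "h * real k < g x")
        case True
        then have "x \<in> M k" using x by (simp add: M_def)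
        moreover have "i k \<le> (\<Sum>k<K. i k)" using k by (intro member_le_sum) auto
        ultimately have "x \<in> Uf N k" using i[of k] \<open>N0 \<le> N\<close> unfolding Uf_def N0_def
          by (intro UN_I[of "i k"]) auto
        then show ?thesis by simp
      qed simp
      then have "(\<Sum>k<K. of_bool (h * real k < g x)) \<le> (\<Sum>k<K. indicator (Uf N k) x :: real)"
        by (intro sum_mono) auto
      then have "h * (\<Sum>k<K. of_bool (h * real k < g x)) \<le> h * (\<Sum>k<K. indicator (Uf N k) x)"
        using \<open>0 < h\<close> by (intro mult_left_mono) auto
      moreover have "g x \<le> h * (\<Sum>k<K. of_bool (h * real k < g x))"
        using \<open>0 < h\<close> g0[OF x] gC[OF x] K by (intro layer_cake_bounds) auto
      ultimately show ?thesis using \<open>0 < h\<close> unfolding G_def by linarith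
    qed
    then show ?thesis by blast
  qed
  have G_int: "(\<integral>w. G N (f, w) \<partial>P) \<le> (\<integral>w. g (f, w) \<partial>P) + e" if f: "f \<in> space F" for N f
  proof -
    have sec: "Pair f -` X \<in> sets P" if "X \<in> sets (F \<Otimes>\<^sub>M P)" for X using that by (rule sets_Pair1)
    have ind: "indicator X (f, w) = (indicator (Pair f -` X) w :: real)" for X w by (simp add: indicator_def)
    have le1: "measure P (Pair f -` Uf N k) \<le> measure P (Pair f -` M k) + d" for k
    proof -
      have s2: "Pair f -` M k \<in> sets P" by (rule sec) measurable
      have s3: "Pair f -` (U k \<inter> V k) \<in> sets P" by (rule sec) measurable
      have "Pair f -` Uf N k \<subseteq> Pair f -` M k \<union> Pair f -` (U k \<inter> V k)"
        using Uf_U[of N k] MV[of k] rect_open_sets[OF U, THEN sets.sets_into_space, of k]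
        unfolding space_pair_measure by blast
      then have "measure P (Pair f -` Uf N k) \<le> measure P (Pair f -` M k \<union> Pair f -` (U k \<inter> V k))"
        by (rule P.finite_measure_mono) (rule sets.Un[OF s2 s3])
      also have "\<dots> \<le> measure P (Pair f -` M k) + measure P (Pair f -` (U k \<inter> V k))"
        by (rule measure_Un_le[OF s2 s3])
      finally show ?thesis using UV[OF f, of k] by linarith
    qed
    have [measurable]: "Pair f \<in> measurable P (F \<Otimes>\<^sub>M P)" using f by simp
    have gi: "integrable P (\<lambda>w. g (f, w))"
      using g0 gC f by (intro P.integrable_const_bound[where B=C]) (auto simp: space_pair_measure)
    have "(\<integral>w. G N (f, w) \<partial>P) = h + h * (\<Sum>k<K. measure P (Pair f -` Uf N k))"
    proof -
      have "integrable P (indicator (Pair f -` Uf N k) :: _ \<Rightarrow> real)" for k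
        using sec[OF Uf_meas] by (simp add: integrable_indicator_iff less_top[symmetric])
      then have "(\<integral>w. G N (f, w) \<partial>P) = h + h * (\<Sum>k<K. (\<integral>w. indicator (Pair f -` Uf N k) w \<partial>P))"
        unfolding G_def ind by (simp add: P.prob_space)
      then show ?thesis using sec[OF Uf_meas, THEN sets.sets_into_space] by (simp add: Int_absorb2)
    qed
    also have "\<dots> \<le> h + h * (\<Sum>k<K. measure P (Pair f -` M k) + d)"
      using \<open>0 < h\<close> by (intro add_mono mult_left_mono sum_mono le1) auto
    also have "\<dots> = h + h * (real K * d) + h * (\<Sum>k<K. measure P (Pair f -` M k))"
      by (simp add: sum.distrib distrib_left)
    also have "\<dots> \<le> h + h * 1 + h * (\<Sum>k<K. measure P (Pair f -` M k))"
      using \<open>0 < h\<close> by (intro add_mono mult_left_mono) (auto simp: d_def)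
    also have "h * (\<Sum>k<K. measure P (Pair f -` M k)) = (\<integral>w. h * (\<Sum>k<K. indicator (Pair f -` M k) w) \<partial>P)"
    proof -
      have "integrable P (indicator (Pair f -` M k) :: _ \<Rightarrow> real)" for k
        using sec[OF M] by (simp add: integrable_indicator_iff less_top[symmetric])
      then show ?thesis using sec[OF M, THEN sets.sets_into_space] by (simp add: Int_absorb2)
    qed
    also have "\<dots> \<le> (\<integral>w. g (f, w) + h \<partial>P)"
    proof (rule integral_mono)
      show "integrable P (\<lambda>w. h * (\<Sum>k<K. indicator (Pair f -` M k) w))"
        using sec[OF M] by (intro integrable_mult_right Bochner_Integration.integrable_sum)
          (simp add: integrable_indicator_iff less_top[symmetric])
      show "integrable P (\<lambda>w. g (f, w) + h)" using gi by simp
      fix w assume "w \<in> space P"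
      then have x: "(f, w) \<in> space (F \<Otimes>\<^sub>M P)" using f by (simp add: space_pair_measure)
      then have "indicator (Pair f -` M k) w = (of_bool (h * real k < g (f, w)) :: real)" for k
        by (simp add: M_def indicator_def)
      then show "h * (\<Sum>k<K. indicator (Pair f -` M k) w) \<le> g (f, w) + h"
        using layer_cake_bounds(2)[of h "g (f, w)" K] \<open>0 < h\<close> g0[OF x] gC[OF x] K by simp
    qed
    also have "\<dots> = (\<integral>w. g (f, w) \<partial>P) + h" using gi by (simp add: P.prob_space)
    finally show ?thesis using \<open>0 < e\<close> by (simp add: h_def)
  qed
  have c_fin: "finite (range (c N))" for N
    by (rule finite_subset[of _ "Pow ({..<K} \<times> {..<N})"]) (auto simp: c_def)
  have c_meas: "{w \<in> space P. c N w = s} \<in> sets P" for N s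
  proof -
    have "{w \<in> space P. c N w = s} = {w \<in> space P. s \<subseteq> {..<K} \<times> {..<N} \<and>
        (\<forall>k\<in>{..<K}. \<forall>i\<in>{..<N}. w \<in> B k i \<longleftrightarrow> (k, i) \<in> s)}"
      unfolding c_def by auto
    also have "\<dots> \<in> sets P" by measurable
    finally show ?thesis .
  qed
  have c_const: "G N (f, w) = G N (f, w')" if "c N w = c N w'" for N f w w'
  proof -
    have "w \<in> B k i \<longleftrightarrow> w' \<in> B k i" if "k < K" "i < N" for k i
      using \<open>c N w = c N w'\<close> that unfolding c_def by blast
    then have "indicator (Uf N k) (f, w) = (indicator (Uf N k) (f, w') :: real)" if "k < K" for k
      using that unfolding Uf_def indicator_def by auto
    then show ?thesis unfolding G_def by simp
  qed
  show ?thesis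
    by (rule that[of G h "h + h * real K" c, OF G_meas \<open>0 < h\<close> G_lower G_upper G_ev G_int c_fin c_meas c_const])
qed

section \<open>Exponential moments without a measurable family of priors\<close>

text \<open>Pushing \<open>L x\<close> forward to the pairs (x, y) moves the dependence on
  \<open>x\<close> from the integrand into the measure, and the integral of a fixed function is
  measurable in the measure.\<close>

lemma integral_measurable_kernel:
  fixes f :: "'x \<Rightarrow> 'y \<Rightarrow> real"
  assumes f[measurable]: "(\<lambda>(x, y). f x y) \<in> borel_measurable (M \<Otimes>\<^sub>M N)"
    and L: "L \<in> measurable M (prob_algebra N)"
  shows "(\<lambda>x. integral\<^sup>L (L x) (f x)) \<in> borel_measurable M"
proof -
  have L'[measurable]: "L \<in> measurable M (subprob_algebra N)" using L by (rule measurable_prob_algebraD)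
  note integral_measurable_subprob_algebra[measurable] measurable_distr2[measurable]
  have "(\<lambda>x. integral\<^sup>L (distr (L x) (M \<Otimes>\<^sub>M N) (\<lambda>y. (x, y))) (\<lambda>(x, y). f x y)) \<in> borel_measurable M"
    by measurable
  then show ?thesis
  proof (rule measurable_cong[THEN iffD1, rotated])
    fix x assume "x \<in> space M"
    then show "integral\<^sup>L (distr (L x) (M \<Otimes>\<^sub>M N) (\<lambda>y. (x, y))) (\<lambda>(x, y). f x y) = integral\<^sup>L (L x) (f x)"
      by (subst integral_distr) (auto simp: measurable_cong_sets[OF sets_kernel[OF L'] refl])
  qed
qed

lemma tendsto_nn_integral_0:
  fixes u :: "nat \<Rightarrow> 'x \<Rightarrow> ennreal"
  assumes "prob_space M" and [measurable]: "\<And>N. u N \<in> borel_measurable M"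
    and bnd: "\<And>N x. x \<in> space M \<Longrightarrow> u N x \<le> ennreal T" and lim: "\<And>x. x \<in> space M \<Longrightarrow> (\<lambda>N. u N x) \<longlonglongrightarrow> 0"
  shows "(\<lambda>N. \<integral>\<^sup>+x. u N x \<partial>M) \<longlonglongrightarrow> 0"
proof -
  interpret prob_space M by fact
  have "(\<lambda>N. \<integral>\<^sup>+x. u N x \<partial>M) \<longlonglongrightarrow> (\<integral>\<^sup>+x. 0 \<partial>M)"
    by (rule nn_integral_dominated_convergence[where w="\<lambda>_. ennreal T"])
      (use bnd lim in \<open>auto simp: emeasure_space_1\<close>)
  then show ?thesis by simp
qed

text \<open>Multiply exp (- y) \<ge> 1 - y by exp y. A linear bound is wanted because
  \<open>y\<close> will be a shortfall that is controlled only in mean.\<close>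

lemma exp_le_linear: fixes y T :: real assumes "0 \<le> y" "y \<le> T" shows "exp y \<le> 1 + exp T * y"
proof -
  have "exp (- y) \<ge> 1 - y" using exp_ge_add_one_self[of "- y"] by simp
  then have "exp y * (1 - y) \<le> exp y * exp (- y)" by (intro mult_left_mono) auto
  then have "exp y \<le> 1 + exp y * y" by (simp add: algebra_simps flip: exp_add)
  also have "\<dots> \<le> 1 + exp T * y" using assms by (intro add_left_mono mult_right_mono) auto
  finally show ?thesis .
qed

text \<open>
  In the application \<open>v A = exp (- KL)\<close>, and the hypothesis on \<open>v\<close> is the Donsker--Varadhan
  inequality. The family \<open>\<mu>\<close> is arbitrary.
\<close>

lemma pac_bayes_nonmeasurable_prior:
  fixes \<pi> :: "'a measure" and g :: "'f \<times> 'w \<Rightarrow> real" and K :: "'a \<times> 'w \<Rightarrow> 'f measure" and \<mu> :: "'a \<Rightarrow> 'f measure"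
  assumes "prob_space P" "prob_space \<pi>"
    and K[measurable]: "K \<in> measurable (\<pi> \<Otimes>\<^sub>M P) (prob_algebra F)"
    and g[measurable]: "g \<in> borel_measurable (F \<Otimes>\<^sub>M P)" and "0 < a0"
    and g_lower: "\<And>x. x \<in> space (F \<Otimes>\<^sub>M P) \<Longrightarrow> a0 \<le> g x" and g_upper: "\<And>x. x \<in> space (F \<Otimes>\<^sub>M P) \<Longrightarrow> g x \<le> b0"
    and g_int: "\<And>f. f \<in> space F \<Longrightarrow> (\<integral>w. g (f, w) \<partial>P) \<le> 1"
    and mu: "\<And>A. A \<in> space \<pi> \<Longrightarrow> \<mu> A \<in> space (prob_algebra F)"
    and "0 < e" "0 < c"
  shows "\<exists>C\<in>sets P. measure P C \<le> 1 / c + e \<and> (\<forall>w\<in>space P - C. \<forall>v\<in>borel_measurable \<pi>.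
      (\<forall>A\<in>space \<pi>. 0 \<le> v A \<and> (\<forall>\<gamma>\<in>borel_measurable F. (\<exists>B. \<forall>f\<in>space F. \<bar>\<gamma> f\<bar> \<le> B) \<longrightarrow>
          v A * exp (\<integral>f. \<gamma> f \<partial>K (A, w)) \<le> (\<integral>f. exp (\<gamma> f) \<partial>\<mu> A)))
      \<longrightarrow> (\<integral>\<^sup>+A. ennreal (v A * exp (\<integral>f. ln (g (f, w)) \<partial>K (A, w))) \<partial>\<pi>) \<le> ennreal c)"
proof -
  interpret P: prob_space P by fact
  interpret pi: prob_space \<pi> by fact
  \<comment> \<open>The exceptional set will cost e1 + (1 + 2 e1) / c; this choice makes it 1 / c +
    e.\<close>
  define e1 where "e1 = e / (1 + 2 / c)"
  have "0 < e1" using \<open>0 < e\<close> \<open>0 < c\<close> by (simp add: e1_def add_pos_pos)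
  have g0: "0 \<le> g x" if "x \<in> space (F \<Otimes>\<^sub>M P)" for x
    using g_lower[OF that] \<open>0 < a0\<close> by linarith
  obtain G :: "nat \<Rightarrow> 'f \<times> 'w \<Rightarrow> real" and cell_of :: "nat \<Rightarrow> 'w \<Rightarrow> (nat \<times> nat) set" and a b :: real where G[measurable]: "\<And>N. G N \<in> borel_measurable (F \<Otimes>\<^sub>M P)" and "0 < a"
    and Ga: "\<And>N x. a \<le> G N x" and Gb: "\<And>N x. G N x \<le> b"
    and G_ev: "\<And>x. x \<in> space (F \<Otimes>\<^sub>M P) \<Longrightarrow> \<exists>N0. \<forall>N\<ge>N0. g x \<le> G N x"
    and G_int: "\<And>N f. f \<in> space F \<Longrightarrow> (\<integral>w. G N (f, w) \<partial>P) \<le> (\<integral>w. g (f, w) \<partial>P) + e1"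
    and cell_of_fin: "\<And>N. finite (range (cell_of N))" and cell_of_meas: "\<And>N s. {w \<in> space P. cell_of N w = s} \<in> sets P"
    and cell_of_const: "\<And>N f w w'. cell_of N w = cell_of N w' \<Longrightarrow> G N (f, w) = G N (f, w')"
  proof (rule uniform_outer_approximation[OF \<open>prob_space P\<close> g g0 g_upper \<open>0 < e1\<close>], goal_cases)
    case (3 G a b c)
    show ?case by (rule 3(1)[OF 3(2-10)])
  qed (assumption+)
  have "0 < b" using \<open>0 < a\<close> Ga[of 0 undefined] Gb[of 0 undefined] by linarith
  define T where "T = \<bar>ln b0 - ln a\<bar>"
  have [measurable]: "K \<in> measurable (\<pi> \<Otimes>\<^sub>M P) (subprob_algebra F)"
    using K by (rule measurable_prob_algebraD)
  have Kprob: "prob_space (K (A, w))" and Ksets: "sets (K (A, w)) = sets F" if "A \<in> space \<pi>" "w \<in> space P" for A w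
    using measurable_space[OF K, of "(A, w)"] that by (auto simp: space_pair_measure space_prob_algebra)
  have Kspace: "space (K (A, w)) = space F" if "A \<in> space \<pi>" "w \<in> space P" for A w
    using Ksets[OF that] by (rule sets_eq_imp_space_eq)
  have gap_le: "ln (g (f, w)) - ln (G N (f, w)) \<le> T" if "f \<in> space F" "w \<in> space P" for f w N
  proof -
    have x: "(f, w) \<in> space (F \<Otimes>\<^sub>M P)" using that by (simp add: space_pair_measure)
    have "ln (g (f, w)) \<le> ln b0" "ln a \<le> ln (G N (f, w))"
      using g_lower[OF x] g_upper[OF x] Ga[of N "(f, w)"] \<open>0 < a\<close> \<open>0 < a0\<close> by simp_all
    then show ?thesis by (simp add: T_def)
  qed
  have sec1: "(\<lambda>f. h (f, w)) \<in> borel_measurable F" if "h \<in> borel_measurable (F \<Otimes>\<^sub>M P)" "w \<in> space P" for h :: "_ \<Rightarrow> real" and w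
    using measurable_compose[OF measurable_Pair2'[OF that(2)] that(1)] .
  have sec2: "(\<lambda>w. h (f, w)) \<in> borel_measurable P" if "h \<in> borel_measurable (F \<Otimes>\<^sub>M P)" "f \<in> space F" for h :: "_ \<Rightarrow> real" and f
    using measurable_compose[OF measurable_Pair1'[OF that(2)] that(1)] .
  have lng_meas: "(\<lambda>f. ln (g (f, w))) \<in> borel_measurable F" if "w \<in> space P" for w
    by (intro borel_measurable_ln sec1 g that)
  have lnG_meas: "(\<lambda>f. ln (G N (f, w))) \<in> borel_measurable F" if "w \<in> space P" for w N
    by (intro borel_measurable_ln sec1 G that)
  have absG: "\<bar>G N x\<bar> \<le> b" for N x using Ga[of N x] Gb[of N x] \<open>0 < a\<close> by simp
  \<comment> \<open>Because \<open>ennreal\<close> keeps only the positive part, \<open>D\<close> is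
    the mean shortfall of ln (G N) below ln g. It tends to 0, since \<open>G N\<close> eventually
    dominates \<open>g\<close> at each point.\<close>
  define D where "D N A w = (\<integral>\<^sup>+f. ennreal (ln (g (f, w)) - ln (G N (f, w))) \<partial>K (A, w))" for N A w
  have D_meas[measurable]: "(\<lambda>(A, w). D N A w) \<in> borel_measurable (\<pi> \<Otimes>\<^sub>M P)" for N
    unfolding D_def case_prod_beta
    by (rule nn_integral_measurable_subprob_algebra2[where N=F]) simp_all
  have D_le: "D N A w \<le> ennreal T" if "A \<in> space \<pi>" "w \<in> space P" for N A w
  proof -
    interpret prob_space "K (A, w)" using that by (rule Kprob)
    have "D N A w \<le> (\<integral>\<^sup>+f. ennreal T \<partial>K (A, w))" unfolding D_def
      using that by (intro nn_integral_mono ennreal_leI gap_le) (auto simp: Kspace)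
    then show ?thesis by (simp add: emeasure_space_1)
  qed
  have D_lim: "(\<lambda>N. D N A w) \<longlonglongrightarrow> 0" if "A \<in> space \<pi>" "w \<in> space P" for A w
    unfolding D_def
  proof (rule tendsto_nn_integral_0[OF Kprob[OF that]])
    show "(\<lambda>f. ennreal (ln (g (f, w)) - ln (G N (f, w)))) \<in> borel_measurable (K (A, w))" for N
      unfolding measurable_cong_sets[OF Ksets[OF that] refl] using that(2)
      by (intro measurable_compose[OF _ measurable_ennreal] borel_measurable_diff lng_meas lnG_meas)
    fix f assume "f \<in> space (K (A, w))"
    then have f: "f \<in> space F" using that by (simp add: Kspace)
    show "ennreal (ln (g (f, w)) - ln (G N (f, w))) \<le> ennreal T" for N
      using f that by (intro ennreal_leI gap_le)
    have x: "(f, w) \<in> space (F \<Otimes>\<^sub>M P)" using f that by (simp add: space_pair_measure)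
    from G_ev[OF x] obtain N0 where N0: "\<And>N. N \<ge> N0 \<Longrightarrow> g (f, w) \<le> G N (f, w)" by blast
    have "ennreal (ln (g (f, w)) - ln (G N (f, w))) = 0" if "N \<ge> N0" for N
    proof -
      have "ln (g (f, w)) \<le> ln (G N (f, w))"
        using N0[OF that] g_lower[OF x] \<open>0 < a0\<close> by simp
      then show ?thesis by (simp add: ennreal_neg)
    qed
    then show "(\<lambda>N. ennreal (ln (g (f, w)) - ln (G N (f, w)))) \<longlonglongrightarrow> 0"
      by (intro tendsto_eventually) (auto simp: eventually_sequentially)
  qed
  define \<kappa> where "\<kappa> N w = (\<integral>\<^sup>+A. D N A w \<partial>\<pi>)" for N w
  have \<kappa>_meas[measurable]: "\<kappa> N \<in> borel_measurable P" for N
  proof -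
    have [measurable]: "(\<lambda>(w, A). D N A w) \<in> borel_measurable (P \<Otimes>\<^sub>M \<pi>)"
      using measurable_compose[OF measurable_pair_swap' D_meas[of N]] by (simp add: case_prod_beta)
    show ?thesis unfolding \<kappa>_def by (rule pi.borel_measurable_nn_integral) measurable
  qed
  have D_meas1: "(\<lambda>A. D N A w) \<in> borel_measurable \<pi>" if "w \<in> space P" for N w
    using measurable_compose[OF measurable_Pair2'[OF that] D_meas[of N]] by simp
  have \<kappa>_lim: "(\<lambda>N. \<kappa> N w) \<longlonglongrightarrow> 0" if "w \<in> space P" for w
    unfolding \<kappa>_def using that
    by (intro tendsto_nn_integral_0[OF \<open>prob_space \<pi>\<close>, where T=T] D_meas1 D_le D_lim)
  have \<kappa>_le: "\<kappa> N w \<le> ennreal T" if "w \<in> space P" for N w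
  proof -
    have "\<kappa> N w \<le> (\<integral>\<^sup>+A. ennreal T \<partial>\<pi>)" unfolding \<kappa>_def
      using that by (intro nn_integral_mono D_le)
    then show ?thesis by (simp add: pi.emeasure_space_1)
  qed
  have "(\<lambda>N. \<integral>\<^sup>+w. \<kappa> N w \<partial>P) \<longlonglongrightarrow> 0"
    by (intro tendsto_nn_integral_0[OF \<open>prob_space P\<close>, where T=T] \<kappa>_meas \<kappa>_le \<kappa>_lim)
  \<comment> \<open>The shortfall enters the final estimate with the factor b * exp T, so a
    shortfall of at most \<eta> costs e1. The stage \<open>N\<close> is then fixed such that, by
    Markov's inequality, the data with a larger shortfall also have probability at most e1.\<close>
  define \<eta> where "\<eta> = e1 / (b * exp T)"
  have "0 < \<eta>" using \<open>0 < e1\<close> \<open>0 < b\<close> by (simp add: \<eta>_def)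
  from order_tendstoD(2)[OF \<open>(\<lambda>N. \<integral>\<^sup>+w. \<kappa> N w \<partial>P) \<longlonglongrightarrow> 0\<close>, of "ennreal (e1 * \<eta>)"]
  obtain N where N: "(\<integral>\<^sup>+w. \<kappa> N w \<partial>P) \<le> ennreal (e1 * \<eta>)"
    using \<open>0 < e1\<close> \<open>0 < \<eta>\<close> by (auto simp: eventually_sequentially intro: less_imp_le)
  define Ex where "Ex = {w \<in> space P. ennreal \<eta> \<le> \<kappa> N w}"
  have Ex[measurable]: "Ex \<in> sets P" unfolding Ex_def by measurable
  have Ex_le: "measure P Ex \<le> e1"
  proof -
    have "ennreal \<eta> * emeasure P Ex = (\<integral>\<^sup>+w. ennreal \<eta> * indicator Ex w \<partial>P)"
      by (simp add: nn_integral_cmult_indicator)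
    also have "\<dots> \<le> (\<integral>\<^sup>+w. \<kappa> N w \<partial>P)"
      by (intro nn_integral_mono) (auto simp: Ex_def indicator_def)
    also note N
    finally have "ennreal (\<eta> * measure P Ex) \<le> ennreal (e1 * \<eta>)"
      using \<open>0 < \<eta>\<close> by (simp add: P.emeasure_eq_measure ennreal_mult')
    then have "\<eta> * measure P Ex \<le> e1 * \<eta>"
      using \<open>0 < \<eta>\<close> \<open>0 < e1\<close> by (subst (asm) ennreal_le_iff) auto
    then show ?thesis using \<open>0 < \<eta>\<close> by (simp add: mult.commute)
  qed
  \<comment> \<open>Of a hyper-posterior only the weight \<open>v\<close> with its variational
    inequality is retained. The weights for different data are chosen independently of each other,
    without measurability in \<open>w\<close>.\<close>
  define ok where "ok w v \<longleftrightarrow> v \<in> borel_measurable \<pi> \<and> (\<forall>A\<in>space \<pi>. 0 \<le> v A \<and>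
      (\<forall>\<gamma>\<in>borel_measurable F. (\<exists>B. \<forall>f\<in>space F. \<bar>\<gamma> f\<bar> \<le> B) \<longrightarrow>
          v A * exp (\<integral>f. \<gamma> f \<partial>K (A, w)) \<le> (\<integral>f. exp (\<gamma> f) \<partial>\<mu> A)))" for w and v :: "'a \<Rightarrow> real"
  have okD: "v A * exp (\<integral>f. \<gamma> f \<partial>K (A, w)) \<le> (\<integral>f. exp (\<gamma> f) \<partial>\<mu> A)"
    if "ok w v" "A \<in> space \<pi>" "\<gamma> \<in> borel_measurable F" "\<And>f. \<bar>\<gamma> f\<bar> \<le> B" for w v A \<gamma> B
    using that unfolding ok_def by blast
  define \<Psi> where "\<Psi> A w = (\<integral>f. ln (g (f, w)) \<partial>K (A, w))" for A w
  define bad where "bad w v \<longleftrightarrow> ok w v \<and> \<not> (\<integral>\<^sup>+A. ennreal (v A * exp (\<Psi> A w)) \<partial>\<pi>) \<le> ennreal c" for w v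
  define cell where "cell s = {w \<in> space P. cell_of N w = s}" for s
  \<comment> \<open>A whole cell is discarded as soon as it contains one violation outside
    \<open>Ex\<close>. The set of violations need not be measurable, but a finite union of cells
    is.\<close>
  define J where "J = {s. \<exists>w\<in>space P - Ex. cell_of N w = s \<and> (\<exists>v. bad w v)}"
  have cell[measurable]: "cell s \<in> sets P" for s unfolding cell_def by (rule cell_of_meas)
  have "finite J" using cell_of_fin[of N] by (rule finite_subset[rotated]) (auto simp: J_def)
  have "\<forall>s\<in>J. \<exists>w v. w \<in> space P - Ex \<and> cell_of N w = s \<and> bad w v" unfolding J_def by blast
  then obtain d v where "\<forall>s\<in>J. d s \<in> space P - Ex \<and> cell_of N (d s) = s \<and> bad (d s) (v s)" by metis
  then have d: "\<And>s. s \<in> J \<Longrightarrow> d s \<in> space P" "\<And>s. s \<in> J \<Longrightarrow> d s \<notin> Ex" "\<And>s. s \<in> J \<Longrightarrow> cell_of N (d s) = s"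
    and v: "\<And>s. s \<in> J \<Longrightarrow> ok (d s) (v s)"
    and vc: "\<And>s. s \<in> J \<Longrightarrow> ennreal c \<le> (\<integral>\<^sup>+A. ennreal (v s A * exp (\<Psi> A (d s))) \<partial>\<pi>)"
    unfolding bad_def by (auto simp: not_le intro: less_imp_le)
  \<comment> \<open>For fixed \<open>f\<close>, \<open>G N\<close> is constant on each cell, so the
    sum over the representatives is its integral over the bad cells. The bound holds for every
    \<open>f\<close>.\<close>
  have d_sum: "(\<Sum>s\<in>J. measure P (cell s) * G N (f, d s)) \<le> 1 + e1" if f: "f \<in> space F" for f
  proof -
    have Gi: "integrable P (\<lambda>w. G N (f, w))"
      using absG by (intro P.integrable_const_bound[where B=b] AE_I2 sec2 G f) simp
    have "(\<Sum>s\<in>J. measure P (cell s) * G N (f, d s)) = (\<Sum>s\<in>J. \<integral>w. indicator (cell s) w * G N (f, d s) \<partial>P)"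
      by (simp add: Int_absorb2 sets.sets_into_space[OF cell])
    also have "\<dots> = (\<integral>w. (\<Sum>s\<in>J. indicator (cell s) w * G N (f, d s)) \<partial>P)"
      by (intro Bochner_Integration.integral_sum[symmetric]) (auto simp: less_top[symmetric])
    also have "\<dots> \<le> (\<integral>w. G N (f, w) \<partial>P)"
    proof (intro integral_mono Gi Bochner_Integration.integrable_sum)
      show "integrable P (\<lambda>w. indicator (cell s) w * G N (f, d s))" for s
        by (auto simp: less_top[symmetric])
      fix w assume w: "w \<in> space P"
      have eq: "(\<Sum>s\<in>J. indicator (cell s) w * G N (f, d s)) = (\<Sum>s\<in>J. if s = cell_of N w then G N (f, w) else 0)"
        using w d(3) by (intro sum.cong refl) (auto simp: cell_def indicator_def intro: cell_of_const)
      show "(\<Sum>s\<in>J. indicator (cell s) w * G N (f, d s)) \<le> G N (f, w)"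
        unfolding eq using \<open>finite J\<close> Ga[of N "(f, w)"] \<open>0 < a\<close> by (simp add: sum.delta)
    qed
    also have "\<dots> \<le> 1 + e1" using G_int[OF f, of N] g_int[OF f] by linarith
    finally show ?thesis .
  qed
  \<comment> \<open>The sum over the cells is formed before any integration over \<pi>. For a single
    \<open>A\<close> it is, up to the shortfall, a \<mu> A-mean of a function bounded by 1 + e1,
    whatever the measure \<mu> A is. In this way \<mu> leaves the argument one \<open>A\<close> at a
    time.\<close>
  have point: "(\<Sum>s\<in>J. measure P (cell s) * (v s A * exp (\<Psi> A (d s))))
      \<le> 1 + e1 + b * exp T * (\<Sum>s\<in>J. measure P (cell s) * enn2real (D N A (d s)))" if A: "A \<in> space \<pi>" for A
  proof -
    interpret mu: prob_space "\<mu> A" using mu[OF A] by (simp add: space_prob_algebra)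
    have mu_sets: "sets (\<mu> A) = sets F" using mu[OF A] by (simp add: space_prob_algebra)
    have mu_space: "space (\<mu> A) = space F" using mu_sets by (rule sets_eq_imp_space_eq)
    have G_mu: "integrable (\<mu> A) (\<lambda>f. G N (f, w))" if "w \<in> space P" for w
    proof (intro mu.integrable_const_bound[where B=b] AE_I2)
      show "(\<lambda>f. G N (f, w)) \<in> borel_measurable (\<mu> A)"
        unfolding measurable_cong_sets[OF mu_sets refl] by (intro sec1 G that)
    qed (use absG in simp)
    \<comment> \<open>Replacing \<open>g\<close> by \<open>G N\<close> costs the factor exp D \<le>
      1 + exp T * D, and the mean of \<open>G N\<close> is at most b.\<close>
    have one: "v s A * exp (\<Psi> A (d s)) \<le> (\<integral>f. G N (f, d s) \<partial>\<mu> A) + b * exp T * enn2real (D N A (d s))"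
      if s: "s \<in> J" for s
    proof -
      let ?w = "d s"
      note w = d(1)[OF s]
      interpret K: prob_space "K (A, ?w)" using A w by (rule Kprob)
      note Kmeas = measurable_cong_sets[OF Ksets[OF A w] refl]
      have lnG: "\<bar>ln (G N x)\<bar> \<le> \<bar>ln a\<bar> + \<bar>ln b\<bar>" for x
      proof -
        have "ln a \<le> ln (G N x)" "ln (G N x) \<le> ln b" using Ga[of N x] Gb[of N x] \<open>0 < a\<close> by simp_all
        then show ?thesis by linarith
      qed
      have lng: "\<bar>ln (g (f, ?w))\<bar> \<le> \<bar>ln a0\<bar> + \<bar>ln b0\<bar>" if "f \<in> space F" for f
      proof -
        have x: "(f, ?w) \<in> space (F \<Otimes>\<^sub>M P)" using that w by (simp add: space_pair_measure)
        have "ln a0 \<le> ln (g (f, ?w))" "ln (g (f, ?w)) \<le> ln b0" using g_lower[OF x] g_upper[OF x] \<open>0 < a0\<close> by simp_all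
        then show ?thesis by linarith
      qed
      have i1: "integrable (K (A, ?w)) (\<lambda>f. ln (G N (f, ?w)))"
        using lnG lnG_meas[OF w] by (intro K.integrable_const_bound[where B="\<bar>ln a\<bar> + \<bar>ln b\<bar>"] AE_I2) (simp_all add: Kmeas)
      have i2: "integrable (K (A, ?w)) (\<lambda>f. ln (g (f, ?w)))"
        using lng lng_meas[OF w] by (intro K.integrable_const_bound[where B="\<bar>ln a0\<bar> + \<bar>ln b0\<bar>"] AE_I2) (simp_all add: Kmeas Kspace[OF A w])
      have Dfin: "D N A ?w = ennreal (enn2real (D N A ?w))"
        using le_less_trans[OF D_le[OF A w] ennreal_less_top] by simp
      have DT: "enn2real (D N A ?w) \<le> T"
        using D_le[OF A w, of N] by (intro enn2real_leI) (auto simp: T_def)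
      have "(\<integral>f. ln (g (f, ?w)) - ln (G N (f, ?w)) \<partial>K (A, ?w)) \<le> enn2real (D N A ?w)"
        by (intro integral_real_bounded) (use Dfin in \<open>simp_all add: D_def\<close>)
      then have le: "\<Psi> A ?w \<le> (\<integral>f. ln (G N (f, ?w)) \<partial>K (A, ?w)) + enn2real (D N A ?w)"
        using i1 i2 by (simp add: \<Psi>_def)
      have v0: "0 \<le> v s A" using v[OF s] A by (simp add: ok_def)
      let ?I = "\<integral>f. G N (f, ?w) \<partial>\<mu> A"
      have "v s A * exp (\<integral>f. ln (G N (f, ?w)) \<partial>K (A, ?w)) \<le> (\<integral>f. exp (ln (G N (f, ?w))) \<partial>\<mu> A)"
      proof -
        have "(\<lambda>f. ln (G N (f, ?w))) \<in> borel_measurable F" using w by (rule lnG_meas)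
        then show ?thesis using lnG by (rule okD[OF v[OF s] A])
      qed
      also have "\<dots> = ?I" using Ga[of N] \<open>0 < a\<close> by (intro Bochner_Integration.integral_cong refl exp_ln) (rule less_le_trans)
      finally have vG: "v s A * exp (\<integral>f. ln (G N (f, ?w)) \<partial>K (A, ?w)) \<le> ?I" .
      have "?I \<le> (\<integral>f. b \<partial>\<mu> A)" using G_mu[OF w] Gb by (intro integral_mono) auto
      then have Ib: "?I \<le> b" by (simp add: mu.prob_space)
      have I0: "0 \<le> ?I" using Ga[of N] \<open>0 < a\<close> by (intro integral_nonneg_AE AE_I2) (auto intro: order_trans[of _ a])
      have "v s A * exp (\<Psi> A ?w) \<le> v s A * (exp (\<integral>f. ln (G N (f, ?w)) \<partial>K (A, ?w)) * exp (enn2real (D N A ?w)))"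
        using le v0 by (intro mult_left_mono) (auto simp flip: exp_add)
      also have "\<dots> = (v s A * exp (\<integral>f. ln (G N (f, ?w)) \<partial>K (A, ?w))) * exp (enn2real (D N A ?w))" by simp
      also have "\<dots> \<le> ?I * (1 + exp T * enn2real (D N A ?w))"
        using DT vG I0 by (intro mult_mono exp_le_linear) auto
      also have "\<dots> = ?I + ?I * (exp T * enn2real (D N A ?w))" by (simp add: distrib_left)
      also have "\<dots> \<le> ?I + b * (exp T * enn2real (D N A ?w))"
        using Ib by (intro add_left_mono mult_right_mono) auto
      finally show ?thesis by (simp add: mult.assoc)
    qed
    have "(\<Sum>s\<in>J. measure P (cell s) * (v s A * exp (\<Psi> A (d s))))
       \<le> (\<Sum>s\<in>J. measure P (cell s) * ((\<integral>f. G N (f, d s) \<partial>\<mu> A) + b * exp T * enn2real (D N A (d s))))"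
      using one by (intro sum_mono mult_left_mono) auto
    also have "\<dots> = (\<Sum>s\<in>J. measure P (cell s) * (\<integral>f. G N (f, d s) \<partial>\<mu> A))
        + b * exp T * (\<Sum>s\<in>J. measure P (cell s) * enn2real (D N A (d s)))"
      by (simp add: sum.distrib sum_distrib_left algebra_simps)
    also have "(\<Sum>s\<in>J. measure P (cell s) * (\<integral>f. G N (f, d s) \<partial>\<mu> A))
       = (\<integral>f. (\<Sum>s\<in>J. measure P (cell s) * G N (f, d s)) \<partial>\<mu> A)"
      using G_mu d(1) by (subst Bochner_Integration.integral_sum) auto
    also have "\<dots> \<le> (\<integral>f. 1 + e1 \<partial>\<mu> A)"
      using G_mu d(1) d_sum by (intro integral_mono Bochner_Integration.integrable_sum) (auto simp: mu_space)
    finally show ?thesis by (simp add: mu.prob_space)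
  qed
  \<comment> \<open>Every chosen violation has integral at least \<open>c\<close>, so integrating
    \<open>point\<close> over \<pi> gives Markov's inequality in the form of a finite sum. Only
    finitely many functions of \<open>A\<close> have to be measurable.\<close>
  have total: "c * (\<Sum>s\<in>J. measure P (cell s)) \<le> 1 + 2 * e1"
  proof -
    have [measurable]: "(\<lambda>A. D N A (d s)) \<in> borel_measurable \<pi>" if "s \<in> J" for s
      using d(1)[OF that] by (rule D_meas1)
    have \<Psi>_meas[measurable]: "(\<lambda>A. \<Psi> A (d s)) \<in> borel_measurable \<pi>" if "s \<in> J" for s
    proof -
      have "(\<lambda>A. K (A, d s)) \<in> measurable \<pi> (prob_algebra F)"
        by (rule measurable_compose[OF measurable_Pair2'[OF d(1)[OF that]] K])
      moreover have "(\<lambda>(A, f). ln (g (f, d s))) \<in> borel_measurable (\<pi> \<Otimes>\<^sub>M F)"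
        unfolding case_prod_beta by (rule measurable_compose[OF measurable_snd lng_meas[OF d(1)[OF that]]])
      ultimately show ?thesis unfolding \<Psi>_def
        by (intro integral_measurable_kernel[where N=F])
    qed
    have [measurable]: "v s \<in> borel_measurable \<pi>" if "s \<in> J" for s using v[OF that] by (simp add: ok_def)
    have v0: "0 \<le> v s A" if "s \<in> J" "A \<in> space \<pi>" for s A using v[OF that(1)] that(2) by (simp add: ok_def)
    have "ennreal (c * (\<Sum>s\<in>J. measure P (cell s))) = (\<Sum>s\<in>J. ennreal (measure P (cell s)) * ennreal c)"
      using \<open>0 < c\<close> by (simp add: sum_distrib_left mult.commute flip: ennreal_mult' sum_ennreal)
    also have "\<dots> \<le> (\<Sum>s\<in>J. ennreal (measure P (cell s)) * (\<integral>\<^sup>+A. ennreal (v s A * exp (\<Psi> A (d s))) \<partial>\<pi>))"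
      using vc by (intro sum_mono mult_left_mono) auto
    also have "\<dots> = (\<Sum>s\<in>J. \<integral>\<^sup>+A. ennreal (measure P (cell s)) * ennreal (v s A * exp (\<Psi> A (d s))) \<partial>\<pi>)"
      by (intro sum.cong refl nn_integral_cmult[symmetric]) measurable
    also have "\<dots> = (\<integral>\<^sup>+A. (\<Sum>s\<in>J. ennreal (measure P (cell s)) * ennreal (v s A * exp (\<Psi> A (d s)))) \<partial>\<pi>)"
      by (intro nn_integral_sum[symmetric]) measurable
    also have "\<dots> \<le> (\<integral>\<^sup>+A. ennreal (1 + e1) + (\<Sum>s\<in>J. ennreal (b * exp T * measure P (cell s)) * D N A (d s)) \<partial>\<pi>)"
    proof (intro nn_integral_mono)
      fix A assume A: "A \<in> space \<pi>"
      have Dfin: "D N A (d s) = ennreal (enn2real (D N A (d s)))" if "s \<in> J" for s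
        using le_less_trans[OF D_le[OF A d(1)[OF that]] ennreal_less_top] by simp
      have "(\<Sum>s\<in>J. ennreal (measure P (cell s)) * ennreal (v s A * exp (\<Psi> A (d s))))
         = ennreal (\<Sum>s\<in>J. measure P (cell s) * (v s A * exp (\<Psi> A (d s))))"
        using v0[OF _ A] by (simp add: sum_nonneg flip: ennreal_mult' sum_ennreal)
      also have "\<dots> \<le> ennreal (1 + e1 + b * exp T * (\<Sum>s\<in>J. measure P (cell s) * enn2real (D N A (d s))))"
        using point[OF A] by (rule ennreal_leI)
      also have "\<dots> = ennreal (1 + e1) + ennreal (\<Sum>s\<in>J. b * exp T * measure P (cell s) * enn2real (D N A (d s)))"
        using \<open>0 < e1\<close> \<open>0 < b\<close> by (subst ennreal_plus[symmetric]) (auto simp: sum_distrib_left mult_ac intro!: sum_nonneg)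
      also have "ennreal (\<Sum>s\<in>J. b * exp T * measure P (cell s) * enn2real (D N A (d s)))
          = (\<Sum>s\<in>J. ennreal (b * exp T * measure P (cell s)) * ennreal (enn2real (D N A (d s))))"
        using \<open>0 < b\<close> by (subst sum_ennreal[symmetric]) (auto simp: ennreal_mult intro!: sum.cong)
      also have "\<dots> = (\<Sum>s\<in>J. ennreal (b * exp T * measure P (cell s)) * D N A (d s))"
        using Dfin by (intro sum.cong refl) simp
      finally show "(\<Sum>s\<in>J. ennreal (measure P (cell s)) * ennreal (v s A * exp (\<Psi> A (d s))))
         \<le> ennreal (1 + e1) + (\<Sum>s\<in>J. ennreal (b * exp T * measure P (cell s)) * D N A (d s))" .
    qed
    also have "\<dots> = ennreal (1 + e1) + (\<Sum>s\<in>J. ennreal (b * exp T * measure P (cell s)) * \<kappa> N (d s))"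
    proof -
      have "(\<integral>\<^sup>+A. ennreal (1 + e1) + (\<Sum>s\<in>J. ennreal (b * exp T * measure P (cell s)) * D N A (d s)) \<partial>\<pi>)
        = (\<integral>\<^sup>+A. ennreal (1 + e1) \<partial>\<pi>) + (\<integral>\<^sup>+A. (\<Sum>s\<in>J. ennreal (b * exp T * measure P (cell s)) * D N A (d s)) \<partial>\<pi>)"
        by (intro nn_integral_add) measurable
      also have "(\<integral>\<^sup>+A. (\<Sum>s\<in>J. ennreal (b * exp T * measure P (cell s)) * D N A (d s)) \<partial>\<pi>)
        = (\<Sum>s\<in>J. \<integral>\<^sup>+A. ennreal (b * exp T * measure P (cell s)) * D N A (d s) \<partial>\<pi>)"
        by (intro nn_integral_sum) measurable
      also have "\<dots> = (\<Sum>s\<in>J. ennreal (b * exp T * measure P (cell s)) * \<kappa> N (d s))"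
        unfolding \<kappa>_def by (intro sum.cong refl nn_integral_cmult) measurable
      finally show ?thesis by (simp add: pi.emeasure_space_1)
    qed
    also have "\<dots> \<le> ennreal (1 + e1) + (\<Sum>s\<in>J. ennreal (b * exp T * measure P (cell s)) * ennreal \<eta>)"
    proof (intro add_left_mono sum_mono mult_left_mono)
      fix s assume "s \<in> J"
      then show "\<kappa> N (d s) \<le> ennreal \<eta>" using d(1,2)[of s] by (auto simp: Ex_def)
    qed simp
    also have "\<dots> = ennreal (1 + e1 + b * exp T * \<eta> * (\<Sum>s\<in>J. measure P (cell s)))"
    proof -
      have "(\<Sum>s\<in>J. ennreal (b * exp T * measure P (cell s)) * ennreal \<eta>) = ennreal (\<Sum>s\<in>J. b * exp T * measure P (cell s) * \<eta>)"
        using \<open>0 < b\<close> \<open>0 < \<eta>\<close> by (subst sum_ennreal[symmetric]) (auto simp: ennreal_mult intro!: sum.cong)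
      then show ?thesis using \<open>0 < e1\<close> \<open>0 < b\<close> \<open>0 < \<eta>\<close>
        by (subst (asm) eq_commute, simp only:, subst ennreal_plus[symmetric])
          (auto simp: sum_distrib_left mult_ac intro!: sum_nonneg)
    qed
    also have "\<dots> \<le> ennreal (1 + 2 * e1)"
    proof (rule ennreal_leI)
      have "(\<Sum>s\<in>J. measure P (cell s)) = measure P (\<Union>s\<in>J. cell s)"
        using \<open>finite J\<close> by (intro P.finite_measure_finite_Union[symmetric]) (auto simp: disjoint_family_on_def cell_def cell_of_meas)
      then have "b * exp T * \<eta> * (\<Sum>s\<in>J. measure P (cell s)) \<le> b * exp T * \<eta> * 1"
        using \<open>0 < b\<close> \<open>0 < \<eta>\<close> by (intro mult_left_mono) auto
      also have "\<dots> = e1" using \<open>0 < b\<close> by (simp add: \<eta>_def)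
      finally show "1 + e1 + b * exp T * \<eta> * (\<Sum>s\<in>J. measure P (cell s)) \<le> 1 + 2 * e1" by simp
    qed
    finally show ?thesis using \<open>0 < e1\<close> by (subst (asm) ennreal_le_iff) auto
  qed
  define C where "C = Ex \<union> (\<Union>s\<in>J. cell s)"
  have C: "C \<in> sets P" unfolding C_def using \<open>finite J\<close> by (intro sets.Un Ex sets.finite_UN cell)
  have "measure P C \<le> measure P Ex + measure P (\<Union>s\<in>J. cell s)"
    unfolding C_def using \<open>finite J\<close> by (intro measure_Un_le Ex sets.finite_UN cell)
  also have "measure P (\<Union>s\<in>J. cell s) \<le> (\<Sum>s\<in>J. measure P (cell s))"
    using \<open>finite J\<close> by (intro measure_UNION_le cell)
  also have "(\<Sum>s\<in>J. measure P (cell s)) \<le> (1 + 2 * e1) / c"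
    using total \<open>0 < c\<close> by (simp add: field_simps)
  also have "measure P Ex + (1 + 2 * e1) / c \<le> e1 + (1 + 2 * e1) / c" using Ex_le by simp
  also have "\<dots> = 1 / c + e1 * (1 + 2 / c)" using \<open>0 < c\<close> by (simp add: field_simps)
  also have "\<dots> = 1 / c + e"
  proof -
    have "1 + 2 / c \<noteq> 0" using \<open>0 < c\<close> by (intro less_imp_neq[THEN not_sym] add_pos_pos) auto
    then show ?thesis by (simp add: e1_def)
  qed
  finally have C_le: "measure P C \<le> 1 / c + e" by simp
  have not_bad: "\<not> bad w v" if "w \<in> space P - C" for w v
    using that by (auto simp: C_def J_def cell_def)
  show ?thesis
  proof (intro bexI[of _ C] conjI ballI impI C C_le)
    fix w and v :: "'a \<Rightarrow> real" assume w: "w \<in> space P - C" and "v \<in> borel_measurable \<pi>" and "\<forall>A\<in>space \<pi>. 0 \<le> v A \<and>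
      (\<forall>\<gamma>\<in>borel_measurable F. (\<exists>B. \<forall>f\<in>space F. \<bar>\<gamma> f\<bar> \<le> B) \<longrightarrow>
          v A * exp (\<integral>f. \<gamma> f \<partial>K (A, w)) \<le> (\<integral>f. exp (\<gamma> f) \<partial>\<mu> A))"
    then have "ok w v" unfolding ok_def by (intro conjI)
    then show "(\<integral>\<^sup>+A. ennreal (v A * exp (\<integral>f. ln (g (f, w)) \<partial>K (A, w))) \<partial>\<pi>) \<le> ennreal c"
      using not_bad[OF w, of v] unfolding bad_def \<Psi>_def by simp
  qed
qed

section \<open>The meta-learning model\<close>

text \<open>On a cylinder the product measure is a finite product of kernel values, and cylinders
  form an intersection-stable generator. The index set may be infinite, as for the sample
  sequences.\<close>

lemma measurable_PiM_kernel:
  assumes K: "\<And>i. i \<in> I \<Longrightarrow> K i \<in> measurable N (prob_algebra (M i))"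
  shows "(\<lambda>x. PiM I (\<lambda>i. K i x)) \<in> measurable N (prob_algebra (PiM I M))"
proof (rule measurable_prob_algebra_generated[OF sets_PiM Int_stable_prod_algebra prod_algebra_sets_into_space])
  fix x assume x: "x \<in> space N"
  have Kx: "prob_space (K i x)" "sets (K i x) = sets (M i)" if "i \<in> I" for i
    using measurable_space[OF K[OF that] x] by (auto simp: space_prob_algebra)
  show "prob_space (PiM I (\<lambda>i. K i x))" using Kx(1) by (rule prob_space_PiM)
  show "sets (PiM I (\<lambda>i. K i x)) = sets (PiM I M)" using Kx(2) by (intro sets_PiM_cong) auto
next
  fix A assume "A \<in> prod_algebra I M"
  then obtain J X where A: "A = prod_emb I M J (Pi\<^sub>E J X)" and J: "finite J" "J \<subseteq> I" and X: "\<And>i. i \<in> J \<Longrightarrow> X i \<in> sets (M i)"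
    by (elim prod_algebraE) auto
  have "emeasure (PiM I (\<lambda>i. K i x)) A = (\<Prod>i\<in>J. emeasure (K i x) (X i))" if x: "x \<in> space N" for x
  proof -
    have Kx: "prob_space (K i x)" "sets (K i x) = sets (M i)" if "i \<in> I" for i
      using measurable_space[OF K[OF that] x] by (auto simp: space_prob_algebra)
    have "prod_emb I M J (Pi\<^sub>E J X) = prod_emb I (\<lambda>i. K i x) J (Pi\<^sub>E J X)"
      using Kx(2)[THEN sets_eq_imp_space_eq] by (auto simp: prod_emb_def PiE_def Pi_def)
    then show ?thesis unfolding A using J X Kx by (simp add: emeasure_PiM_emb subset_iff)
  qed
  moreover have "(\<lambda>x. \<Prod>i\<in>J. emeasure (K i x) (X i)) \<in> borel_measurable N"
    using J X by (intro borel_measurable_prod_ennreal measurable_emeasure_kernel[OF measurable_prob_algebraD[OF K]]) auto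
  ultimately show "(\<lambda>x. emeasure (PiM I (\<lambda>i. K i x)) A) \<in> borel_measurable N"
    by (simp cong: measurable_cong)
qed

text \<open>The environment draws an infinite sample sequence, of which the first \<open>m\<close>
  entries form the data set. The integrand sees only these, so the finite marginal decides.\<close>

lemma nn_integral_exp_skl_sequence_le:
  fixes M :: "'z measure" and g :: "'z \<Rightarrow> real"
  assumes M: "prob_space M" and g[measurable]: "g \<in> borel_measurable M"
    and g01: "\<And>z. z \<in> space M \<Longrightarrow> g z \<in> {0..1}" and "m > 0" "t > 0"
  shows "(\<integral>\<^sup>+x. ennreal (exp (real m * skl t ((\<Sum>j<m. g (x j)) / real m) (\<integral>z. g z \<partial>M))) \<partial>(\<Pi>\<^sub>M i\<in>UNIV::nat set. M))
      \<le> ennreal (2 * sqrt (real m))"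
proof -
  interpret M: prob_space M by fact
  interpret P: product_prob_space "\<lambda>_::nat. M" UNIV by unfold_locales
  let ?h = "\<lambda>x. ennreal (exp (real m * skl t ((\<Sum>j<m. g (x j)) / real m) (\<integral>z. g z \<partial>M)))"
  have [measurable]: "(\<lambda>x. g (x j)) \<in> borel_measurable (\<Pi>\<^sub>M i\<in>{..<m}. M)" if "j \<in> {..<m}" for j
    using that by measurable
  have "?h \<in> borel_measurable (\<Pi>\<^sub>M i\<in>{..<m}. M)" unfolding skl_def by measurable
  then have "(\<integral>\<^sup>+x. ?h x \<partial>distr (\<Pi>\<^sub>M i\<in>UNIV. M) (\<Pi>\<^sub>M i\<in>{..<m}. M) (\<lambda>x. restrict x {..<m})) = (\<integral>\<^sup>+x. ?h (restrict x {..<m}) \<partial>(\<Pi>\<^sub>M i\<in>UNIV. M))"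
    by (intro nn_integral_distr measurable_restrict_subset) auto
  then have "(\<integral>\<^sup>+x. ?h x \<partial>(\<Pi>\<^sub>M i\<in>UNIV. M)) = (\<integral>\<^sup>+x. ?h x \<partial>(\<Pi>\<^sub>M i\<in>{..<m}. M))"
    by (subst (asm) P.distr_PiM_restrict_finite) auto
  then show ?thesis using nn_integral_exp_skl_le[OF assms] by simp
qed

text \<open>With exp (- h) absorbed into the weight, the change of measure returns the mean of
  \<open>h\<close> as an additive term. If this mean is infinite, so is the right-hand side.
  Otherwise \<open>h\<close> is finite \<rho>-almost everywhere, and the weight 0 assigned to an
  infinite \<open>h\<close> does not disturb the logarithm.\<close>

lemma donsker_varadhan_penalty:
  assumes "prob_space \<pi>" "prob_space \<rho>" and sets: "sets \<rho> = sets \<pi>"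
    and \<Psi>[measurable]: "\<Psi> \<in> borel_measurable \<pi>" and bnd: "\<And>A. A \<in> space \<pi> \<Longrightarrow> \<bar>\<Psi> A\<bar> \<le> B"
    and h[measurable]: "h \<in> borel_measurable \<pi>" and "0 < c"
    and le: "(\<integral>\<^sup>+A. ennreal ((if h A = \<top> then 0 else exp (- enn2real (h A))) * exp (\<Psi> A)) \<partial>\<pi>) \<le> ennreal c"
  shows "ereal (\<integral>A. \<Psi> A \<partial>\<rho>) \<le> KLdiv \<rho> \<pi> + enn2ereal (\<integral>\<^sup>+A. h A \<partial>\<rho>) + ereal (ln c)"
proof (cases "(\<integral>\<^sup>+A. h A \<partial>\<rho>) = \<top>")
  case True
  have "0 \<le> KLdiv \<rho> \<pi>" using assms by (intro KLdiv_nonneg)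
  then have "KLdiv \<rho> \<pi> \<noteq> - \<infinity>" by auto
  then show ?thesis using True by (simp add: enn2ereal_top plus_ereal.simps)
next
  case False
  note [measurable_cong] = sets
  interpret pi: prob_space \<pi> by fact
  interpret rho: prob_space \<rho> by fact
  have space: "space \<rho> = space \<pi>" using sets by (rule sets_eq_imp_space_eq)
  have [measurable]: "h \<in> borel_measurable \<rho>" "\<Psi> \<in> borel_measurable \<rho>" by measurable
  let ?w = "\<lambda>A. (if h A = \<top> then 0 else exp (- enn2real (h A))) * exp (\<Psi> A)"
  have fin: "AE A in \<rho>. h A \<noteq> \<top>" using False by (intro nn_integral_noteq_infinite[unfolded infinity_ennreal_def]) auto
  have i\<Psi>: "integrable \<rho> \<Psi>" using bnd by (intro rho.integrable_const_bound[where B=B]) (auto simp: space)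
  have nn: "(\<integral>\<^sup>+A. ennreal (enn2real (h A)) \<partial>\<rho>) = (\<integral>\<^sup>+A. h A \<partial>\<rho>)"
    using fin by (intro nn_integral_cong_AE) (auto simp: less_top)
  have ih: "integrable \<rho> (\<lambda>A. enn2real (h A))"
    using False nn by (intro integrableI_nonneg) (auto simp: less_top)
  have ln_w: "AE A in \<rho>. ln (?w A) = \<Psi> A - enn2real (h A)"
    using fin by eventually_elim (simp add: ln_mult)
  have [measurable]: "?w \<in> borel_measurable \<pi>" by measurable
  have il: "integrable \<rho> (\<lambda>A. ln (?w A))"
    using ln_w i\<Psi> ih by (subst integrable_cong_AE[where g="\<lambda>A. \<Psi> A - enn2real (h A)"]) auto
  have pos: "AE A in \<rho>. 0 < ?w A" using fin by eventually_elim simp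
  have "ereal (\<integral>A. ln (?w A) \<partial>\<rho>) \<le> KLdiv \<rho> \<pi> + ereal (ln c)"
    using le \<open>0 < c\<close> pos il by (intro donsker_varadhan \<open>prob_space \<pi>\<close> \<open>prob_space \<rho>\<close>) auto
  also have "(\<integral>A. ln (?w A) \<partial>\<rho>) = (\<integral>A. \<Psi> A - enn2real (h A) \<partial>\<rho>)"
    using ln_w by (intro integral_cong_AE) auto
  also have "\<dots> = (\<integral>A. \<Psi> A \<partial>\<rho>) - (\<integral>A. enn2real (h A) \<partial>\<rho>)" using i\<Psi> ih by simp
  finally have *: "ereal ((\<integral>A. \<Psi> A \<partial>\<rho>) - (\<integral>A. enn2real (h A) \<partial>\<rho>)) \<le> KLdiv \<rho> \<pi> + ereal (ln c)" .
  have "(\<integral>\<^sup>+A. h A \<partial>\<rho>) = ennreal (\<integral>A. enn2real (h A) \<partial>\<rho>)"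
    unfolding nn[symmetric] by (intro nn_integral_eq_integral ih) auto
  then have "enn2ereal (\<integral>\<^sup>+A. h A \<partial>\<rho>) = ereal (\<integral>A. enn2real (h A) \<partial>\<rho>)"
    by (simp add: enn2ereal_ennreal)
  with * show ?thesis by (cases "KLdiv \<rho> \<pi>") auto
qed

locale meta_learning =
  fixes Z :: "'z measure" and F :: "'f measure" and Alg :: "'a measure"
    and l :: "'f \<Rightarrow> 'z \<Rightarrow> real" and alg :: "'a \<Rightarrow> 'z list \<Rightarrow> 'f measure"
    and tau0 :: "('z measure \<times> nat) measure" and mmax n :: nat
    and \<pi> :: "'a measure" and PP :: "'a \<Rightarrow> 'f measure measure"
  assumes tau0: "prob_space tau0"
    and tau0_sets: "sets tau0 = sets (prob_algebra Z \<Otimes>\<^sub>M count_space {1..mmax})"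
    and loss_meas: "(\<lambda>(f, z). l f z) \<in> borel_measurable (F \<Otimes>\<^sub>M Z)"
    and loss_range: "\<And>f z. f \<in> space F \<Longrightarrow> z \<in> space Z \<Longrightarrow> 0 \<le> l f z \<and> l f z \<le> 1"
    and alg_meas: "\<And>m. m \<in> {1..mmax} \<Longrightarrow>
          (\<lambda>(A, S). alg A (dataset m S)) \<in> measurable (Alg \<Otimes>\<^sub>M (\<Pi>\<^sub>M i\<in>UNIV. Z)) (prob_algebra F)"
    and meta_prior: "\<pi> \<in> space (prob_algebra Alg)"
    and hyper_prior: "\<And>A. A \<in> space Alg \<Longrightarrow> PP A \<in> space (prob_algebra (prob_algebra F))"
    and n_pos: "n > 0"
begin

abbreviation "TS \<equiv> task_space Z mmax"
abbreviation "\<tau> \<equiv> env tau0 Z mmax"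
abbreviation "P \<equiv> \<Pi>\<^sub>M i\<in>{..<n}. \<tau>"
abbreviation "Fn \<equiv> \<Pi>\<^sub>M i\<in>{..<n}. F"

section \<open>The environment as a mixture of product measures\<close>

lemma env_kernel:
  "(\<lambda>Dm. distr (\<Pi>\<^sub>M i\<in>UNIV. fst Dm) TS (\<lambda>S. (Dm, S)))
    \<in> measurable (prob_algebra Z \<Otimes>\<^sub>M count_space {1..mmax}) (prob_algebra TS)"
proof (rule measurable_distr_prob_space2)
  show "(\<lambda>Dm. \<Pi>\<^sub>M i\<in>UNIV. fst Dm) \<in> measurable (prob_algebra Z \<Otimes>\<^sub>M count_space {1..mmax}) (prob_algebra (\<Pi>\<^sub>M i\<in>UNIV. Z))"
    by (rule measurable_PiM_kernel) (rule measurable_fst)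
  show "(\<lambda>(x, y). (x, y)) \<in> measurable ((prob_algebra Z \<Otimes>\<^sub>M count_space {1..mmax}) \<Otimes>\<^sub>M (\<Pi>\<^sub>M i\<in>UNIV. Z)) TS"
    unfolding task_space_def by (simp add: case_prod_beta)
qed

lemma tau0_in: "tau0 \<in> space (prob_algebra (prob_algebra Z \<Otimes>\<^sub>M count_space {1..mmax}))"
  unfolding space_prob_algebra using tau0 tau0_sets by blast

lemma sets_env: "sets \<tau> = sets TS"
  unfolding env_def by (rule sets_bind'[OF tau0_in env_kernel])

lemma prob_env: "prob_space \<tau>"
  unfolding env_def by (rule prob_space_bind'[OF tau0_in env_kernel])

lemma space_env: "space \<tau> = space TS" by (rule sets_eq_imp_space_eq[OF sets_env])

lemma sets_P: "sets P = sets (\<Pi>\<^sub>M i\<in>{..<n}. TS)"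
  by (intro sets_PiM_cong refl sets_env)

lemma prob_P: "prob_space P" by (intro prob_space_PiM prob_env)

lemma nn_integral_env:
  assumes h: "h \<in> borel_measurable TS"
  shows "(\<integral>\<^sup>+t. h t \<partial>\<tau>) = (\<integral>\<^sup>+Dm. \<integral>\<^sup>+S. h (Dm, S) \<partial>(\<Pi>\<^sub>M i\<in>UNIV. fst Dm) \<partial>tau0)"
proof -
  have "(\<integral>\<^sup>+t. h t \<partial>\<tau>) = (\<integral>\<^sup>+Dm. \<integral>\<^sup>+t. h t \<partial>distr (\<Pi>\<^sub>M i\<in>UNIV. fst Dm) TS (\<lambda>S. (Dm, S)) \<partial>tau0)"
    unfolding env_def
    by (rule nn_integral_bind[OF h])
      (use measurable_prob_algebraD[OF env_kernel] in \<open>simp add: measurable_cong_sets[OF tau0_sets refl]\<close>)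
  also have "\<dots> = (\<integral>\<^sup>+Dm. \<integral>\<^sup>+S. h (Dm, S) \<partial>(\<Pi>\<^sub>M i\<in>UNIV. fst Dm) \<partial>tau0)"
  proof (intro nn_integral_cong nn_integral_distr h)
    fix Dm assume "Dm \<in> space tau0"
    then have Dm: "Dm \<in> space (prob_algebra Z \<Otimes>\<^sub>M count_space {1..mmax})"
      using sets_eq_imp_space_eq[OF tau0_sets] by simp
    then have "sets (fst Dm) = sets Z" unfolding space_pair_measure mem_Times_iff space_prob_algebra by blast
    then have "sets (\<Pi>\<^sub>M i\<in>UNIV::nat set. fst Dm) = sets (\<Pi>\<^sub>M i\<in>UNIV. Z)" by (intro sets_PiM_cong) auto
    then show "Pair Dm \<in> measurable (\<Pi>\<^sub>M i\<in>UNIV. fst Dm) TS"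
      unfolding task_space_def using measurable_Pair1'[OF Dm] by (simp cong: measurable_cong_sets)
  qed (use h in simp)
  finally show ?thesis .
qed

lemma space_TS:
  "t \<in> space TS \<longleftrightarrow> prob_space (fst (fst t)) \<and> sets (fst (fst t)) = sets Z \<and>
    snd (fst t) \<in> {1..mmax} \<and> (\<forall>i. snd t i \<in> space Z)"
  unfolding task_space_def space_pair_measure mem_Times_iff space_prob_algebra space_PiM PiE_UNIV_domain
  by (auto simp only: mem_Collect_eq Pi_iff space_count_space)

lemma meas_m: "(\<lambda>t. snd (fst t)) \<in> measurable TS (count_space {1..mmax})"
  unfolding task_space_def by measurable

lemma meas_D: "(\<lambda>t. fst (fst t)) \<in> measurable TS (prob_algebra Z)"
  unfolding task_space_def by measurable

lemma meas_S: "snd \<in> measurable TS (\<Pi>\<^sub>M i\<in>UNIV. Z)"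
  unfolding task_space_def by measurable

lemma meas_real_m: "(\<lambda>t. real (snd (fst t))) \<in> borel_measurable TS"
  by (rule measurable_compose[OF meas_m]) simp

section \<open>Losses of a hypothesis and of a posterior on one task\<close>

definition algT :: "'a \<Rightarrow> ('z measure \<times> nat) \<times> (nat \<Rightarrow> 'z) \<Rightarrow> 'f measure" where
  "algT A t = alg A (dataset (snd (fst t)) (snd t))"

lemma algT_meas: "(\<lambda>(A, t). algT A t) \<in> measurable (Alg \<Otimes>\<^sub>M TS) (prob_algebra F)"
proof -
  \<comment> \<open>The sample size is random with finitely many values, and measurability is known
    for each fixed size.\<close>
  have "(\<lambda>x. (\<lambda>m x. alg (fst x) (dataset m (snd (snd x)))) (snd (fst (snd x))) x)
      \<in> measurable (Alg \<Otimes>\<^sub>M TS) (prob_algebra F)"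
  proof (rule measurable_compose_countable'[where I="{1..mmax}"])
    fix m assume m: "m \<in> {1..mmax}"
    have "(\<lambda>x. (fst x, snd (snd x))) \<in> measurable (Alg \<Otimes>\<^sub>M TS) (Alg \<Otimes>\<^sub>M (\<Pi>\<^sub>M i\<in>UNIV. Z))"
      using measurable_compose[OF measurable_snd meas_S] by (intro measurable_Pair measurable_fst)
    from measurable_compose[OF this alg_meas[OF m]]
    show "(\<lambda>x. alg (fst x) (dataset m (snd (snd x)))) \<in> measurable (Alg \<Otimes>\<^sub>M TS) (prob_algebra F)" by simp
  next
    show "(\<lambda>x. snd (fst (snd x))) \<in> measurable (Alg \<Otimes>\<^sub>M TS) (count_space {1..mmax})"
      by (rule measurable_compose[OF measurable_snd meas_m])
  qed simp
  then show ?thesis by (simp add: algT_def case_prod_beta)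
qed

lemma algT_in: "A \<in> space Alg \<Longrightarrow> t \<in> space TS \<Longrightarrow> algT A t \<in> space (prob_algebra F)"
  using measurable_space[OF algT_meas, of "(A, t)"] by (simp add: space_pair_measure)

definition emp_loss :: "'f \<Rightarrow> ('z measure \<times> nat) \<times> (nat \<Rightarrow> 'z) \<Rightarrow> real" where
  "emp_loss f t = (\<Sum>j<snd (fst t). l f (snd t j)) / real (snd (fst t))"

definition true_loss :: "'f \<Rightarrow> ('z measure \<times> nat) \<times> (nat \<Rightarrow> 'z) \<Rightarrow> real" where
  "true_loss f t = (\<integral>z. l f z \<partial>fst (fst t))"

lemma loss_meas_S: "(\<lambda>x. l (fst x) (snd (snd x) j)) \<in> borel_measurable (F \<Otimes>\<^sub>M TS)"
proof -
  have "(\<lambda>x. snd (snd x) j) \<in> measurable (F \<Otimes>\<^sub>M TS) Z"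
    by (rule measurable_compose[OF measurable_compose[OF measurable_snd meas_S] measurable_component_singleton]) simp
  then have "(\<lambda>x. (fst x, snd (snd x) j)) \<in> measurable (F \<Otimes>\<^sub>M TS) (F \<Otimes>\<^sub>M Z)"
    by (intro measurable_Pair measurable_fst)
  from measurable_compose[OF this loss_meas] show ?thesis by simp
qed

lemma emp_loss_meas: "(\<lambda>(f, t). emp_loss f t) \<in> borel_measurable (F \<Otimes>\<^sub>M TS)"
proof -
  have "(\<lambda>x. (\<lambda>m x. (\<Sum>j<m. l (fst x) (snd (snd x) j)) / real m) (snd (fst (snd x))) x) \<in> borel_measurable (F \<Otimes>\<^sub>M TS)"
    by (rule measurable_compose_countable'[where I="{1..mmax}", OF _ measurable_compose[OF measurable_snd meas_m]])
      (auto intro!: borel_measurable_divide borel_measurable_sum loss_meas_S)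
  then show ?thesis by (simp add: emp_loss_def case_prod_beta)
qed

lemma true_loss_meas: "(\<lambda>(f, t). true_loss f t) \<in> borel_measurable (F \<Otimes>\<^sub>M TS)"
proof -
  have "(\<lambda>y. (fst (fst y), snd y)) \<in> measurable ((F \<Otimes>\<^sub>M TS) \<Otimes>\<^sub>M Z) (F \<Otimes>\<^sub>M Z)"
    by (intro measurable_Pair measurable_compose[OF measurable_fst measurable_fst] measurable_snd)
  from measurable_compose[OF this loss_meas]
  have "(\<lambda>(x, z). l (fst x) z) \<in> borel_measurable ((F \<Otimes>\<^sub>M TS) \<Otimes>\<^sub>M Z)" by (simp add: case_prod_beta)
  from integral_measurable_kernel[OF this measurable_compose[OF measurable_snd meas_D]]
  show ?thesis by (simp add: true_loss_def case_prod_beta)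
qed

lemma loss_meas_z: "f \<in> space F \<Longrightarrow> l f \<in> borel_measurable Z"
  using measurable_compose[OF measurable_Pair1' loss_meas] by simp

lemma loss_meas_f: "z \<in> space Z \<Longrightarrow> (\<lambda>f. l f z) \<in> borel_measurable F"
  using measurable_compose[OF measurable_Pair2' loss_meas] by simp

lemma (in prob_space) expectation_in_unit:
  fixes h :: "'a \<Rightarrow> real"
  assumes "h \<in> borel_measurable M" "\<And>x. x \<in> space M \<Longrightarrow> h x \<in> {0..1}"
  shows "integrable M h" "expectation h \<in> {0..1}"
proof -
  show i: "integrable M h" using assms by (intro integrable_const_bound[where B=1]) auto
  have "expectation h \<le> expectation (\<lambda>_. 1)" using i assms(2) by (intro integral_mono) auto
  moreover have "0 \<le> expectation h" using assms(2) by (intro integral_nonneg_AE) auto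
  ultimately show "expectation h \<in> {0..1}" by (simp add: prob_space)
qed

lemma emp_loss_range: "f \<in> space F \<Longrightarrow> t \<in> space TS \<Longrightarrow> emp_loss f t \<in> {0..1}"
proof -
  assume f: "f \<in> space F" and t: "t \<in> space TS"
  then have l: "0 \<le> l f (snd t j)" "l f (snd t j) \<le> 1" for j using loss_range[OF f] by (auto simp: space_TS)
  then have "(\<Sum>j<snd (fst t). l f (snd t j)) \<le> (\<Sum>j<snd (fst t). 1)" by (intro sum_mono) auto
  then show ?thesis using t l by (auto simp: emp_loss_def space_TS divide_le_eq sum_nonneg)
qed

lemma true_loss_range: "f \<in> space F \<Longrightarrow> t \<in> space TS \<Longrightarrow> true_loss f t \<in> {0..1}"
proof -
  assume f: "f \<in> space F" and t: "t \<in> space TS"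
  then interpret D: prob_space "fst (fst t)" by (simp add: space_TS)
  have s: "sets (fst (fst t)) = sets Z" using t by (simp add: space_TS)
  show ?thesis unfolding true_loss_def using loss_meas_z[OF f] loss_range[OF f] sets_eq_imp_space_eq[OF s]
    by (intro D.expectation_in_unit) (auto simp: measurable_cong_sets[OF s refl])
qed

definition post_emp_loss :: "'a \<Rightarrow> ('z measure \<times> nat) \<times> (nat \<Rightarrow> 'z) \<Rightarrow> real" where
  "post_emp_loss A t = (\<integral>f. emp_loss f t \<partial>algT A t)"

definition post_true_loss :: "'a \<Rightarrow> ('z measure \<times> nat) \<times> (nat \<Rightarrow> 'z) \<Rightarrow> real" where
  "post_true_loss A t = (\<integral>f. true_loss f t \<partial>algT A t)"

lemma swap_kernel_meas:
  assumes "(\<lambda>(f, t). h f t) \<in> borel_measurable (F \<Otimes>\<^sub>M TS)"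
  shows "(\<lambda>(A, t). \<integral>f. h f t \<partial>algT A t :: real) \<in> borel_measurable (Alg \<Otimes>\<^sub>M TS)"
proof -
  have "(\<lambda>y. (snd y, snd (fst y))) \<in> measurable ((Alg \<Otimes>\<^sub>M TS) \<Otimes>\<^sub>M F) (F \<Otimes>\<^sub>M TS)"
    by (intro measurable_Pair measurable_compose[OF measurable_fst measurable_snd] measurable_snd)
  from measurable_compose[OF this assms]
  have "(\<lambda>(x, f). h f (snd x)) \<in> borel_measurable ((Alg \<Otimes>\<^sub>M TS) \<Otimes>\<^sub>M F)" by (simp add: case_prod_beta)
  from integral_measurable_kernel[OF this algT_meas] show ?thesis by (simp add: case_prod_beta)
qed

lemma sec_F:
  fixes h :: "'f \<Rightarrow> ('z measure \<times> nat) \<times> (nat \<Rightarrow> 'z) \<Rightarrow> real"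
  assumes "(\<lambda>(f, t). h f t) \<in> borel_measurable (F \<Otimes>\<^sub>M TS)" "t \<in> space TS"
  shows "(\<lambda>f. h f t) \<in> borel_measurable F"
  using measurable_compose[OF measurable_Pair2'[OF assms(2)] assms(1)] by simp

lemma algT_prob: "A \<in> space Alg \<Longrightarrow> t \<in> space TS \<Longrightarrow> prob_space (algT A t)"
  and algT_sets: "A \<in> space Alg \<Longrightarrow> t \<in> space TS \<Longrightarrow> sets (algT A t) = sets F"
  using algT_in by (auto simp: space_prob_algebra)

lemma algT_space: "A \<in> space Alg \<Longrightarrow> t \<in> space TS \<Longrightarrow> space (algT A t) = space F"
  by (rule sets_eq_imp_space_eq[OF algT_sets])

lemma post_emp_loss_meas: "(\<lambda>(A, t). post_emp_loss A t) \<in> borel_measurable (Alg \<Otimes>\<^sub>M TS)"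
  unfolding post_emp_loss_def by (rule swap_kernel_meas[OF emp_loss_meas])

lemma post_true_loss_meas: "(\<lambda>(A, t). post_true_loss A t) \<in> borel_measurable (Alg \<Otimes>\<^sub>M TS)"
  unfolding post_true_loss_def by (rule swap_kernel_meas[OF true_loss_meas])

lemma post_emp_loss_range: "A \<in> space Alg \<Longrightarrow> t \<in> space TS \<Longrightarrow> post_emp_loss A t \<in> {0..1}"
  unfolding post_emp_loss_def by (rule prob_space.expectation_in_unit[OF algT_prob])
    (auto simp: measurable_cong_sets[OF algT_sets refl] algT_space intro!: sec_F[OF emp_loss_meas] dest: emp_loss_range)

lemma post_true_loss_range: "A \<in> space Alg \<Longrightarrow> t \<in> space TS \<Longrightarrow> post_true_loss A t \<in> {0..1}"
  unfolding post_true_loss_def by (rule prob_space.expectation_in_unit[OF algT_prob])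
    (auto simp: measurable_cong_sets[OF algT_sets refl] algT_space intro!: sec_F[OF true_loss_meas] dest: true_loss_range)

lemma post_emp_loss_eq:
  assumes A: "A \<in> space Alg" and t: "t \<in> space TS"
  shows "post_emp_loss A t = 1 / real (snd (fst t)) * (\<Sum>j<snd (fst t). lossQ l (snd t j) (alg A (dataset (snd (fst t)) (snd t))))"
proof -
  interpret K: prob_space "algT A t" using A t by (rule algT_prob)
  have "integrable (algT A t) (\<lambda>f. l f (snd t j))" for j
    using loss_meas_f loss_range t A by (intro K.expectation_in_unit)
      (auto simp: measurable_cong_sets[OF algT_sets refl] algT_space space_TS)
  then show ?thesis unfolding post_emp_loss_def emp_loss_def lossQ_def algT_def[symmetric] by simp
qed

text \<open>Fubini's theorem exchanges hypothesis and test point: the exponential moments are taken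
  for a fixed hypothesis, whereas the risk averages over hypotheses first.\<close>

lemma post_true_loss_eq:
  assumes A: "A \<in> space Alg" and t: "t \<in> space TS"
  shows "post_true_loss A t = (\<integral>z. lossQ l z (alg A (dataset (snd (fst t)) (snd t))) \<partial>(fst (fst t)))"
proof -
  interpret K: prob_space "algT A t" using A t by (rule algT_prob)
  interpret D: prob_space "fst (fst t)" using t by (simp add: space_TS)
  interpret KD: pair_prob_space "algT A t" "fst (fst t)" by unfold_locales
  have s: "sets (fst (fst t)) = sets Z" using t by (simp add: space_TS)
  have sp: "sets (algT A t \<Otimes>\<^sub>M fst (fst t)) = sets (F \<Otimes>\<^sub>M Z)"
    using A t s by (intro sets_pair_measure_cong algT_sets)
  have "integrable (algT A t \<Otimes>\<^sub>M fst (fst t)) (\<lambda>(f, z). l f z)"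
    using loss_range loss_meas sets_eq_imp_space_eq[OF sp]
    by (intro KD.expectation_in_unit) (auto simp: measurable_cong_sets[OF sp refl] space_pair_measure)
  from KD.Fubini_integral[OF this] show ?thesis
    unfolding post_true_loss_def true_loss_def lossQ_def algT_def[symmetric] by simp
qed

section \<open>Exponents of one task and of all tasks\<close>

definition exponent :: "real \<Rightarrow> 'f \<Rightarrow> ('z measure \<times> nat) \<times> (nat \<Rightarrow> 'z) \<Rightarrow> real" where
  "exponent s f t = real (snd (fst t)) * skl s (emp_loss f t) (true_loss f t) - ln (2 * sqrt (real (snd (fst t))))"

lemma exponent_meas: "(\<lambda>(f, t). exponent s f t) \<in> borel_measurable (F \<Otimes>\<^sub>M TS)"
proof -
  have [measurable]: "(\<lambda>x. emp_loss (fst x) (snd x)) \<in> borel_measurable (F \<Otimes>\<^sub>M TS)"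
    using emp_loss_meas by (simp add: case_prod_beta)
  have [measurable]: "(\<lambda>x. true_loss (fst x) (snd x)) \<in> borel_measurable (F \<Otimes>\<^sub>M TS)"
    using true_loss_meas by (simp add: case_prod_beta)
  have [measurable]: "(\<lambda>x. real (snd (fst (snd x)))) \<in> borel_measurable (F \<Otimes>\<^sub>M TS)"
    by (rule measurable_compose[OF measurable_snd meas_real_m])
  show ?thesis unfolding case_prod_beta exponent_def skl_def by measurable
qed

definition exponent_bound :: "real \<Rightarrow> real" where
  "exponent_bound s = real mmax * (2 * (1 + s + \<bar>ln s\<bar>)) + ln (2 * sqrt (real mmax))"

lemma abs_exponent_le:
  assumes "0 < s" "f \<in> space F" "t \<in> space TS"
  shows "\<bar>exponent s f t\<bar> \<le> exponent_bound s"
proof -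
  have m: "1 \<le> snd (fst t)" "snd (fst t) \<le> mmax" using assms(3) by (auto simp: space_TS)
  have "\<bar>real (snd (fst t)) * skl s (emp_loss f t) (true_loss f t)\<bar> \<le> real mmax * (2 * (1 + s + \<bar>ln s\<bar>))"
    unfolding abs_mult using m assms skl_bounded[OF assms(1) emp_loss_range true_loss_range] by (intro mult_mono) auto
  moreover have "1 \<le> sqrt (real (snd (fst t)))" using m by simp
  then have "0 \<le> ln (2 * sqrt (real (snd (fst t))))" by (intro ln_ge_zero) linarith
  moreover have "ln (2 * sqrt (real (snd (fst t)))) \<le> ln (2 * sqrt (real mmax))"
    using m by (subst ln_le_cancel_iff) auto
  ultimately show ?thesis unfolding exponent_def exponent_bound_def by linarith
qed

text \<open>Conditionally on the distribution and the sample size m, the shifted divergence has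
  exponential moment at most 2 * sqrt m. Subtracting its logarithm inside \<open>exponent\<close>
  makes the bound 1 for every random m; the subtracted terms return as the constant c_1.\<close>

lemma exponent_env:
  assumes "0 < s" and f: "f \<in> space F"
  shows "(\<integral>\<^sup>+t. ennreal (exp (exponent s f t)) \<partial>\<tau>) \<le> 1"
proof -
  have "(\<lambda>t. exponent s f t) \<in> borel_measurable TS"
    using measurable_compose[OF measurable_Pair1'[OF f] exponent_meas[of s]] by simp
  then have [measurable]: "(\<lambda>t. ennreal (exp (exponent s f t))) \<in> borel_measurable TS" by measurable
  have "(\<integral>\<^sup>+t. ennreal (exp (exponent s f t)) \<partial>\<tau>) = (\<integral>\<^sup>+Dm. \<integral>\<^sup>+S. ennreal (exp (exponent s f (Dm, S))) \<partial>(\<Pi>\<^sub>M i\<in>UNIV. fst Dm) \<partial>tau0)"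
    by (rule nn_integral_env) fact
  also have "\<dots> \<le> (\<integral>\<^sup>+Dm. 1 \<partial>tau0)"
  proof (rule nn_integral_mono)
    fix Dm assume "Dm \<in> space tau0"
    then have "Dm \<in> space (prob_algebra Z \<Otimes>\<^sub>M count_space {1..mmax})"
      using sets_eq_imp_space_eq[OF tau0_sets] by simp
    then have D: "prob_space (fst Dm)" "sets (fst Dm) = sets Z" and m: "1 \<le> snd Dm"
      unfolding space_pair_measure mem_Times_iff space_prob_algebra space_count_space by auto
    let ?m = "snd Dm"
    let ?e = "\<lambda>S. exp (real ?m * skl s ((\<Sum>j<?m. l f (S j)) / real ?m) (\<integral>z. l f z \<partial>fst Dm))"
    have lm: "l f \<in> borel_measurable (fst Dm)" using loss_meas_z[OF f] by (simp add: measurable_cong_sets[OF D(2) refl])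
    have lr: "l f z \<in> {0..1}" if "z \<in> space (fst Dm)" for z
      using loss_range[OF f, of z] that sets_eq_imp_space_eq[OF D(2)] by simp
    have c: "0 < 2 * sqrt (real ?m)" using m by simp
    have "(\<integral>\<^sup>+S. ennreal (exp (exponent s f (Dm, S))) \<partial>(\<Pi>\<^sub>M i\<in>UNIV. fst Dm))
       = (\<integral>\<^sup>+S. ennreal (1 / (2 * sqrt (real ?m))) * ennreal (?e S) \<partial>(\<Pi>\<^sub>M i\<in>UNIV. fst Dm))"
      using c by (intro nn_integral_cong) (simp add: exponent_def emp_loss_def true_loss_def exp_diff flip: ennreal_mult')
    also have "\<dots> = ennreal (1 / (2 * sqrt (real ?m))) * (\<integral>\<^sup>+S. ennreal (?e S) \<partial>(\<Pi>\<^sub>M i\<in>UNIV. fst Dm))"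
    proof (rule nn_integral_cmult)
      have [measurable]: "(\<lambda>S. l f (S j)) \<in> borel_measurable (\<Pi>\<^sub>M i\<in>UNIV. fst Dm)" for j :: nat
        by (rule measurable_compose[OF _ lm]) (rule measurable_component_singleton, simp)
      show "(\<lambda>S. ennreal (?e S)) \<in> borel_measurable (\<Pi>\<^sub>M i\<in>UNIV. fst Dm)"
        unfolding skl_def by measurable
    qed
    also have "\<dots> \<le> ennreal (1 / (2 * sqrt (real ?m))) * ennreal (2 * sqrt (real ?m))"
      using nn_integral_exp_skl_sequence_le[OF D(1) lm lr, of ?m s] m assms(1) by (intro mult_left_mono) auto
    also have "\<dots> = 1" using c by (simp flip: ennreal_mult')
    finally show "(\<integral>\<^sup>+S. ennreal (exp (exponent s f (Dm, S))) \<partial>(\<Pi>\<^sub>M i\<in>UNIV. fst Dm)) \<le> 1" .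
  qed
  also have "\<dots> = 1" using prob_space.emeasure_space_1[OF tau0] by simp
  finally show ?thesis .
qed

definition g :: "real \<Rightarrow> (nat \<Rightarrow> 'f) \<times> (nat \<Rightarrow> ('z measure \<times> nat) \<times> (nat \<Rightarrow> 'z)) \<Rightarrow> real" where
  "g s x = exp (\<Sum>i<n. exponent s (fst x i) (snd x i))"

lemma space_P: "\<omega> \<in> space P \<Longrightarrow> i < n \<Longrightarrow> \<omega> i \<in> space TS"
  by (auto simp: space_PiM space_env PiE_iff)

lemma space_Fn: "fs \<in> space Fn \<Longrightarrow> i < n \<Longrightarrow> fs i \<in> space F"
  by (auto simp: space_PiM PiE_iff)

lemma meas_P_comp: "i < n \<Longrightarrow> (\<lambda>\<omega>. \<omega> i) \<in> measurable P TS"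
  unfolding measurable_cong_sets[OF sets_P refl] by (rule measurable_component_singleton) simp

lemma meas_Fn_comp: "i < n \<Longrightarrow> (\<lambda>fs. fs i) \<in> measurable Fn F"
  by (rule measurable_component_singleton) simp

lemma exponent_meas_i: "i < n \<Longrightarrow> (\<lambda>x. exponent s (fst x i) (snd x i)) \<in> borel_measurable (Fn \<Otimes>\<^sub>M P)"
proof -
  assume i: "i < n"
  have "(\<lambda>x. (fst x i, snd x i)) \<in> measurable (Fn \<Otimes>\<^sub>M P) (F \<Otimes>\<^sub>M TS)"
    by (intro measurable_Pair measurable_compose[OF measurable_fst meas_Fn_comp[OF i]] measurable_compose[OF measurable_snd meas_P_comp[OF i]])
  from measurable_compose[OF this exponent_meas[of s]] show ?thesis by simp
qed

lemma g_meas: "g s \<in> borel_measurable (Fn \<Otimes>\<^sub>M P)"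
  unfolding g_def using exponent_meas_i
  by (intro measurable_compose[OF borel_measurable_sum borel_measurable_exp]) auto

lemma sum_exponent_bound:
  assumes "0 < s" "x \<in> space (Fn \<Otimes>\<^sub>M P)"
  shows "\<bar>\<Sum>i<n. exponent s (fst x i) (snd x i)\<bar> \<le> real n * exponent_bound s"
proof -
  have x: "fst x \<in> space Fn" "snd x \<in> space P" using assms(2) by (auto simp: space_pair_measure)
  have "\<bar>\<Sum>i<n. exponent s (fst x i) (snd x i)\<bar> \<le> (\<Sum>i<n. \<bar>exponent s (fst x i) (snd x i)\<bar>)" by (rule sum_abs)
  also have "\<dots> \<le> (\<Sum>i<n. exponent_bound s)"
    using assms(1) x by (intro sum_mono abs_exponent_le space_Fn space_P) auto
  finally show ?thesis by simp
qed

text \<open>The tasks are independent and each hypothesis meets only its own task, so the moments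
  multiply.\<close>

lemma g_int:
  assumes "0 < s" and fs: "fs \<in> space Fn"
  shows "(\<integral>\<omega>. g s (fs, \<omega>) \<partial>P) \<le> 1"
proof -
  interpret \<tau>: prob_space \<tau> by (rule prob_env)
  interpret pp: product_prob_space "\<lambda>_. \<tau>" "{..<n}" by unfold_locales
  have meas: "(\<lambda>t. exp (exponent s (fs i) t)) \<in> borel_measurable \<tau>" if "i < n" for i
  proof -
    have "(\<lambda>t. exponent s (fs i) t) \<in> borel_measurable TS"
      using measurable_compose[OF measurable_Pair1'[OF space_Fn[OF fs that]] exponent_meas[of s]] by simp
    then show ?thesis unfolding measurable_cong_sets[OF sets_env refl] by measurable
  qed
  have int: "integrable \<tau> (\<lambda>t. exp (exponent s (fs i) t))" if "i < n" for i
    using meas[OF that] abs_exponent_le[OF \<open>0 < s\<close> space_Fn[OF fs that]]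
    by (intro \<tau>.integrable_const_bound[where B="exp (exponent_bound s)"] AE_I2) (auto simp: space_env abs_le_iff)
  have "(\<integral>\<omega>. g s (fs, \<omega>) \<partial>P) = (\<integral>\<omega>. (\<Prod>i<n. exp (exponent s (fs i) (\<omega> i))) \<partial>P)"
    by (simp add: g_def exp_sum)
  also have "\<dots> = (\<Prod>i<n. \<integral>t. exp (exponent s (fs i) t) \<partial>\<tau>)"
    using int by (intro pp.product_integral_prod) auto
  also have "\<dots> \<le> 1"
  proof (rule prod_le_1, rule conjI)
    fix i assume "i \<in> {..<n}"
    then show "(\<integral>t. exp (exponent s (fs i) t) \<partial>\<tau>) \<le> 1"
      using exponent_env[OF \<open>0 < s\<close> space_Fn[OF fs]] by (intro integral_real_bounded) auto
  qed simp
  finally show ?thesis .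
qed

section \<open>Averaging the exponent over the product posterior\<close>

definition Kn :: "'a \<times> (nat \<Rightarrow> ('z measure \<times> nat) \<times> (nat \<Rightarrow> 'z)) \<Rightarrow> (nat \<Rightarrow> 'f) measure" where
  "Kn x = (\<Pi>\<^sub>M i\<in>{..<n}. algT (fst x) (snd x i))"

lemma sets_pi: "sets \<pi> = sets Alg" and prob_pi: "prob_space \<pi>"
  using meta_prior by (auto simp: space_prob_algebra)

lemma space_pi: "space \<pi> = space Alg" by (rule sets_eq_imp_space_eq[OF sets_pi])

lemma algT_meas_i: "i < n \<Longrightarrow> (\<lambda>x. (fst x, snd x i)) \<in> measurable (\<pi> \<Otimes>\<^sub>M P) (Alg \<Otimes>\<^sub>M TS)"
proof -
  assume i: "i < n"
  have "fst \<in> measurable (\<pi> \<Otimes>\<^sub>M P) Alg"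
    using measurable_fst[of \<pi> P] by (simp add: measurable_cong_sets[OF refl sets_pi])
  then show ?thesis by (intro measurable_Pair measurable_compose[OF measurable_snd meas_P_comp[OF i]])
qed

lemma Kn_meas: "Kn \<in> measurable (\<pi> \<Otimes>\<^sub>M P) (prob_algebra Fn)"
  unfolding Kn_def
proof (rule measurable_PiM_kernel)
  fix i assume "i \<in> {..<n}"
  then have "i < n" by simp
  from measurable_compose[OF algT_meas_i[OF this] algT_meas]
  show "(\<lambda>x. algT (fst x) (snd x i)) \<in> measurable (\<pi> \<Otimes>\<^sub>M P) (prob_algebra F)" by simp
qed

definition post_exponent :: "real \<Rightarrow> 'a \<Rightarrow> (nat \<Rightarrow> ('z measure \<times> nat) \<times> (nat \<Rightarrow> 'z)) \<Rightarrow> real" where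
  "post_exponent s A \<omega> = (\<Sum>i<n. \<integral>f. exponent s f (\<omega> i) \<partial>algT A (\<omega> i))"

lemma exponent_algT_integrable:
  assumes "0 < s" "A \<in> space Alg" "t \<in> space TS"
  shows "integrable (algT A t) (\<lambda>f. exponent s f t)"
proof -
  interpret prob_space "algT A t" using assms by (intro algT_prob)
  show ?thesis using assms sec_F[OF exponent_meas, of t s] abs_exponent_le
    by (intro integrable_const_bound[where B="exponent_bound s"] AE_I2) (auto simp: algT_space measurable_cong_sets[OF algT_sets refl])
qed

text \<open>The logarithm of \<open>g\<close> is a sum of functions of single coordinates, so only
  the marginals of the product posterior matter.\<close>

lemma Kn_integral:
  assumes "0 < s" and A: "A \<in> space Alg" and \<omega>: "\<omega> \<in> space P"
  shows "(\<integral>fs. ln (g s (fs, \<omega>)) \<partial>Kn (A, \<omega>)) = post_exponent s A \<omega>"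
proof -
  have pr: "prob_space (algT A (\<omega> i))" if "i \<in> {..<n}" for i
    using A space_P[OF \<omega>] that by (intro algT_prob) auto
  have comp: "distr (Kn (A, \<omega>)) (algT A (\<omega> i)) (\<lambda>fs. fs i) = algT A (\<omega> i)" if "i < n" for i
    unfolding Kn_def using distr_PiM_component[of "{..<n}" "\<lambda>i. algT A (\<omega> i)" i] pr that by simp
  have cm: "(\<lambda>fs. fs i) \<in> measurable (Kn (A, \<omega>)) (algT A (\<omega> i))" if "i < n" for i
    unfolding Kn_def using that by (simp add: measurable_component_singleton)
  have pm: "(\<lambda>f. exponent s f (\<omega> i)) \<in> borel_measurable (algT A (\<omega> i))" if "i < n" for i
    using exponent_algT_integrable[OF \<open>0 < s\<close> A space_P[OF \<omega> that]] by (rule borel_measurable_integrable)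
  have i1: "integrable (Kn (A, \<omega>)) (\<lambda>fs. exponent s (fs i) (\<omega> i))" if "i < n" for i
    using exponent_algT_integrable[OF \<open>0 < s\<close> A space_P[OF \<omega> that]]
      integrable_distr_eq[OF cm[OF that] pm[OF that]] comp[OF that] by simp
  have i2: "(\<integral>fs. exponent s (fs i) (\<omega> i) \<partial>Kn (A, \<omega>)) = (\<integral>f. exponent s f (\<omega> i) \<partial>algT A (\<omega> i))" if "i < n" for i
    using integral_distr[OF cm[OF that] pm[OF that]] comp[OF that] by simp
  have "(\<integral>fs. ln (g s (fs, \<omega>)) \<partial>Kn (A, \<omega>)) = (\<integral>fs. (\<Sum>i<n. exponent s (fs i) (\<omega> i)) \<partial>Kn (A, \<omega>))"
    by (simp add: g_def)
  also have "\<dots> = (\<Sum>i<n. \<integral>fs. exponent s (fs i) (\<omega> i) \<partial>Kn (A, \<omega>))"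
    using i1 by (intro Bochner_Integration.integral_sum) auto
  finally show ?thesis using i2 by (simp add: post_exponent_def)
qed

lemma post_exponent_lower:
  assumes "0 < s" and A: "A \<in> space Alg" and \<omega>: "\<omega> \<in> space P"
  shows "(\<Sum>i<n. real (snd (fst (\<omega> i))) * skl s (post_emp_loss A (\<omega> i)) (post_true_loss A (\<omega> i))) - (\<Sum>i<n. ln (2 * sqrt (real (snd (fst (\<omega> i))))))
     \<le> post_exponent s A \<omega>"
  unfolding post_exponent_def sum_subtractf[symmetric]
proof (rule sum_mono)
  fix i assume "i \<in> {..<n}"
  then have t: "\<omega> i \<in> space TS" using space_P[OF \<omega>] by simp
  interpret K: prob_space "algT A (\<omega> i)" using A t by (rule algT_prob)
  have J: "skl s (post_emp_loss A (\<omega> i)) (post_true_loss A (\<omega> i)) \<le> (\<integral>f. skl s (emp_loss f (\<omega> i)) (true_loss f (\<omega> i)) \<partial>algT A (\<omega> i))"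
    "integrable (algT A (\<omega> i)) (\<lambda>f. skl s (emp_loss f (\<omega> i)) (true_loss f (\<omega> i)))"
    unfolding post_emp_loss_def post_true_loss_def using A t \<open>0 < s\<close>
    by (intro K.skl_jensen; auto simp: algT_space measurable_cong_sets[OF algT_sets refl] intro!: sec_F[OF emp_loss_meas] sec_F[OF true_loss_meas] dest: emp_loss_range true_loss_range)+
  have "real (snd (fst (\<omega> i))) * skl s (post_emp_loss A (\<omega> i)) (post_true_loss A (\<omega> i))
     \<le> real (snd (fst (\<omega> i))) * (\<integral>f. skl s (emp_loss f (\<omega> i)) (true_loss f (\<omega> i)) \<partial>algT A (\<omega> i))"
    using J(1) by (intro mult_left_mono) auto
  then show "real (snd (fst (\<omega> i))) * skl s (post_emp_loss A (\<omega> i)) (post_true_loss A (\<omega> i)) - ln (2 * sqrt (real (snd (fst (\<omega> i)))))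
      \<le> (\<integral>f. exponent s f (\<omega> i) \<partial>algT A (\<omega> i))"
    unfolding exponent_def using J(2) by (simp add: K.prob_space)
qed

lemma post_exponent_bound:
  assumes "0 < s" and A: "A \<in> space Alg" and \<omega>: "\<omega> \<in> space P"
  shows "\<bar>post_exponent s A \<omega>\<bar> \<le> real n * exponent_bound s"
proof -
  have "\<bar>post_exponent s A \<omega>\<bar> \<le> (\<Sum>i<n. \<bar>\<integral>f. exponent s f (\<omega> i) \<partial>algT A (\<omega> i)\<bar>)" unfolding post_exponent_def by (rule sum_abs)
  also have "\<dots> \<le> (\<Sum>i<n. exponent_bound s)"
  proof (rule sum_mono)
    fix i assume "i \<in> {..<n}"
    then have t: "\<omega> i \<in> space TS" using space_P[OF \<omega>] by simp
    interpret K: prob_space "algT A (\<omega> i)" using A t by (rule algT_prob)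
    have "\<bar>\<integral>f. exponent s f (\<omega> i) \<partial>algT A (\<omega> i)\<bar> \<le> (\<integral>f. \<bar>exponent s f (\<omega> i)\<bar> \<partial>algT A (\<omega> i))" by (rule integral_abs_bound)
    also have "\<dots> \<le> (\<integral>f. exponent_bound s \<partial>algT A (\<omega> i))"
      using exponent_algT_integrable[OF \<open>0 < s\<close> A t] abs_exponent_le[OF \<open>0 < s\<close> _ t]
      by (intro integral_mono integrable_abs) (auto simp: algT_space[OF A t])
    finally show "\<bar>\<integral>f. exponent s f (\<omega> i) \<partial>algT A (\<omega> i)\<bar> \<le> exponent_bound s" by (simp add: K.prob_space)
  qed
  finally show ?thesis by simp
qed

lemma sec_Alg:
  fixes h :: "'a \<Rightarrow> ('z measure \<times> nat) \<times> (nat \<Rightarrow> 'z) \<Rightarrow> real"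
  assumes "(\<lambda>(A, t). h A t) \<in> borel_measurable (Alg \<Otimes>\<^sub>M TS)" "t \<in> space TS"
  shows "(\<lambda>A. h A t) \<in> borel_measurable Alg"
  using measurable_compose[OF measurable_Pair2'[OF assms(2)] assms(1)] by simp

lemma post_exponent_meas:
  assumes "\<omega> \<in> space P" shows "(\<lambda>A. post_exponent s A \<omega>) \<in> borel_measurable Alg"
  unfolding post_exponent_def
  by (intro borel_measurable_sum sec_Alg[OF swap_kernel_meas[OF exponent_meas]]) (use space_P[OF assms] in auto)

section \<open>Divergence from the hyper-prior as a penalty\<close>

definition mu :: "'a \<Rightarrow> (nat \<Rightarrow> 'f) measure" where
  "mu A = distr (hyper_prior_joint F n (PP A)) Fn snd"

lemma prior_in:
  assumes A: "A \<in> space Alg"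
  shows "hyper_prior_joint F n (PP A) \<in> space (prob_algebra (joint_space F n))"
proof -
  have k: "(\<lambda>P. distr (\<Pi>\<^sub>M i\<in>{..<n}. P) (joint_space F n) (\<lambda>fs. (P, fs))) \<in> measurable (prob_algebra F) (prob_algebra (joint_space F n))"
  proof (rule measurable_distr_prob_space2)
    show "(\<lambda>P. \<Pi>\<^sub>M i\<in>{..<n}. P) \<in> measurable (prob_algebra F) (prob_algebra Fn)"
      by (rule measurable_PiM_kernel) (rule measurable_ident_sets[OF refl])
    show "(\<lambda>(x, y). (x, y)) \<in> measurable (prob_algebra F \<Otimes>\<^sub>M Fn) (joint_space F n)"
      unfolding joint_space_def by (simp add: case_prod_beta)
  qed
  show ?thesis unfolding hyper_prior_joint_def space_prob_algebra
    using prob_space_bind'[OF hyper_prior[OF A] k] sets_bind'[OF hyper_prior[OF A] k] by blast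
qed

lemma mu_in: "A \<in> space Alg \<Longrightarrow> mu A \<in> space (prob_algebra Fn)"
proof -
  assume "A \<in> space Alg"
  from prior_in[OF this] have p: "prob_space (hyper_prior_joint F n (PP A))" "sets (hyper_prior_joint F n (PP A)) = sets (prob_algebra F \<Otimes>\<^sub>M Fn)"
    by (auto simp: space_prob_algebra joint_space_def)
  have "snd \<in> measurable (hyper_prior_joint F n (PP A)) Fn"
    unfolding measurable_cong_sets[OF p(2) refl] by (rule measurable_snd)
  then show ?thesis unfolding mu_def space_prob_algebra
    using prob_space.prob_space_distr[OF p(1)] by simp
qed

text \<open>The variational inequality is used on the joint measures, which include the drawn prior,
  with a function of the hypotheses alone. The posterior side then becomes the product posterior,
  the prior side becomes \<open>mu A\<close>, and the hyper-posterior survives only in the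
  divergence. This supplies the condition on \<open>v\<close> in
  \<open>pac_bayes_nonmeasurable_prior\<close>.\<close>

lemma kl_penalty:
  assumes A: "A \<in> space Alg" and \<omega>: "\<omega> \<in> space P" and QA: "QA \<in> space (prob_algebra (prob_algebra F))"
    and \<gamma>: "\<gamma> \<in> borel_measurable Fn" and B: "\<And>fs. fs \<in> space Fn \<Longrightarrow> \<bar>\<gamma> fs\<bar> \<le> B"
    and h: "h = e2ennreal (KLdiv (hyper_post_joint alg n \<omega> QA A) (hyper_prior_joint F n (PP A)))"
  shows "(if h = \<top> then 0 else exp (- enn2real h)) * exp (\<integral>fs. \<gamma> fs \<partial>Kn (A, \<omega>)) \<le> (\<integral>fs. exp (\<gamma> fs) \<partial>mu A)"
proof -
  let ?N = "hyper_post_joint alg n \<omega> QA A" and ?M = "hyper_prior_joint F n (PP A)"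
  interpret mu: prob_space "mu A" using mu_in[OF A] by (simp add: space_prob_algebra)
  have mu_sets: "sets (mu A) = sets Fn" by (simp add: mu_def)
  have mu_space: "space (mu A) = space Fn" by (simp add: mu_def)
  have e_int: "integrable (mu A) (\<lambda>fs. exp (\<gamma> fs))"
  proof (intro mu.integrable_const_bound[where B="exp B"] AE_I2)
    show "norm (exp (\<gamma> fs)) \<le> exp B" if "fs \<in> space (mu A)" for fs using B[of fs] that by (simp add: mu_space)
    show "(\<lambda>fs. exp (\<gamma> fs)) \<in> borel_measurable (mu A)"
      unfolding measurable_cong_sets[OF mu_sets refl] using \<gamma> by measurable
  qed
  have "(\<integral>fs. exp (- B) \<partial>mu A) \<le> (\<integral>fs. exp (\<gamma> fs) \<partial>mu A)"
    using e_int B by (intro integral_mono) (auto simp: mu_space minus_le_iff abs_le_iff)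
  then have "exp (- B) \<le> (\<integral>fs. exp (\<gamma> fs) \<partial>mu A)" by (simp add: mu.prob_space)
  then have pos: "0 < (\<integral>fs. exp (\<gamma> fs) \<partial>mu A)" by (rule less_le_trans[OF exp_gt_zero])
  show ?thesis
  proof (cases "h = \<top>")
    case True then show ?thesis using pos by simp
  next
    case False
    have Mp: "prob_space ?M" "sets ?M = sets (prob_algebra F \<Otimes>\<^sub>M Fn)"
      using prior_in[OF A] by (auto simp: space_prob_algebra joint_space_def)
    have snd_meas: "snd \<in> measurable ?M Fn"
      unfolding measurable_cong_sets[OF Mp(2) refl] by (rule measurable_snd)
    have Kp: "prob_space (Kn (A, \<omega>))" "sets (Kn (A, \<omega>)) = sets Fn"
      using measurable_space[OF Kn_meas, of "(A, \<omega>)"] A \<omega> by (auto simp: space_pair_measure space_prob_algebra space_pi)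
    have N_eq: "?N = QA \<Otimes>\<^sub>M Kn (A, \<omega>)" by (simp add: hyper_post_joint_def Kn_def algT_def)
    have Q: "prob_space QA" using QA by (simp add: space_prob_algebra)
    interpret Q: prob_space QA by (rule Q)
    interpret K: prob_space "Kn (A, \<omega>)" by (rule Kp)
    interpret QK: pair_prob_space QA "Kn (A, \<omega>)" by unfold_locales
    have Np: "prob_space ?N" unfolding N_eq by unfold_locales
    have \<gamma>K: "\<gamma> \<in> borel_measurable (Kn (A, \<omega>))" using \<gamma> by (simp add: measurable_cong_sets[OF Kp(2) refl])
    have \<gamma>i: "integrable (Kn (A, \<omega>)) \<gamma>"
      using B \<gamma>K sets_eq_imp_space_eq[OF Kp(2)] by (intro K.integrable_const_bound[where B=B] AE_I2) auto
    have d: "distr ?N (Kn (A, \<omega>)) snd = Kn (A, \<omega>)"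
      unfolding N_eq
    proof (rule measure_eqI)
      fix X assume "X \<in> sets (distr (QA \<Otimes>\<^sub>M Kn (A, \<omega>)) (Kn (A, \<omega>)) snd)"
      then have X: "X \<in> sets (Kn (A, \<omega>))" by simp
      then have "snd -` X \<inter> space (QA \<Otimes>\<^sub>M Kn (A, \<omega>)) = space QA \<times> X"
        using sets.sets_into_space by (fastforce simp: space_pair_measure)
      with X show "emeasure (distr (QA \<Otimes>\<^sub>M Kn (A, \<omega>)) (Kn (A, \<omega>)) snd) X = emeasure (Kn (A, \<omega>)) X"
        by (simp add: emeasure_distr K.emeasure_pair_measure_Times Q.emeasure_space_1)
    qed simp
    have sN: "snd \<in> measurable ?N (Kn (A, \<omega>))" unfolding N_eq by (rule measurable_snd)
    have iN: "integrable ?N (\<lambda>x. \<gamma> (snd x))" using integrable_distr_eq[OF sN \<gamma>K] d \<gamma>i by simp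
    have eN: "(\<integral>x. \<gamma> (snd x) \<partial>?N) = (\<integral>fs. \<gamma> fs \<partial>Kn (A, \<omega>))" using integral_distr[OF sN \<gamma>K] d by simp
    have "(\<lambda>fs. exp (\<gamma> fs)) \<in> borel_measurable Fn" using \<gamma> by measurable
    note wm = measurable_compose[OF snd_meas this]
    have "(\<integral>\<^sup>+x. ennreal (exp (\<gamma> (snd x))) \<partial>?M) = (\<integral>\<^sup>+fs. ennreal (exp (\<gamma> fs)) \<partial>mu A)"
      unfolding mu_def using \<gamma> snd_meas by (subst nn_integral_distr) auto
    also have "\<dots> = ennreal (\<integral>fs. exp (\<gamma> fs) \<partial>mu A)" using e_int by (intro nn_integral_eq_integral) auto
    finally have le: "(\<integral>\<^sup>+x. ennreal (exp (\<gamma> (snd x))) \<partial>?M) \<le> ennreal (\<integral>fs. exp (\<gamma> fs) \<partial>mu A)" by simp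
    have dv: "ereal (\<integral>x. ln (exp (\<gamma> (snd x))) \<partial>?N) \<le> KLdiv ?N ?M + ereal (ln (\<integral>fs. exp (\<gamma> fs) \<partial>mu A))"
      using iN le pos by (intro donsker_varadhan Mp(1) Np wm) auto
    have "0 \<le> KLdiv ?N ?M" by (rule KLdiv_nonneg[OF Mp(1) Np])
    moreover have "KLdiv ?N ?M \<noteq> \<infinity>" using False by (auto simp: h)
    ultimately obtain k where k: "KLdiv ?N ?M = ereal k" "0 \<le> k" by (cases "KLdiv ?N ?M") auto
    then have hk: "enn2real h = k" by (simp add: h)
    have "(\<integral>fs. \<gamma> fs \<partial>Kn (A, \<omega>)) - k \<le> ln (\<integral>fs. exp (\<gamma> fs) \<partial>mu A)"
      using dv unfolding k(1) by (simp add: eN)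
    then have "exp ((\<integral>fs. \<gamma> fs \<partial>Kn (A, \<omega>)) - k) \<le> (\<integral>fs. exp (\<gamma> fs) \<partial>mu A)"
      using pos by (simp add: ln_ge_iff)
    then show ?thesis using False hk by (simp add: exp_diff exp_minus field_simps)
  qed
qed

section \<open>High-probability moment bounds at the two levels\<close>

definition meta_loss :: "'a \<Rightarrow> real" where "meta_loss A = (\<integral>t. post_true_loss A t \<partial>\<tau>)"

lemma post_true_loss_meas_t: "A \<in> space Alg \<Longrightarrow> post_true_loss A \<in> borel_measurable \<tau>"
  using measurable_compose[OF measurable_Pair1' post_true_loss_meas] by (simp add: measurable_cong_sets[OF sets_env refl])

lemma meta_loss_range: "A \<in> space Alg \<Longrightarrow> meta_loss A \<in> {0..1}"
  unfolding meta_loss_def by (rule prob_space.expectation_in_unit[OF prob_env])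
    (auto simp: post_true_loss_meas_t space_env dest: post_true_loss_range)

lemma meta_loss_meas: "meta_loss \<in> borel_measurable Alg"
proof -
  interpret \<tau>: prob_space \<tau> by (rule prob_env)
  have eq: "sets (Alg \<Otimes>\<^sub>M \<tau>) = sets (Alg \<Otimes>\<^sub>M TS)" by (intro sets_pair_measure_cong refl sets_env)
  have "(\<lambda>(A, t). post_true_loss A t) \<in> borel_measurable (Alg \<Otimes>\<^sub>M \<tau>)"
    unfolding measurable_cong_sets[OF eq refl] by (rule post_true_loss_meas)
  then show ?thesis unfolding meta_loss_def by (rule \<tau>.borel_measurable_lebesgue_integral)
qed

text \<open>No hyper-prior occurs here, so everything is jointly measurable and Fubini's theorem
  with Markov's inequality applies. For fixed \<open>A\<close> the values
  \<open>post_true_loss A (\<omega> i)\<close> are independent copies with mean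
  \<open>meta_loss A\<close>.\<close>

lemma task_level_bound:
  assumes "0 < s" "0 < \<delta>"
  shows "\<exists>C\<in>sets P. measure P C \<le> \<delta> / 2 \<and> (\<forall>\<omega>\<in>space P - C.
    (\<integral>\<^sup>+A. ennreal (exp (real n * skl s ((\<Sum>i<n. post_true_loss A (\<omega> i)) / real n) (meta_loss A))) \<partial>\<pi>) \<le> ennreal (4 * sqrt (real n) / \<delta>))"
proof -
  interpret \<tau>: prob_space \<tau> by (rule prob_env)
  interpret P: prob_space P by (rule prob_P)
  interpret pi: prob_space \<pi> by (rule prob_pi)
  interpret piP: pair_sigma_finite \<pi> P by unfold_locales
  define G where "G A \<omega> = ennreal (exp (real n * skl s ((\<Sum>i<n. post_true_loss A (\<omega> i)) / real n) (meta_loss A)))" for A \<omega>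
  have G: "(\<lambda>(A, \<omega>). G A \<omega>) \<in> borel_measurable (\<pi> \<Otimes>\<^sub>M P)"
  proof -
    have [measurable]: "(\<lambda>x. post_true_loss (fst x) (snd x i)) \<in> borel_measurable (\<pi> \<Otimes>\<^sub>M P)" if "i < n" for i
      using measurable_compose[OF algT_meas_i[OF that] post_true_loss_meas] by simp
    have [measurable]: "(\<lambda>x. meta_loss (fst x)) \<in> borel_measurable (\<pi> \<Otimes>\<^sub>M P)"
      using meta_loss_meas by (intro measurable_compose[OF measurable_fst]) (simp add: measurable_cong_sets[OF sets_pi refl])
    have [measurable]: "(\<lambda>x. \<Sum>i<n. post_true_loss (fst x) (snd x i)) \<in> borel_measurable (\<pi> \<Otimes>\<^sub>M P)"
      by (rule borel_measurable_sum) simp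
    show ?thesis unfolding G_def case_prod_beta skl_def by measurable
  qed
  have "(\<integral>\<^sup>+\<omega>. \<integral>\<^sup>+A. G A \<omega> \<partial>\<pi> \<partial>P) = (\<integral>\<^sup>+A. \<integral>\<^sup>+\<omega>. G A \<omega> \<partial>P \<partial>\<pi>)"
    using G by (rule piP.Fubini')
  also have "\<dots> \<le> (\<integral>\<^sup>+A. ennreal (2 * sqrt (real n)) \<partial>\<pi>)"
  proof (rule nn_integral_mono)
    fix A assume "A \<in> space \<pi>"
    then have A: "A \<in> space Alg" by (simp add: space_pi)
    show "(\<integral>\<^sup>+\<omega>. G A \<omega> \<partial>P) \<le> ennreal (2 * sqrt (real n))"
      unfolding G_def meta_loss_def
      by (rule nn_integral_exp_skl_le[OF prob_env post_true_loss_meas_t[OF A] _ n_pos \<open>0 < s\<close>]) (use post_true_loss_range[OF A] in \<open>simp add: space_env\<close>)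
  qed
  finally have le: "(\<integral>\<^sup>+\<omega>. \<integral>\<^sup>+A. G A \<omega> \<partial>\<pi> \<partial>P) \<le> ennreal (2 * sqrt (real n))" by (simp add: pi.emeasure_space_1)
  \<comment> \<open>The moment bound 2 * sqrt n, divided by the allowed probability \<delta> /
    2.\<close>
  define c where "c = 4 * sqrt (real n) / \<delta>"
  have "0 < c" using n_pos \<open>0 < \<delta>\<close> by (simp add: c_def)
  have H: "(\<lambda>\<omega>. \<integral>\<^sup>+A. G A \<omega> \<partial>\<pi>) \<in> borel_measurable P"
    by (rule pi.borel_measurable_nn_integral)
      (use measurable_compose[OF measurable_pair_swap' G] in \<open>simp add: case_prod_beta\<close>)
  define C where "C = {\<omega>\<in>space P. ennreal c < (\<integral>\<^sup>+A. G A \<omega> \<partial>\<pi>)}"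
  have C: "C \<in> sets P" unfolding C_def using H by measurable
  have "ennreal c * emeasure P C = (\<integral>\<^sup>+\<omega>. ennreal c * indicator C \<omega> \<partial>P)"
    using C by (simp add: nn_integral_cmult_indicator)
  also have "\<dots> \<le> (\<integral>\<^sup>+\<omega>. \<integral>\<^sup>+A. G A \<omega> \<partial>\<pi> \<partial>P)"
    by (intro nn_integral_mono) (auto simp: C_def indicator_def)
  also note le
  finally have "ennreal (c * measure P C) \<le> ennreal (2 * sqrt (real n))"
    using \<open>0 < c\<close> by (simp add: P.emeasure_eq_measure ennreal_mult')
  then have "c * measure P C \<le> 2 * sqrt (real n)" by (subst (asm) ennreal_le_iff) auto
  then have "measure P C \<le> \<delta> / 2" using n_pos \<open>0 < \<delta>\<close> by (simp add: c_def field_simps)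
  then show ?thesis using C by (intro bexI[of _ C]) (auto simp: C_def G_def c_def not_less)
qed

definition penalty :: "(nat \<Rightarrow> ('z measure \<times> nat) \<times> (nat \<Rightarrow> 'z)) \<Rightarrow> ('a \<Rightarrow> 'f measure measure) \<Rightarrow> 'a \<Rightarrow> ennreal" where
  "penalty \<omega> Q A = e2ennreal (KLdiv (hyper_post_joint alg n \<omega> (Q A) A) (hyper_prior_joint F n (PP A)))"

text \<open>The threshold 2 / \<delta> for a moment of at most 1 gives the failure probability
  \<delta> / 2; the excess \<open>e\<close> comes from the finite approximation of the data.\<close>

lemma observation_level_bound:
  assumes "0 < s" "0 < \<delta>" "0 < e"
  shows "\<exists>C\<in>sets P. measure P C \<le> \<delta> / 2 + e \<and> (\<forall>\<omega>\<in>space P - C. \<forall>Q.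
    (\<forall>A\<in>space Alg. Q A \<in> space (prob_algebra (prob_algebra F))) \<longrightarrow> penalty \<omega> Q \<in> borel_measurable Alg \<longrightarrow>
    (\<integral>\<^sup>+A. ennreal ((if penalty \<omega> Q A = \<top> then 0 else exp (- enn2real (penalty \<omega> Q A))) * exp (post_exponent s A \<omega>)) \<partial>\<pi>) \<le> ennreal (2 / \<delta>))"
proof -
  let ?B = "real n * exponent_bound s"
  have lo: "exp (- ?B) \<le> g s x" and up: "g s x \<le> exp ?B" if "x \<in> space (Fn \<Otimes>\<^sub>M P)" for x
    using sum_exponent_bound[OF \<open>0 < s\<close> that] by (auto simp: g_def abs_le_iff)
  have mu: "mu A \<in> space (prob_algebra Fn)" if "A \<in> space \<pi>" for A using that mu_in by (simp add: space_pi)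
  have "0 < 2 / \<delta>" using \<open>0 < \<delta>\<close> by simp
  from pac_bayes_nonmeasurable_prior[OF prob_P prob_pi Kn_meas g_meas exp_gt_zero lo up g_int[OF \<open>0 < s\<close>] mu \<open>0 < e\<close> this]
  obtain C where C1: "C \<in> sets P" and C: "measure P C \<le> 1 / (2 / \<delta>) + e \<and> (\<forall>\<omega>\<in>space P - C. \<forall>v\<in>borel_measurable \<pi>.
      (\<forall>A\<in>space \<pi>. 0 \<le> v A \<and> (\<forall>\<gamma>\<in>borel_measurable Fn. (\<exists>B. \<forall>f\<in>space Fn. \<bar>\<gamma> f\<bar> \<le> B) \<longrightarrow>
          v A * exp (\<integral>f. \<gamma> f \<partial>Kn (A, \<omega>)) \<le> (\<integral>f. exp (\<gamma> f) \<partial>mu A)))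
      \<longrightarrow> (\<integral>\<^sup>+A. ennreal (v A * exp (\<integral>f. ln (g s (f, \<omega>)) \<partial>Kn (A, \<omega>))) \<partial>\<pi>) \<le> ennreal (2 / \<delta>))"
    by (rule bexE)
  note main = mp[OF bspec[OF bspec[OF conjunct2[OF C]]]]
  show ?thesis
  proof (intro bexI[of _ C] conjI ballI allI impI)
    show "measure P C \<le> \<delta> / 2 + e" using conjunct1[OF C] by simp
    fix \<omega> Q assume \<omega>C: "\<omega> \<in> space P - C" and Q: "\<forall>A\<in>space Alg. Q A \<in> space (prob_algebra (prob_algebra F))"
      and pen: "penalty \<omega> Q \<in> borel_measurable Alg"
    from \<omega>C have \<omega>: "\<omega> \<in> space P" by simp
    define v where "v A = (if penalty \<omega> Q A = \<top> then 0 else exp (- enn2real (penalty \<omega> Q A)))" for A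
    have vm: "v \<in> borel_measurable \<pi>" unfolding v_def measurable_cong_sets[OF sets_pi refl] using pen by measurable
    have "0 \<le> v A \<and> (\<forall>\<gamma>\<in>borel_measurable Fn. (\<exists>B. \<forall>f\<in>space Fn. \<bar>\<gamma> f\<bar> \<le> B) \<longrightarrow>
          v A * exp (\<integral>f. \<gamma> f \<partial>Kn (A, \<omega>)) \<le> (\<integral>f. exp (\<gamma> f) \<partial>mu A))" if "A \<in> space \<pi>" for A
    proof (intro conjI ballI impI)
      show "0 \<le> v A" by (simp add: v_def)
      fix \<gamma> :: "(nat \<Rightarrow> 'f) \<Rightarrow> real" assume \<gamma>: "\<gamma> \<in> borel_measurable Fn" and "\<exists>B. \<forall>f\<in>space Fn. \<bar>\<gamma> f\<bar> \<le> B"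
      then obtain B where B: "\<And>fs. fs \<in> space Fn \<Longrightarrow> \<bar>\<gamma> fs\<bar> \<le> B" by blast
      have A: "A \<in> space Alg" using that by (simp add: space_pi)
      show "v A * exp (\<integral>f. \<gamma> f \<partial>Kn (A, \<omega>)) \<le> (\<integral>f. exp (\<gamma> f) \<partial>mu A)"
        unfolding v_def by (rule kl_penalty[OF A \<omega> Q[rule_format, OF A] \<gamma> B penalty_def[of \<omega> Q A]])
    qed
    then have "(\<integral>\<^sup>+A. ennreal (v A * exp (\<integral>f. ln (g s (f, \<omega>)) \<partial>Kn (A, \<omega>))) \<partial>\<pi>) \<le> ennreal (2 / \<delta>)"
      by (intro main[OF \<omega>C vm] ballI)
    moreover have "(\<integral>\<^sup>+A. ennreal (v A * exp (\<integral>f. ln (g s (f, \<omega>)) \<partial>Kn (A, \<omega>))) \<partial>\<pi>) = (\<integral>\<^sup>+A. ennreal (v A * exp (post_exponent s A \<omega>)) \<partial>\<pi>)"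
      by (intro nn_integral_cong) (simp add: Kn_integral[OF \<open>0 < s\<close> _ \<omega>] space_pi)
    ultimately show "(\<integral>\<^sup>+A. ennreal ((if penalty \<omega> Q A = \<top> then 0 else exp (- enn2real (penalty \<omega> Q A))) * exp (post_exponent s A \<omega>)) \<partial>\<pi>) \<le> ennreal (2 / \<delta>)"
      by (simp add: v_def)
  qed (fact C1)
qed

text \<open>The quantity that links the two levels: these risks are the witnesses p_i of the inner
  inverse, and their mean is the empirical side of the outer one.\<close>

definition task_true_risk :: "(nat \<Rightarrow> ('z measure \<times> nat) \<times> (nat \<Rightarrow> 'z)) \<Rightarrow> 'a measure \<Rightarrow> nat \<Rightarrow> real" where
  "task_true_risk \<omega> \<rho> i = (\<integral>A. post_true_loss A (\<omega> i) \<partial>\<rho>)"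

section \<open>Jensen's inequality over a fixed meta-posterior\<close>

context
  fixes \<rho> assumes \<rho>: "\<rho> \<in> space (prob_algebra Alg)"
begin

lemma prob_rho: "prob_space \<rho>" and sets_rho: "sets \<rho> = sets Alg"
  using \<rho> by (auto simp: space_prob_algebra)

lemma space_rho: "space \<rho> = space Alg" by (rule sets_eq_imp_space_eq[OF sets_rho])

lemma meas_rho: "h \<in> borel_measurable Alg \<Longrightarrow> h \<in> borel_measurable \<rho>"
  by (simp add: measurable_cong_sets[OF sets_rho refl])

lemma emp_risk_eq: "\<omega> \<in> space P \<Longrightarrow> i < n \<Longrightarrow> emp_risk l alg \<omega> \<rho> i = (\<integral>A. post_emp_loss A (\<omega> i) \<partial>\<rho>)"
  unfolding emp_risk_def Let_def
  by (intro Bochner_Integration.integral_cong refl) (simp add: post_emp_loss_eq space_rho space_P)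

lemma task_risk_eq: "task_risk l alg \<tau> \<rho> = (\<integral>A. meta_loss A \<partial>\<rho>)"
  unfolding task_risk_def meta_loss_def
  by (intro Bochner_Integration.integral_cong refl) (simp add: post_true_loss_eq space_rho space_env)

lemma emp_risk_range: "\<omega> \<in> space P \<Longrightarrow> i < n \<Longrightarrow> emp_risk l alg \<omega> \<rho> i \<in> {0..1}"
  unfolding emp_risk_eq by (rule prob_space.expectation_in_unit[OF prob_rho])
    (auto simp: space_rho intro!: meas_rho sec_Alg[OF post_emp_loss_meas] space_P dest: post_emp_loss_range space_P)

lemma task_true_risk_range: "\<omega> \<in> space P \<Longrightarrow> i < n \<Longrightarrow> task_true_risk \<omega> \<rho> i \<in> {0..1}"
  unfolding task_true_risk_def by (rule prob_space.expectation_in_unit[OF prob_rho])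
    (auto simp: space_rho intro!: meas_rho sec_Alg[OF post_true_loss_meas] space_P dest: post_true_loss_range space_P)

lemma task_risk_range: "task_risk l alg \<tau> \<rho> \<in> {0..1}"
  unfolding task_risk_eq by (rule prob_space.expectation_in_unit[OF prob_rho])
    (use meta_loss_range in \<open>auto simp: space_rho intro!: meas_rho meta_loss_meas\<close>)

lemma observation_level_jensen:
  assumes "0 < s" and \<omega>: "\<omega> \<in> space P"
  shows "(\<Sum>i<n. real (snd (fst (\<omega> i))) * skl s (emp_risk l alg \<omega> \<rho> i) (task_true_risk \<omega> \<rho> i))
     \<le> (\<integral>A. post_exponent s A \<omega> \<partial>\<rho>) + (\<Sum>i<n. ln (2 * sqrt (real (snd (fst (\<omega> i))))))"
proof -
  interpret rho: prob_space \<rho> by (rule prob_rho)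
  have J: "skl s (emp_risk l alg \<omega> \<rho> i) (task_true_risk \<omega> \<rho> i) \<le> (\<integral>A. skl s (post_emp_loss A (\<omega> i)) (post_true_loss A (\<omega> i)) \<partial>\<rho>)"
    "integrable \<rho> (\<lambda>A. skl s (post_emp_loss A (\<omega> i)) (post_true_loss A (\<omega> i)))" if "i < n" for i
  proof -
    have t: "\<omega> i \<in> space TS" using space_P[OF \<omega> that] .
    note m = meas_rho[OF sec_Alg[OF post_emp_loss_meas t]] meas_rho[OF sec_Alg[OF post_true_loss_meas t]]
    have r: "A \<in> space \<rho> \<Longrightarrow> post_emp_loss A (\<omega> i) \<in> {0..1}" "A \<in> space \<rho> \<Longrightarrow> post_true_loss A (\<omega> i) \<in> {0..1}" for A
      using post_emp_loss_range[OF _ t] post_true_loss_range[OF _ t] by (simp_all add: space_rho)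
    show "skl s (emp_risk l alg \<omega> \<rho> i) (task_true_risk \<omega> \<rho> i) \<le> (\<integral>A. skl s (post_emp_loss A (\<omega> i)) (post_true_loss A (\<omega> i)) \<partial>\<rho>)"
      unfolding emp_risk_eq[OF \<omega> that] task_true_risk_def by (rule rho.skl_jensen(1)[OF m \<open>0 < s\<close> r])
    show "integrable \<rho> (\<lambda>A. skl s (post_emp_loss A (\<omega> i)) (post_true_loss A (\<omega> i)))"
      by (rule rho.skl_jensen(2)[OF m \<open>0 < s\<close> r])
  qed
  have post_exponent_int: "integrable \<rho> (\<lambda>A. post_exponent s A \<omega>)"
    using post_exponent_bound[OF \<open>0 < s\<close> _ \<omega>] meas_rho[OF post_exponent_meas[OF \<omega>]]
    by (intro rho.integrable_const_bound[where B="real n * exponent_bound s"] AE_I2) (auto simp: space_rho)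
  let ?c = "\<Sum>i<n. ln (2 * sqrt (real (snd (fst (\<omega> i)))))"
  let ?L = "\<lambda>A. \<Sum>i<n. real (snd (fst (\<omega> i))) * skl s (post_emp_loss A (\<omega> i)) (post_true_loss A (\<omega> i))"
  have iL: "integrable \<rho> ?L" using J(2) by (intro Bochner_Integration.integrable_sum integrable_mult_right) auto
  have "(\<Sum>i<n. real (snd (fst (\<omega> i))) * skl s (emp_risk l alg \<omega> \<rho> i) (task_true_risk \<omega> \<rho> i))
     \<le> (\<Sum>i<n. real (snd (fst (\<omega> i))) * (\<integral>A. skl s (post_emp_loss A (\<omega> i)) (post_true_loss A (\<omega> i)) \<partial>\<rho>))"
    using J(1) by (intro sum_mono mult_left_mono) auto
  also have "\<dots> = (\<integral>A. ?L A \<partial>\<rho>)" using J(2) by (subst Bochner_Integration.integral_sum) auto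
  also have "\<dots> \<le> (\<integral>A. post_exponent s A \<omega> + ?c \<partial>\<rho>)"
  proof (intro integral_mono iL Bochner_Integration.integrable_add post_exponent_int rho.integrable_const)
    fix A assume "A \<in> space \<rho>"
    then show "?L A \<le> post_exponent s A \<omega> + ?c"
      using post_exponent_lower[OF \<open>0 < s\<close> _ \<omega>, of A] unfolding space_rho by linarith
  qed
  also have "\<dots> = (\<integral>A. post_exponent s A \<omega> \<partial>\<rho>) + ?c" using post_exponent_int by (simp add: rho.prob_space)
  finally show ?thesis .
qed

lemma task_level_jensen:
  assumes "0 < s" and \<omega>: "\<omega> \<in> space P"
  shows "real n * skl s ((\<Sum>i<n. task_true_risk \<omega> \<rho> i) / real n) (task_risk l alg \<tau> \<rho>)
      \<le> (\<integral>A. real n * skl s ((\<Sum>i<n. post_true_loss A (\<omega> i)) / real n) (meta_loss A) \<partial>\<rho>)"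
    and "(\<lambda>A. real n * skl s ((\<Sum>i<n. post_true_loss A (\<omega> i)) / real n) (meta_loss A)) \<in> borel_measurable Alg"
    and "A \<in> space Alg \<Longrightarrow> \<bar>real n * skl s ((\<Sum>i<n. post_true_loss A (\<omega> i)) / real n) (meta_loss A)\<bar> \<le> real n * (2 * (1 + s + \<bar>ln s\<bar>))"
proof -
  interpret rho: prob_space \<rho> by (rule prob_rho)
  have pm: "(\<lambda>A. post_true_loss A (\<omega> i)) \<in> borel_measurable Alg" if "i < n" for i
    by (rule sec_Alg[OF post_true_loss_meas space_P[OF \<omega> that]])
  have pr: "post_true_loss A (\<omega> i) \<in> {0..1}" if "i < n" "A \<in> space Alg" for A i
    using post_true_loss_range[OF that(2) space_P[OF \<omega> that(1)]] .
  have avm: "(\<lambda>A. (\<Sum>i<n. post_true_loss A (\<omega> i)) / real n) \<in> borel_measurable Alg"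
    using pm by (intro borel_measurable_divide borel_measurable_sum) auto
  have avr: "(\<Sum>i<n. post_true_loss A (\<omega> i)) / real n \<in> {0..1}" if "A \<in> space Alg" for A
  proof -
    have "0 \<le> (\<Sum>i<n. post_true_loss A (\<omega> i))" using pr that by (intro sum_nonneg) auto
    moreover have "(\<Sum>i<n. post_true_loss A (\<omega> i)) \<le> (\<Sum>i<n. 1)" using pr that by (intro sum_mono) auto
    ultimately show ?thesis using n_pos by simp
  qed
  have "integrable \<rho> (\<lambda>A. post_true_loss A (\<omega> i))" if "i < n" for i
    using rho.expectation_in_unit(1)[OF meas_rho[OF pm[OF that]]] pr[OF that] by (simp add: space_rho)
  then have av: "(\<integral>A. (\<Sum>i<n. post_true_loss A (\<omega> i)) / real n \<partial>\<rho>) = (\<Sum>i<n. task_true_risk \<omega> \<rho> i) / real n"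
    unfolding task_true_risk_def by simp
  have "skl s (\<integral>A. (\<Sum>i<n. post_true_loss A (\<omega> i)) / real n \<partial>\<rho>) (\<integral>A. meta_loss A \<partial>\<rho>)
     \<le> (\<integral>A. skl s ((\<Sum>i<n. post_true_loss A (\<omega> i)) / real n) (meta_loss A) \<partial>\<rho>)"
    using avr meta_loss_range by (intro rho.skl_jensen meas_rho avm meta_loss_meas \<open>0 < s\<close>) (simp_all add: space_rho)
  then show "real n * skl s ((\<Sum>i<n. task_true_risk \<omega> \<rho> i) / real n) (task_risk l alg \<tau> \<rho>)
      \<le> (\<integral>A. real n * skl s ((\<Sum>i<n. post_true_loss A (\<omega> i)) / real n) (meta_loss A) \<partial>\<rho>)"
    unfolding av task_risk_eq using n_pos by simp
  note [measurable] = avm meta_loss_meas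
  show "(\<lambda>A. real n * skl s ((\<Sum>i<n. post_true_loss A (\<omega> i)) / real n) (meta_loss A)) \<in> borel_measurable Alg"
    unfolding skl_def by measurable
  show "A \<in> space Alg \<Longrightarrow> \<bar>real n * skl s ((\<Sum>i<n. post_true_loss A (\<omega> i)) / real n) (meta_loss A)\<bar> \<le> real n * (2 * (1 + s + \<bar>ln s\<bar>))"
    unfolding abs_mult using skl_bounded[OF \<open>0 < s\<close> avr meta_loss_range] by (intro mult_mono) auto
qed

end

text \<open>Both moment bounds are independent of \<rho>. Outside the union of the two exceptional
  sets, change of measure and Jensen's inequality are deterministic statements about fixed data, so
  they hold for all meta-posteriors and hyper-posteriors at once.\<close>

lemma both_levels:
  assumes "0 < s" "0 < \<delta>" "0 < e"
  shows "\<exists>C\<in>sets P. measure P C \<le> \<delta> + e \<and> (\<forall>\<omega>\<in>space P - C. \<forall>\<rho>\<in>space (prob_algebra Alg). \<forall>Q.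
    (\<forall>A\<in>space Alg. Q A \<in> space (prob_algebra (prob_algebra F))) \<longrightarrow> penalty \<omega> Q \<in> borel_measurable Alg \<longrightarrow>
    ereal (\<Sum>i<n. real (snd (fst (\<omega> i))) * skl s (emp_risk l alg \<omega> \<rho> i) (task_true_risk \<omega> \<rho> i))
      \<le> KLdiv \<rho> \<pi> + enn2ereal (\<integral>\<^sup>+A. penalty \<omega> Q A \<partial>\<rho>) + ereal (ln (2 / \<delta>)) + ereal (\<Sum>i<n. ln (2 * sqrt (real (snd (fst (\<omega> i))))))
    \<and> ereal (real n * skl s ((\<Sum>i<n. task_true_risk \<omega> \<rho> i) / real n) (task_risk l alg \<tau> \<rho>)) \<le> KLdiv \<rho> \<pi> + ereal (ln (4 * sqrt (real n) / \<delta>)))"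
proof -
  from observation_level_bound[OF assms] obtain C1 where C1: "C1 \<in> sets P" "measure P C1 \<le> \<delta> / 2 + e"
    and H1: "\<And>\<omega> Q. \<omega> \<in> space P - C1 \<Longrightarrow> \<forall>A\<in>space Alg. Q A \<in> space (prob_algebra (prob_algebra F)) \<Longrightarrow> penalty \<omega> Q \<in> borel_measurable Alg \<Longrightarrow>
    (\<integral>\<^sup>+A. ennreal ((if penalty \<omega> Q A = \<top> then 0 else exp (- enn2real (penalty \<omega> Q A))) * exp (post_exponent s A \<omega>)) \<partial>\<pi>) \<le> ennreal (2 / \<delta>)"
    by blast
  from task_level_bound[OF assms(1,2)] obtain C2 where C2: "C2 \<in> sets P" "measure P C2 \<le> \<delta> / 2"
    and H2: "\<And>\<omega>. \<omega> \<in> space P - C2 \<Longrightarrow>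
      (\<integral>\<^sup>+A. ennreal (exp (real n * skl s ((\<Sum>i<n. post_true_loss A (\<omega> i)) / real n) (meta_loss A))) \<partial>\<pi>) \<le> ennreal (4 * sqrt (real n) / \<delta>)"
    by blast
  show ?thesis
  proof (intro bexI[of _ "C1 \<union> C2"] conjI ballI allI impI)
    show "C1 \<union> C2 \<in> sets P" using C1 C2 by blast
    show "measure P (C1 \<union> C2) \<le> \<delta> + e" using measure_Un_le[OF C1(1) C2(1)] C1(2) C2(2) by linarith
    fix \<omega> \<rho> Q assume \<omega>C: "\<omega> \<in> space P - (C1 \<union> C2)" and \<rho>: "\<rho> \<in> space (prob_algebra Alg)"
      and Q: "\<forall>A\<in>space Alg. Q A \<in> space (prob_algebra (prob_algebra F))" and pen: "penalty \<omega> Q \<in> borel_measurable Alg"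
    have \<omega>: "\<omega> \<in> space P" "\<omega> \<in> space P - C1" "\<omega> \<in> space P - C2" using \<omega>C by auto
    have sets: "sets \<rho> = sets \<pi>" using sets_rho[OF \<rho>] sets_pi by simp
    let ?c = "\<Sum>i<n. ln (2 * sqrt (real (snd (fst (\<omega> i)))))"
    have "ereal (\<Sum>i<n. real (snd (fst (\<omega> i))) * skl s (emp_risk l alg \<omega> \<rho> i) (task_true_risk \<omega> \<rho> i))
       \<le> ereal (\<integral>A. post_exponent s A \<omega> \<partial>\<rho>) + ereal ?c"
      using observation_level_jensen[OF \<rho> assms(1) \<omega>(1)] by simp
    also have "ereal (\<integral>A. post_exponent s A \<omega> \<partial>\<rho>) \<le> KLdiv \<rho> \<pi> + enn2ereal (\<integral>\<^sup>+A. penalty \<omega> Q A \<partial>\<rho>) + ereal (ln (2 / \<delta>))"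
      using post_exponent_bound[OF assms(1) _ \<omega>(1)] \<open>0 < \<delta>\<close> H1[OF \<omega>(2) Q pen]
      by (intro donsker_varadhan_penalty prob_pi prob_rho[OF \<rho>] sets measurable_cong_sets[OF sets_pi refl, THEN equalityD2, THEN subsetD] post_exponent_meas[OF \<omega>(1)] pen)
        (auto simp: space_pi)
    finally show "ereal (\<Sum>i<n. real (snd (fst (\<omega> i))) * skl s (emp_risk l alg \<omega> \<rho> i) (task_true_risk \<omega> \<rho> i))
      \<le> KLdiv \<rho> \<pi> + enn2ereal (\<integral>\<^sup>+A. penalty \<omega> Q A \<partial>\<rho>) + ereal (ln (2 / \<delta>)) + ereal ?c"
      by (simp add: add_right_mono)
    let ?X = "\<lambda>A. real n * skl s ((\<Sum>i<n. post_true_loss A (\<omega> i)) / real n) (meta_loss A)"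
    have "ereal (real n * skl s ((\<Sum>i<n. task_true_risk \<omega> \<rho> i) / real n) (task_risk l alg \<tau> \<rho>)) \<le> ereal (\<integral>A. ?X A \<partial>\<rho>)"
      using task_level_jensen(1)[OF \<rho> assms(1) \<omega>(1)] by simp
    \<comment> \<open>With penalty 0 the penalised inequality is the ordinary change of
      measure.\<close>
    also have "\<dots> \<le> KLdiv \<rho> \<pi> + enn2ereal (\<integral>\<^sup>+A. 0 \<partial>\<rho>) + ereal (ln (4 * sqrt (real n) / \<delta>))"
    proof (rule donsker_varadhan_penalty[OF prob_pi prob_rho[OF \<rho>] sets])
      show "?X \<in> borel_measurable \<pi>"
        using task_level_jensen(2)[OF \<rho> assms(1) \<omega>(1)] by (simp add: measurable_cong_sets[OF sets_pi refl])
      show "\<bar>?X A\<bar> \<le> real n * (2 * (1 + s + \<bar>ln s\<bar>))" if "A \<in> space \<pi>" for A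
        using task_level_jensen(3)[OF \<rho> assms(1) \<omega>(1)] that by (simp add: space_pi)
      show "0 < 4 * sqrt (real n) / \<delta>" using n_pos \<open>0 < \<delta>\<close> by simp
      show "(\<integral>\<^sup>+A. ennreal ((if (0::ennreal) = \<top> then 0 else exp (- enn2real 0)) * exp (?X A)) \<partial>\<pi>) \<le> ennreal (4 * sqrt (real n) / \<delta>)"
        using H2[OF \<omega>(3)] by simp
    qed simp
    finally show "ereal (real n * skl s ((\<Sum>i<n. task_true_risk \<omega> \<rho> i) / real n) (task_risk l alg \<tau> \<rho>)) \<le> KLdiv \<rho> \<pi> + ereal (ln (4 * sqrt (real n) / \<delta>))"
      by (simp add: zero_ennreal.rep_eq)
  qed
qed

end

section \<open>Inverting the divergences\<close>

lemma kl_refl: "kl p p = 0"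
  by (simp add: kl_def kl_term_def)

lemma kl_eq_skl:
  assumes "0 < p" "p < 1" shows "kl q p = ereal (skl 0 q p)"
  using assms by (simp add: kl_def kl_term_def skl_def zero_ereal_def)

text \<open>In its first argument the divergence is convex, nonnegative and zero at
  \<open>p\<close>, hence decreasing up to \<open>p\<close>. At p = 1 it is infinite for every
  smaller argument.\<close>

lemma kl_antimono:
  assumes "0 \<le> q" "q \<le> q'" "q' < p" "p \<le> 1"
  shows "kl q' p \<le> kl q p"
proof (cases "p = 1")
  case True
  then have "kl q p = \<infinity>" using assms by (auto simp: kl_def kl_term_def)
  then show ?thesis by simp
next
  case False
  then have p: "0 < p" "p < 1" using assms by auto
  define u where "u = (q' - q) / (p - q)"
  have u: "0 \<le> u" "u \<le> 1" using assms by (auto simp: u_def field_simps)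
  have "u * (p - q) = q' - q" using assms by (simp add: u_def)
  then have q': "q' = (1 - u) * q + u * p" by (simp add: algebra_simps)
  have "q * (ln 1 + 1) - p * 1 \<le> q * ln (q / p)"
    using assms p by (intro xlogx_tangent) auto
  moreover have "(1 - q) * (ln 1 + 1) - (1 - p) * 1 \<le> (1 - q) * ln ((1 - q) / (1 - p))"
    using assms p by (intro xlogx_tangent) auto
  ultimately have nonneg: "0 \<le> skl 0 q p" by (simp add: skl_def)
  have "skl 0 q' p \<le> (1 - u) * skl 0 q p + u * skl 0 p p"
    using convex_onD[OF skl_convex[of p 0], of u q p] u p assms by (simp add: q')
  also have "\<dots> = (1 - u) * skl 0 q p" using p by (simp add: skl_def)
  also have "\<dots> \<le> skl 0 q p" using u nonneg by (intro mult_left_le_one_le) auto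
  finally show ?thesis by (simp add: kl_eq_skl p)
qed

lemma kl_not_MInf: "kl q p \<noteq> - \<infinity>"
  by (simp add: kl_def kl_term_def)

lemma tendsto_sum_ereal_not_MInf:
  fixes f :: "'i \<Rightarrow> 'x \<Rightarrow> ereal"
  assumes "\<And>i. i \<in> I \<Longrightarrow> (f i \<longlongrightarrow> a i) net" "\<And>i. i \<in> I \<Longrightarrow> a i \<noteq> - \<infinity>"
  shows "((\<lambda>x. \<Sum>i\<in>I. f i x) \<longlongrightarrow> (\<Sum>i\<in>I. a i)) net"
proof -
  have "((\<lambda>x. \<Sum>i\<in>I. f i x) \<longlongrightarrow> (\<Sum>i\<in>I. a i)) net \<and> (\<Sum>i\<in>I. a i) \<noteq> - \<infinity>"
    using assms
  proof (induction I rule: infinite_finite_induct)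
    case (insert i I)
    then show ?case by (simp add: tendsto_add_ereal_nonneg)
  qed simp_all
  then show ?thesis ..
qed

text \<open>The risks \<open>r\<close> are feasible for the inner supremum \<open>v\<close>, so
  their mean is at most \<open>v\<close>. If R \<le> v, then \<open>v\<close> itself is feasible for
  the outer inverse, since kl v v = 0 \<le> b. If v < R, moving the first argument from the mean up
  to \<open>v\<close> lowers the divergence, so \<open>R\<close> is feasible.\<close>

lemma kl_inv_bound:
  assumes n: "n > 0" and r: "\<And>i. i < n \<Longrightarrow> r i \<in> {0..1}" and R: "R \<in> {0..1}" and "0 \<le> b"
    and obs: "(\<Sum>i<n. ereal (real (m i)) * kl (q i) (r i)) \<le> a"
    and task: "ereal (real n) * kl ((\<Sum>i<n. r i) / real n) R \<le> b"
  shows "ereal R \<le> kl_inv n (real_of_ereal (kl_inv_multi n m q a)) b"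
proof -
  define v where "v = kl_inv_multi n m q a"
  let ?av = "(\<Sum>i<n. r i) / real n"
  \<comment> \<open>Finiteness of \<open>v\<close> keeps \<open>real_of_ereal\<close> away from its
    default value at infinity.\<close>
  have "v \<le> ereal 1" unfolding v_def kl_inv_multi_def
  proof (rule Sup_least)
    fix x assume "x \<in> {ereal (1 / real n * (\<Sum>i<n. p i)) | p. (\<forall>i<n. p i \<in> {0..1}) \<and> (\<Sum>i<n. ereal (real (m i)) * kl (q i) (p i)) \<le> a}"
    then obtain p where x: "x = ereal (1 / real n * (\<Sum>i<n. p i))" and p: "\<forall>i<n. p i \<in> {0..1}" by blast
    have "(\<Sum>i<n. p i) \<le> (\<Sum>i<n. 1)" using p by (intro sum_mono) auto
    then show "x \<le> ereal 1" using n by (simp add: x field_simps)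
  qed
  moreover have av_le: "ereal ?av \<le> v" unfolding v_def kl_inv_multi_def
    by (rule Sup_upper) (use r obs in \<open>auto intro!: exI[of _ r]\<close>)
  ultimately obtain v' where v': "v = ereal v'" by (cases v) auto
  have av0: "0 \<le> ?av" using r by (intro divide_nonneg_nonneg sum_nonneg) auto
  have v: "?av \<le> v'" "v' \<le> 1" using av_le \<open>v \<le> ereal 1\<close> by (simp_all add: v')
  show ?thesis
  proof (cases "R \<le> v'")
    case True
    have "ereal v' \<le> kl_inv n v' b" unfolding kl_inv_def
      by (rule Sup_upper) (use v av0 \<open>0 \<le> b\<close> in \<open>auto simp: kl_refl\<close>)
    then show ?thesis using True by (auto simp: v_def[symmetric] v' intro: order_trans[rotated])
  next
    case False
    then have "kl v' R \<le> kl ?av R" using av0 v R by (intro kl_antimono) auto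
    then have "ereal (real n) * kl v' R \<le> ereal (real n) * kl ?av R" by (intro ereal_mult_left_mono) auto
    then have "ereal R \<le> kl_inv n v' b" unfolding kl_inv_def
      using R task by (intro Sup_upper) auto
    then show ?thesis by (simp add: v_def[symmetric] v')
  qed
qed

text \<open>Intersecting the good events over all \<open>k\<close> could accumulate their failure
  probabilities. Points that are good for infinitely many \<open>k\<close> lose nothing: the unions
  over j \<ge> k decrease in \<open>k\<close>, each has probability at least 1 - d because e j tends
  to 0, and continuity from above applies.\<close>

lemma (in prob_space) limsup_event:
  assumes C: "\<And>k. C k \<in> sets M" and le: "\<And>k. measure M (C k) \<le> d + e k" and e: "e \<longlonglongrightarrow> 0"
  shows "1 - d \<le> measure M (\<Inter>k. \<Union>j\<in>{k..}. space M - C j)" "(\<Inter>k::nat. \<Union>j\<in>{k..}. space M - C j) \<in> sets M"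
proof -
  let ?U = "\<lambda>k. \<Union>j\<in>{k..}. space M - C j"
  have U: "?U k \<in> sets M" for k using C by (intro sets.countable_UN') auto
  then show "(\<Inter>k. ?U k) \<in> sets M" by (intro sets.countable_INT) auto
  have dec: "decseq ?U" unfolding decseq_def by (intro allI impI UN_mono) auto
  have "1 - d \<le> measure M (?U k)" for k
  proof (rule LIMSEQ_le_const2)
    show "(\<lambda>j. 1 - (d + e j)) \<longlonglongrightarrow> 1 - d" using e by (auto intro!: tendsto_eq_intros)
    show "\<exists>N. \<forall>j\<ge>N. 1 - (d + e j) \<le> measure M (?U k)"
    proof (intro exI[of _ k] allI impI)
      fix j assume "k \<le> j"
      have "1 - (d + e j) \<le> measure M (space M - C j)" using le[of j] C[of j] by (simp add: prob_compl)
      also have "\<dots> \<le> measure M (?U k)" using \<open>k \<le> j\<close> U by (intro finite_measure_mono) auto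
      finally show "1 - (d + e j) \<le> measure M (?U k)" .
    qed
  qed
  moreover have "(\<lambda>k. measure M (?U k)) \<longlonglongrightarrow> measure M (\<Inter>k. ?U k)"
    using U dec by (intro finite_Lim_measure_decseq) auto
  ultimately show "1 - d \<le> measure M (\<Inter>k. ?U k)" by (intro LIMSEQ_le_const) auto
qed

lemma frequently_le_tendsto_le:
  fixes f :: "nat \<Rightarrow> ereal"
  assumes "f \<longlonglongrightarrow> L" "\<And>k. \<exists>j\<ge>k. f j \<le> b"
  shows "L \<le> b"
proof (rule ccontr)
  assume "\<not> L \<le> b"
  then have "eventually (\<lambda>j. b < f j) sequentially" using order_tendstoD(1)[OF assms(1)] by simp
  then obtain N where "\<And>j. N \<le> j \<Longrightarrow> b < f j" by (auto simp: eventually_sequentially)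
  with assms(2)[of N] show False by (auto simp: not_less[symmetric])
qed

theorem theorem6:
  fixes Z :: "'z measure" and F :: "'f measure" and Alg :: "'a measure"
    and l :: "'f \<Rightarrow> 'z \<Rightarrow> real" and alg :: "'a \<Rightarrow> 'z list \<Rightarrow> 'f measure"
    and tau0 :: "('z measure \<times> nat) measure" and mmax n :: nat
    and \<pi> :: "'a measure" and PP :: "'a \<Rightarrow> 'f measure measure" and \<delta> :: real
  assumes tau0: "prob_space tau0"
    and tau0_sets: "sets tau0 = sets (prob_algebra Z \<Otimes>\<^sub>M count_space {1..mmax})"
    and loss_meas: "(\<lambda>(f, z). l f z) \<in> borel_measurable (F \<Otimes>\<^sub>M Z)"
    and loss_range: "\<And>f z. f \<in> space F \<Longrightarrow> z \<in> space Z \<Longrightarrow> 0 \<le> l f z \<and> l f z \<le> 1"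
    and alg_meas: "\<And>m. m \<in> {1..mmax} \<Longrightarrow>
          (\<lambda>(A, S). alg A (dataset m S)) \<in> measurable (Alg \<Otimes>\<^sub>M (\<Pi>\<^sub>M i\<in>UNIV. Z)) (prob_algebra F)"
    and meta_prior: "\<pi> \<in> space (prob_algebra Alg)"
    and hyper_prior: "\<And>A. A \<in> space Alg \<Longrightarrow> PP A \<in> space (prob_algebra (prob_algebra F))"
    and n_pos: "n > 0"
    and delta_pos: "\<delta> > 0"
  shows "\<exists>E \<in> sets (\<Pi>\<^sub>M i\<in>{..<n}. env tau0 Z mmax).
           measure (\<Pi>\<^sub>M i\<in>{..<n}. env tau0 Z mmax) E \<ge> 1 - \<delta> \<and>
           (\<forall>\<omega>\<in>E. \<forall>\<rho>\<in>space (prob_algebra Alg). \<forall>Q.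
              ((\<forall>A\<in>space Alg. Q A \<in> space (prob_algebra (prob_algebra F))) \<and>
               (\<lambda>A. e2ennreal (KLdiv (hyper_post_joint alg n \<omega> (Q A) A) (hyper_prior_joint F n (PP A))))
                  \<in> borel_measurable Alg)
              \<longrightarrow>
              ereal (task_risk l alg (env tau0 Z mmax) \<rho>)
                \<le> kl_inv n
                     (real_of_ereal
                        (kl_inv_multi n (\<lambda>i. snd (fst (\<omega> i))) (\<lambda>i. emp_risk l alg \<omega> \<rho> i)
                           (KLdiv \<rho> \<pi>
                            + enn2ereal (\<integral>\<^sup>+ A. e2ennreal (KLdiv (hyper_post_joint alg n \<omega> (Q A) A)
                                                            (hyper_prior_joint F n (PP A))) \<partial>\<rho>)
                            + ereal (ln (2 / \<delta>))
                            + ereal (\<Sum>i<n. ln (2 * sqrt (real (snd (fst (\<omega> i)))))))))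
                     (KLdiv \<rho> \<pi> + ereal (ln (4 * sqrt (real n) / \<delta>))))"
proof -
  interpret meta_learning Z F Alg l alg tau0 mmax n \<pi> PP
    by (rule meta_learning.intro[OF assms(1-8)])
  interpret P: prob_space "\<Pi>\<^sub>M i\<in>{..<n}. env tau0 Z mmax" by (rule prob_P)
  show ?thesis
  proof (cases "1 \<le> \<delta>")
    \<comment> \<open>For \<delta> \<ge> 1 the empty event suffices. In the other case \<delta> < 1
      makes the budget of the outer inverse nonnegative, as \<open>kl_inv_bound\<close>
      requires.\<close>
    case True
    then show ?thesis by (intro bexI[of _ "{}"]) auto
  next
    case False
    \<comment> \<open>One null sequence serves both as the shift and as the excess failure
      probability.\<close>
    define s where "s k = inverse (real (Suc k))" for k
    have s0: "0 < s k" for k by (simp add: s_def)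
    have s_lim: "s \<longlonglongrightarrow> 0" unfolding s_def by (rule LIMSEQ_inverse_real_of_nat)
    have s_right: "filterlim s (at_right 0) sequentially"
      using s_lim s0 by (intro tendsto_imp_filterlim_at_right) auto
    let ?obs = "\<lambda>k \<omega> \<rho>. ereal (\<Sum>i<n. real (snd (fst (\<omega> i))) * skl (s k) (emp_risk l alg \<omega> \<rho> i) (task_true_risk \<omega> \<rho> i))"
    let ?task = "\<lambda>k \<omega> \<rho>. ereal (real n * skl (s k) ((\<Sum>i<n. task_true_risk \<omega> \<rho> i) / real n) (task_risk l alg \<tau> \<rho>))"
    let ?a = "\<lambda>\<omega> \<rho> Q. KLdiv \<rho> \<pi> + enn2ereal (\<integral>\<^sup>+A. penalty \<omega> Q A \<partial>\<rho>) + ereal (ln (2 / \<delta>)) + ereal (\<Sum>i<n. ln (2 * sqrt (real (snd (fst (\<omega> i))))))"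
    let ?b = "\<lambda>\<rho>. KLdiv \<rho> \<pi> + ereal (ln (4 * sqrt (real n) / \<delta>))"
    let ?good = "\<lambda>k \<omega>. \<forall>\<rho>\<in>space (prob_algebra Alg). \<forall>Q.
      (\<forall>A\<in>space Alg. Q A \<in> space (prob_algebra (prob_algebra F))) \<longrightarrow> penalty \<omega> Q \<in> borel_measurable Alg \<longrightarrow>
      ?obs k \<omega> \<rho> \<le> ?a \<omega> \<rho> Q \<and> ?task k \<omega> \<rho> \<le> ?b \<rho>"
    have "\<forall>k. \<exists>C. C \<in> sets P \<and> measure P C \<le> \<delta> + s k \<and> (\<forall>\<omega>\<in>space P - C. ?good k \<omega>)"
    proof
      fix k show "\<exists>C. C \<in> sets P \<and> measure P C \<le> \<delta> + s k \<and> (\<forall>\<omega>\<in>space P - C. ?good k \<omega>)"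
        using both_levels[OF s0 delta_pos s0, of k k] unfolding Bex_def .
    qed
    then obtain C where "\<forall>k. C k \<in> sets P \<and> measure P (C k) \<le> \<delta> + s k \<and> (\<forall>\<omega>\<in>space P - C k. ?good k \<omega>)"
      by (rule choice[THEN exE])
    then have C: "\<And>k. C k \<in> sets P" "\<And>k. measure P (C k) \<le> \<delta> + s k"
      and good: "\<And>k. \<forall>\<omega>\<in>space P - C k. ?good k \<omega>" by simp_all
    define E where "E = (\<Inter>k. \<Union>j\<in>{k..}. space P - C j)"
    have E: "1 - \<delta> \<le> measure P E" "E \<in> sets P"
      unfolding E_def by (rule P.limsup_event[OF C s_lim])+
    show ?thesis
    proof (intro bexI[of _ E] conjI ballI allI impI E)
      fix \<omega> \<rho> Q
      assume \<omega>E: "\<omega> \<in> E" and \<rho>: "\<rho> \<in> space (prob_algebra Alg)"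
        and Q: "(\<forall>A\<in>space Alg. Q A \<in> space (prob_algebra (prob_algebra F))) \<and>
          (\<lambda>A. e2ennreal (KLdiv (hyper_post_joint alg n \<omega> (Q A) A) (hyper_prior_joint F n (PP A)))) \<in> borel_measurable Alg"
      have pen: "penalty \<omega> Q \<in> borel_measurable Alg"
        using conjunct2[OF Q] unfolding penalty_def[abs_def] .
      have ex: "\<exists>j\<ge>k. \<omega> \<in> space P - C j" for k using \<omega>E unfolding E_def by auto
      have \<omega>: "\<omega> \<in> space P" using ex[of 0] by auto
      have freq: "\<exists>j\<ge>k. ?obs j \<omega> \<rho> \<le> ?a \<omega> \<rho> Q \<and> ?task j \<omega> \<rho> \<le> ?b \<rho>" for k
      proof -
        from ex obtain j where j: "k \<le> j" "\<omega> \<in> space P - C j" by blast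
        have "?obs j \<omega> \<rho> \<le> ?a \<omega> \<rho> Q \<and> ?task j \<omega> \<rho> \<le> ?b \<rho>"
          by (rule mp[OF mp[OF spec[OF bspec[OF bspec[OF good j(2)] \<rho>]] conjunct1[OF Q]] pen])
        with j(1) show ?thesis by blast
      qed
      have lim: "(\<lambda>k. ereal (skl (s k) q p)) \<longlonglongrightarrow> kl q p" if "q \<in> {0..1}" "p \<in> {0..1}" for q p
        by (rule filterlim_compose[OF skl_tendsto_kl[OF that] s_right])
      have avg: "(\<Sum>i<n. task_true_risk \<omega> \<rho> i) / real n \<in> {0..1}"
      proof -
        have "0 \<le> (\<Sum>i<n. task_true_risk \<omega> \<rho> i)" using task_true_risk_range[OF \<rho> \<omega>] by (intro sum_nonneg) auto
        moreover have "(\<Sum>i<n. task_true_risk \<omega> \<rho> i) \<le> (\<Sum>i<n. 1)" using task_true_risk_range[OF \<rho> \<omega>] by (intro sum_mono) auto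
        ultimately show ?thesis using n_pos by simp
      qed
      have "(\<lambda>k. \<Sum>i<n. ereal (real (snd (fst (\<omega> i)))) * ereal (skl (s k) (emp_risk l alg \<omega> \<rho> i) (task_true_risk \<omega> \<rho> i)))
          \<longlonglongrightarrow> (\<Sum>i<n. ereal (real (snd (fst (\<omega> i)))) * kl (emp_risk l alg \<omega> \<rho> i) (task_true_risk \<omega> \<rho> i))"
        using emp_risk_range[OF \<rho> \<omega>] task_true_risk_range[OF \<rho> \<omega>] kl_not_MInf
        by (intro tendsto_sum_ereal_not_MInf tendsto_cmult_ereal lim) (auto simp: ereal_mult_eq_MInfty)
      then have obs_lim: "(\<lambda>k. ?obs k \<omega> \<rho>) \<longlonglongrightarrow> (\<Sum>i<n. ereal (real (snd (fst (\<omega> i)))) * kl (emp_risk l alg \<omega> \<rho> i) (task_true_risk \<omega> \<rho> i))"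
        by simp
      have "(\<lambda>k. ereal (real n) * ereal (skl (s k) ((\<Sum>i<n. task_true_risk \<omega> \<rho> i) / real n) (task_risk l alg \<tau> \<rho>)))
          \<longlonglongrightarrow> ereal (real n) * kl ((\<Sum>i<n. task_true_risk \<omega> \<rho> i) / real n) (task_risk l alg \<tau> \<rho>)"
        using avg task_risk_range[OF \<rho>] by (intro tendsto_cmult_ereal lim) auto
      then have task_lim: "(\<lambda>k. ?task k \<omega> \<rho>) \<longlonglongrightarrow> ereal (real n) * kl ((\<Sum>i<n. task_true_risk \<omega> \<rho> i) / real n) (task_risk l alg \<tau> \<rho>)"
        by simp
      have obs: "(\<Sum>i<n. ereal (real (snd (fst (\<omega> i)))) * kl (emp_risk l alg \<omega> \<rho> i) (task_true_risk \<omega> \<rho> i)) \<le> ?a \<omega> \<rho> Q"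
        by (rule frequently_le_tendsto_le[OF obs_lim]) (use freq in blast)
      have task: "ereal (real n) * kl ((\<Sum>i<n. task_true_risk \<omega> \<rho> i) / real n) (task_risk l alg \<tau> \<rho>) \<le> ?b \<rho>"
        by (rule frequently_le_tendsto_le[OF task_lim]) (use freq in blast)
      have "1 \<le> sqrt (real n)" using n_pos by simp
      then have "\<delta> \<le> 4 * sqrt (real n)" using False by linarith
      then have "1 \<le> 4 * sqrt (real n) / \<delta>" using delta_pos by (simp add: le_divide_eq)
      then have "0 \<le> ?b \<rho>"
        using KLdiv_nonneg[OF prob_pi prob_rho[OF \<rho>]] by (intro add_nonneg_nonneg) auto
      from kl_inv_bound[OF n_pos task_true_risk_range[OF \<rho> \<omega>] task_risk_range[OF \<rho>] this obs task]
      show "ereal (task_risk l alg (env tau0 Z mmax) \<rho>)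
                \<le> kl_inv n
                     (real_of_ereal
                        (kl_inv_multi n (\<lambda>i. snd (fst (\<omega> i))) (\<lambda>i. emp_risk l alg \<omega> \<rho> i)
                           (KLdiv \<rho> \<pi>
                            + enn2ereal (\<integral>\<^sup>+ A. e2ennreal (KLdiv (hyper_post_joint alg n \<omega> (Q A) A)
                                                            (hyper_prior_joint F n (PP A))) \<partial>\<rho>)
                            + ereal (ln (2 / \<delta>))
                            + ereal (\<Sum>i<n. ln (2 * sqrt (real (snd (fst (\<omega> i)))))))))
                     (KLdiv \<rho> \<pi> + ereal (ln (4 * sqrt (real n) / \<delta>)))"
        unfolding penalty_def .
    qed
  qed
qed

end
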